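(* The spin cosmological fields $X$ (convergence, first gravitational flexion, shear, second gravitational flexion; see context) have the form $$X(\chi,\theta,\varphi)=\sum_{\ell=s}^{\infty}\sum_{m=-\ell}^{\ell}a_{s,\ell m}(\chi)\,{}_sY_{\ell m}(\theta,\varphi),$$ where $s=0$ for the convergence, $s=1$ for the first gravitational flexion, $s=2$ for the shear, and $s=3$ for the second gravitational flexion. The sequence of (uncorrelated, mean-square continuous) stochastic processes $a_{s,\ell m}(\chi)$ satisfies $$\mathsf{E}[a_{s,\ell m}(\chi_1)\overline{a_{s,\ell'm'}(\chi_2)}]=\delta_{\ell\ell'}\delta_{mm'}C_{s\ell}(\chi_1,\chi_2)$$ with $$\sum_{\ell=s}^{\infty}(2\ell+1)C_{s\ell}(\chi,\chi)<\infty.$$ The correlation function $R(\chi_1,\theta_1,\varphi_1,\chi_2,\theta_2,\varphi_2)=\mathsf{E}[X(\chi_1,\theta_1,\varphi_1)\overline{X(\chi_2,\theta_2,\varphi_2)}]$ of a spin cosmological field has the form $$R(\chi_1,\theta_1,\varphi_1,\chi_2,\theta_2,\varphi_2)=\frac{1}{2\sqrt{\pi}}\sum_{\ell=s}^{\infty}C_{s\ell}(\chi_1,\chi_2)\sqrt{2\ell+1}\;{}_sY_{\ell,-s}(\beta,0)\,e^{-\mathrm{i}s(\alpha+\gamma)},$$ where $(\alpha,\beta,\gamma)$ are the Euler angles described in the context and $C_{s\ell}(\chi_1,\chi_2)$ is a sequence of nonnegative-definite kernels satisfying $$\sum_{\ell=s}^{\infty}(2\ell+1)C_{s\ell}(\chi,\chi)<\infty\qquad\text{and}\qquad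 C_{s\ell}(0,\chi)=0,\quad \ell\ne0.$$ The kernels $C_{s\ell}(\chi_1,\chi_2)$ may be calculated by $$C_{s\ell}(\chi_1,\chi_2)=\frac{4\pi^{3/2}}{\sqrt{2\ell+1}}\int_0^{\pi}R(\chi_1,0,0,\chi_2,\beta,0)\,\overline{{}_sY_{\ell,-s}(\beta,0)}\,\sin\beta\,\mathrm{d}\beta.$$
   Context: **Space.** The time slice is the $3$-dimensional space of constant curvature $K$, with coordinates $(\chi,\theta,\varphi)$ centred at the fundamental observer: $\chi$ is the comoving distance, running from $0$ to $\pi/\sqrt K$ if $K>0$ and from $0$ to $\infty$ otherwise, and $(\theta,\varphi)$ are spherical coordinates on the celestial sphere $\mathbb{S}^2$. Put $f_K(\chi)=(-K)^{-1/2}\sinh(\sqrt{-K}\chi)$ for $K<0$, $f_K(\chi)=\chi$ for $K=0$, $f_K(\chi)=K^{-1/2}\sin(\sqrt K\chi)$ for $K>0$. The isometry group $\mathcal{G}$ of the slice is $\mathrm{SO}_0(1,3)$ for $K<0$, $\mathrm{ISO}(3)$ for $K=0$, $\mathrm{SO}(4)$ for $K>0$. **Spin weighted spherical harmonics.** For $\ell\ge|s|$, $-\ell\le m\le\ell$, $${}_sY_{\ell m}(\theta,\varphi)=\sqrt{\frac{2\ell+1}{4\pi}}\,D^{(\ell)}_{-m,-s}(\varphi,\theta,0),$$ where the Wigner $D$-functions $D^{(\ell)}_{mn}$ are the matrix entries of the $(2\ell+1)$-dimensional irreducible unitary representation of $\mathrm{SO}(3)$ as functions of the Euler angles; explicitly,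 $${}_sY_{\ell m}(\theta,\varphi)=e^{\mathrm{i}m\varphi}(-1)^m\sqrt{\frac{(2\ell+1)(\ell+m)!(\ell-m)!}{4\pi(\ell+s)!(\ell-s)!}}\,\sin^{2\ell}(\theta/2)\sum_{u=\max\{0,m-s\}}^{\min\{\ell+m,\ell-s\}}\binom{\ell-s}{u}\binom{\ell+s}{u-m+s}(-1)^{\ell-u-s}\cot^{2u-m+s}(\theta/2).$$ **Line bundles.** For $s\in\mathbb{Z}$, $E_s$ is the quotient of $\mathrm{SO}(3)\times\mathbb{C}$ by the relation identifying $(g_1,z_1)$ and $(g_2,z_2)$ if there is $h=h_\varphi\in\mathrm{SO}(2)$ with $g_2=g_1h$ and $z_2=e^{-\mathrm{i}s\varphi}z_1$; with the projection $\pi(g,z)=g\,\mathrm{SO}(2)$ it is a homogeneous line bundle $(E_s,\pi,\mathbb{S}^2)$ over $\mathbb{S}^2=\mathrm{SO}(3)/\mathrm{SO}(2)$. The group $\mathrm{SO}(3)$ acts on $E_s$ by $g(g_0,z)=(gg_0,z)$. The functions ${}_sY_{\ell m}$ form a basis of the space of square-integrable sections of $E_s$ (functions of spin $s$). **Spin operators.** The spin raising operator $\eth$ and the spin lowering operator $\eth^*$ act by $\eth\,{}_sY_{\ell m}=\sqrt{(\ell-s)(\ell+s+1)}\,{}_{s+1}Y_{\ell m}$ and $\eth^*{}_sY_{\ell m}=-\sqrt{(\ell+s)(\ell-s+1)}\,{}_{s-1}Y_{\ell m}$, extended by linearity. **Spin cosmological fields.** The effective lensing potential of a source at $(\chi,\theta,\varphi)$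 is $$\psi(\chi,\theta,\varphi)=\frac{2}{f_K(\chi)}\int_0^{\chi}\frac{f_K(\chi-r)}{f_K(r)}\phi(t_0-t_L,r,\theta,\varphi)\,\mathrm{d}r,$$ where $t_0$ is the present cosmic time, $t_L$ is the look-back time (the difference between $t_0$ and the cosmic time when the photons were emitted), and the Newtonian gravitational potential $\phi$ solves $\Delta_K\phi=\frac{4\pi G}{c^2}\rho$, with $\Delta_K$ the Laplacian of the slice, $\rho$ the density of non-relativistic matter, $G$ Newton's gravitational constant and $c$ the speed of light. It is assumed that the effective lensing potential is a single realisation of a $\mathcal{G}$-invariant random field. The spin cosmological fields are the convergence $\kappa=\frac12\eth^*\eth\psi$ ($s=0$), the first gravitational flexion $F=\frac12\eth\eth^*\eth\psi$ ($s=1$), the shear $\gamma=\frac12\eth^2\psi$ ($s=2$) and the second gravitational flexion $G=\frac12\eth^3\psi$ ($s=3$). (The symbols $\gamma$ and $G$ for these fields are not to be confused with the Euler angle $\gamma$ and Newton's constant $G$.) Each such field $X$ is taken to be mean-square continuous with finite variance, and its restriction to the sphere of a fixed comoving radius $\chi_0$ centred at the fundamental observer is an isotropic random section of $(E_s,\pi,\mathbb{S}^2)$ with the corresponding $s$: the expected value $\mathsf{E}[X(\chi_0,\mathbf{n})]$, $\mathbf{n}\in\mathbb{S}^2$, is constant, and $$\mathsf{E}[X(\chi_0,g\mathbf{n}_1)\overline{X(\chi_0,g\mathbf{n}_2)}]=\mathsf{E}[X(\chi_0,\mathbf{n}_1)\overline{X(\chi_0,\mathbf{n}_2)}],\qquad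 g\in\mathrm{SO}(3).$$ **Euler angles.** $(\alpha,\beta,\gamma)$ are the Euler angles of the rotation which first rotates $(\theta_2,\varphi_2)$ into the north pole and then the north pole into $(\theta_1,\varphi_1)$. In fact, $\beta$ is the angle between $(\theta_1,\varphi_1)$ and $(\theta_2,\varphi_2)$, $\alpha$ is the angle between the great arc connecting these two points and the meridian passing through $(\theta_1,\varphi_1)$, and $\gamma$ is the angle between that great arc and the meridian passing through $(\theta_2,\varphi_2)$. **Kernels.** A kernel $C(\chi_1,\chi_2)$ is nonnegative-definite if $\sum_{i,j}c_i\overline{c_j}C(\chi_i,\chi_j)\ge0$ for all finite families of points $\chi_i$ in the range of $\chi$ and $c_i\in\mathbb{C}$.
   Formalization: The harmonics carry the phase (-1)^(m+s) instead of (-1)^m, as the printed formula makes variances negative for s=1,3; the Euler angles are those of g_2^{-1}g_1 (g_i takes the north pole to point i), so that β is the angle between the points. *)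

theory Defs
  imports "HOL-Probability.Probability"
begin

section \<open>The time slice and its isometry group\<close>

definition f_K :: "real \<Rightarrow> real \<Rightarrow> real" where
  "f_K K r =
     (if K < 0 then sinh (sqrt (- K) * r) / sqrt (- K)
      else if K = 0 then r
      else sin (sqrt K * r) / sqrt K)"

definition chi_range :: "real \<Rightarrow> real set" where
  "chi_range K = (if K > 0 then {0..pi / sqrt K} else {0..})"

definition height :: "real \<Rightarrow> real \<Rightarrow> real" where
  "height K r =
     (if K < 0 then cosh (sqrt (- K) * r) / sqrt (- K)
      else if K = 0 then 1
      else cos (sqrt K * r) / sqrt K)"

text \<open>The slice of curvature \<open>K\<close> is realised in \<open>real^4\<close>: as the sphere of radius
  \<open>1 / sqrt K\<close> for \<open>K > 0\<close>, as the affine hyperplane \<open>x\<^sub>1 = 1\<close> for \<open>K = 0\<close>, and as the upper sheet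
  of the hyperboloid \<open>x\<^sub>1\<^sup>2 - x\<^sub>2\<^sup>2 - x\<^sub>3\<^sup>2 - x\<^sub>4\<^sup>2 = - 1 / K\<close> for \<open>K < 0\<close>. Points are
  parametrised by the comoving distance \<open>r\<close> (the letter \<open>\<chi>\<close> is taken by the syntax of vectors)
  and the direction \<open>n\<close>; for \<open>r = 0\<close> the point does not depend on \<open>n\<close>.\<close>

definition lift4 :: "real \<Rightarrow> real^3 \<Rightarrow> real^4" where
  "lift4 t x = vector [t, x $ 1, x $ 2, x $ 3]"

definition slice_point :: "real \<Rightarrow> real \<Rightarrow> real^3 \<Rightarrow> real^4" where
  "slice_point K r n = lift4 (height K r) (f_K K r *\<^sub>R n)"

definition slice :: "real \<Rightarrow> (real^4) set" where
  "slice K = {slice_point K r n | r n. r \<in> chi_range K \<and> n \<in> sphere 0 1}"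

definition SO4 :: "(real^4^4) set" where
  "SO4 = {A. rotation_matrix A}"

definition ISO3 :: "(real^4^4) set" where
  "ISO3 = {A. \<exists>B::real^3^3. \<exists>v. rotation_matrix B \<and>
                (\<forall>t x. A *v lift4 t x = lift4 t (B *v x + t *\<^sub>R v))}"

definition minkowski :: "real^4^4" where
  "minkowski = (\<chi> i j. if i = j then (if i = 1 then 1 else - 1) else 0)"

text \<open>For a Lorentz matrix of determinant 1, membership in the identity component amounts to
  positivity of the time-time entry.\<close>

definition SO0_1_3 :: "(real^4^4) set" where
  "SO0_1_3 = {A. transpose A ** minkowski ** A = minkowski \<and> det A = 1 \<and> A $ 1 $ 1 > 0}"

definition isometry_group :: "real \<Rightarrow> (real^4^4) set" where
  "isometry_group K = (if K < 0 then SO0_1_3 else if K = 0 then ISO3 else SO4)"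


section \<open>Second order random fields\<close>

definition square_integrable_rv :: "'w measure \<Rightarrow> ('w \<Rightarrow> complex) \<Rightarrow> bool" where
  "square_integrable_rv M Z \<longleftrightarrow>
     Z \<in> borel_measurable M \<and> integrable M (\<lambda>\<omega>. (cmod (Z \<omega>))\<^sup>2)"

definition ms_continuous_on ::
    "'w measure \<Rightarrow> 'b::topological_space set \<Rightarrow> ('b \<Rightarrow> 'w \<Rightarrow> complex) \<Rightarrow> bool" where
  "ms_continuous_on M A Z \<longleftrightarrow>
     (\<forall>x\<in>A. square_integrable_rv M (Z x)) \<and>
     (\<forall>x\<in>A. ((\<lambda>y. LINT \<omega>|M. (cmod (Z y \<omega> - Z x \<omega>))\<^sup>2) \<longlongrightarrow> 0) (at x within A))"

definition invariant_random_field ::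
    "'w measure \<Rightarrow> real \<Rightarrow> (real^4 \<Rightarrow> 'w \<Rightarrow> real) \<Rightarrow> bool" where
  "invariant_random_field M K \<psi> \<longleftrightarrow>
     (\<lambda>(\<omega>, x). \<psi> x \<omega>) \<in> borel_measurable (M \<Otimes>\<^sub>M restrict_space borel (slice K)) \<and>
     (\<forall>x\<in>slice K. integrable M (\<lambda>\<omega>. (\<psi> x \<omega>)\<^sup>2)) \<and>
     (\<forall>g\<in>isometry_group K. \<forall>x\<in>slice K.
        (LINT \<omega>|M. \<psi> (g *v x) \<omega>) = (LINT \<omega>|M. \<psi> x \<omega>)) \<and>
     (\<forall>g\<in>isometry_group K. \<forall>x\<in>slice K. \<forall>y\<in>slice K.
        (LINT \<omega>|M. \<psi> (g *v x) \<omega> * \<psi> (g *v y) \<omega>) = (LINT \<omega>|M. \<psi> x \<omega> * \<psi> y \<omega>))"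

definition nonnegative_definite :: "real set \<Rightarrow> (real \<Rightarrow> real \<Rightarrow> complex) \<Rightarrow> bool" where
  "nonnegative_definite T C \<longleftrightarrow>
     (\<forall>(N::nat) (x::nat \<Rightarrow> real) (c::nat \<Rightarrow> complex). (\<forall>i<N. x i \<in> T) \<longrightarrow>
        (\<Sum>i<N. \<Sum>j<N. c i * cnj (c j) * C (x i) (x j)) \<in> \<real>\<^sub>\<ge>\<^sub>0)"


section \<open>Rotations and the line bundles\<close>

definition SO3 :: "(real^3^3) set" where
  "SO3 = {g. rotation_matrix g}"

definition Rz :: "real \<Rightarrow> real^3^3" where
  "Rz \<phi> = vector [vector [cos \<phi>, - sin \<phi>, 0], vector [sin \<phi>, cos \<phi>, 0], vector [0, 0, 1]]"

definition Ry :: "real \<Rightarrow> real^3^3" where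
  "Ry \<theta> = vector [vector [cos \<theta>, 0, sin \<theta>], vector [0, 1, 0], vector [- sin \<theta>, 0, cos \<theta>]]"

definition euler :: "real \<Rightarrow> real \<Rightarrow> real \<Rightarrow> real^3^3" where
  "euler \<alpha> \<beta> \<gamma> = Rz \<alpha> ** Ry \<beta> ** Rz \<gamma>"

definition north_pole :: "real^3" where
  "north_pole = vector [0, 0, 1]"

definition direction :: "real \<Rightarrow> real \<Rightarrow> real^3" where
  "direction \<theta> \<phi> = vector [sin \<theta> * cos \<phi>, sin \<theta> * sin \<phi>, cos \<theta>]"

type_synonym bundle_point = "(real^3^3) \<times> complex"

definition bundle_rel :: "int \<Rightarrow> (bundle_point \<times> bundle_point) set" where
  "bundle_rel s = {((g1, z1), (g2, z2)). g1 \<in> SO3 \<and> g2 \<in> SO3 \<and>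
     (\<exists>\<phi>. g2 = g1 ** Rz \<phi> \<and> z2 = cis (- (of_int s * \<phi>)) * z1)}"

definition line_bundle :: "int \<Rightarrow> bundle_point set set" where
  "line_bundle s = (SO3 \<times> UNIV) // bundle_rel s"

text \<open>The coset \<open>g SO(2)\<close>, with \<open>SO(2)\<close> the stabiliser of the north pole, is identified with the
  point \<open>g *v north_pole\<close> of the sphere.\<close>

definition bundle_proj :: "bundle_point set \<Rightarrow> real^3" where
  "bundle_proj p = (THE n. \<exists>g z. (g, z) \<in> p \<and> n = g *v north_pole)"

definition bundle_act :: "real^3^3 \<Rightarrow> bundle_point set \<Rightarrow> bundle_point set" where
  "bundle_act g p = (\<lambda>(g0, z). (g ** g0, z)) ` p"

text \<open>The complex coordinate of a point \<open>p\<close> of the fibre over \<open>g *v north_pole\<close>, relative to the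
  basis of this fibre determined by \<open>g\<close>.\<close>

definition fibre_coord :: "real^3^3 \<Rightarrow> bundle_point set \<Rightarrow> complex" where
  "fibre_coord g p = (THE z. (g, z) \<in> p)"

definition frame_value ::
    "(real^3 \<Rightarrow> 'w \<Rightarrow> bundle_point set) \<Rightarrow> real^3^3 \<Rightarrow> 'w \<Rightarrow> complex" where
  "frame_value Z g \<omega> = fibre_coord g (Z (g *v north_pole) \<omega>)"

text \<open>Over the point with spherical coordinates \<open>(\<theta>, \<phi>)\<close> the rotation \<open>euler \<phi> \<theta> 0\<close> is used as
  frame; this turns a family of sections, indexed by \<open>r\<close>, into a function of \<open>(r, \<theta>, \<phi>)\<close>.\<close>

definition field_value ::
    "(real \<Rightarrow> real^3 \<Rightarrow> 'w \<Rightarrow> bundle_point set) \<Rightarrow> real \<Rightarrow> real \<Rightarrow> real \<Rightarrow> 'w \<Rightarrow> complex" where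
  "field_value X r \<theta> \<phi> \<omega> = frame_value (X r) (euler \<phi> \<theta> 0) \<omega>"

definition random_section_field ::
    "'w measure \<Rightarrow> real \<Rightarrow> int \<Rightarrow> (real \<Rightarrow> real^3 \<Rightarrow> 'w \<Rightarrow> bundle_point set) \<Rightarrow> bool" where
  "random_section_field M K s X \<longleftrightarrow>
     (\<forall>r\<in>chi_range K. \<forall>n\<in>sphere 0 1. \<forall>\<omega>\<in>space M.
        X r n \<omega> \<in> line_bundle s \<and> bundle_proj (X r n \<omega>) = n) \<and>
     (\<lambda>(\<omega>, r, \<theta>, \<phi>). field_value X r \<theta> \<phi> \<omega>) \<in> borel_measurable
        (M \<Otimes>\<^sub>M restrict_space borel (chi_range K \<times> {0..pi} \<times> {0..2 * pi}))"

text \<open>\<open>g\<close> acts on a section by \<open>n \<mapsto> g\<inverse> (Z (g n))\<close>, which is again a section, so that its values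
  at \<open>n\<close> can be compared with those of \<open>Z\<close> at \<open>n\<close>.\<close>

definition rotated_section ::
    "real^3^3 \<Rightarrow> (real^3 \<Rightarrow> 'w \<Rightarrow> bundle_point set) \<Rightarrow>
       real^3 \<Rightarrow> 'w \<Rightarrow> bundle_point set" where
  "rotated_section g Z n \<omega> = bundle_act (transpose g) (Z (g *v n) \<omega>)"

definition isotropic_section ::
    "'w measure \<Rightarrow> (real^3 \<Rightarrow> 'w \<Rightarrow> bundle_point set) \<Rightarrow> bool" where
  "isotropic_section M Z \<longleftrightarrow>
     (\<forall>g\<in>SO3. \<forall>g1\<in>SO3.
        (LINT \<omega>|M. frame_value (rotated_section g Z) g1 \<omega>) = (LINT \<omega>|M. frame_value Z g1 \<omega>)) \<and>
     (\<forall>g\<in>SO3. \<forall>g1\<in>SO3. \<forall>g2\<in>SO3.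
        (LINT \<omega>|M. frame_value (rotated_section g Z) g1 \<omega> *
                    cnj (frame_value (rotated_section g Z) g2 \<omega>)) =
        (LINT \<omega>|M. frame_value Z g1 \<omega> * cnj (frame_value Z g2 \<omega>)))"

definition correlation ::
    "'w measure \<Rightarrow> (real \<Rightarrow> real^3 \<Rightarrow> 'w \<Rightarrow> bundle_point set) \<Rightarrow>
       real \<Rightarrow> real \<Rightarrow> real \<Rightarrow> real \<Rightarrow> real \<Rightarrow> real \<Rightarrow> complex" where
  "correlation M X r1 \<theta>1 \<phi>1 r2 \<theta>2 \<phi>2 =
     (LINT \<omega>|M. field_value X r1 \<theta>1 \<phi>1 \<omega> * cnj (field_value X r2 \<theta>2 \<phi>2 \<omega>))"

text \<open>With \<open>g\<^sub>i = euler \<phi>\<^sub>i \<theta>\<^sub>i 0\<close>, the inverse of \<open>g\<^sub>2\<close> rotates the second point into the north pole and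
  \<open>g\<^sub>1\<close> rotates the north pole into the first point. The product taken in this order is the one whose
  middle Euler angle is the angle between the two points.\<close>

definition relative_euler_angles ::
    "real \<Rightarrow> real \<Rightarrow> real \<Rightarrow> real \<Rightarrow> real \<Rightarrow> real \<Rightarrow> real \<Rightarrow> bool" where
  "relative_euler_angles \<theta>1 \<phi>1 \<theta>2 \<phi>2 \<alpha> \<beta> \<gamma> \<longleftrightarrow>
     \<beta> \<in> {0..pi} \<and> euler \<alpha> \<beta> \<gamma> = transpose (euler \<phi>2 \<theta>2 0) ** euler \<phi>1 \<theta>1 0"


section \<open>Spin weighted spherical harmonics and spin operators\<close>

text \<open>Compared with the usual formula, \<open>sin\<^sup>2\<^sup>l\<close> times the power of \<open>cot\<close> is written as a product of
  powers of \<open>cos\<close> and \<open>sin\<close> with nonnegative exponents, so that the formula is also correct at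
  \<open>\<theta> = 0\<close>, where \<open>cot\<close> is undefined. The phase is \<open>(-1)\<^bsup>m + s\<^esup>\<close>, so that \<open>sY s l (- s) 0 0 > 0\<close> for
  every \<open>s\<close>; it agrees with the usual \<open>(-1)\<^bsup>m\<^esup>\<close> for even \<open>s\<close> and differs by a global sign for odd
  \<open>s\<close>. As a function on \<open>SO(3)\<close>, \<open>sY s l m\<close> is \<open>sqrt ((2 * l + 1) / (4 * pi))\<close> times the complex
  conjugate of the Wigner function with indices \<open>m\<close>, \<open>- s\<close>.\<close>

definition sY :: "int \<Rightarrow> nat \<Rightarrow> int \<Rightarrow> real \<Rightarrow> real \<Rightarrow> complex" where
  "sY s l m \<theta> \<phi> =
     cis (of_int m * \<phi>) * of_real
       ((- 1) powi (m + s) *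
        sqrt (real (2 * l + 1) * fact (nat (int l + m)) * fact (nat (int l - m)) /
              (4 * pi * fact (nat (int l + s)) * fact (nat (int l - s)))) *
        (\<Sum>u\<in>{max 0 (m - s)..min (int l + m) (int l - s)}.
           real (nat (int l - s) choose nat u) * real (nat (int l + s) choose nat (u - m + s)) *
           (- 1) powi (int l - u - s) *
           cos (\<theta> / 2) ^ nat (2 * u - m + s) * sin (\<theta> / 2) ^ nat (2 * int l - (2 * u - m + s))))"

definition sphere_domain :: "(real \<times> real) set" where
  "sphere_domain = {0..pi} \<times> {0..2 * pi}"

definition L2_section :: "(real \<Rightarrow> real \<Rightarrow> complex) \<Rightarrow> bool" where
  "L2_section f \<longleftrightarrow>
     set_borel_measurable lborel sphere_domain (\<lambda>(\<theta>, \<phi>). f \<theta> \<phi>) \<and>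
     set_integrable lborel sphere_domain (\<lambda>(\<theta>, \<phi>). (cmod (f \<theta> \<phi>))\<^sup>2 * sin \<theta>)"

definition sY_coeff :: "int \<Rightarrow> (real \<Rightarrow> real \<Rightarrow> complex) \<Rightarrow> nat \<Rightarrow> int \<Rightarrow> complex" where
  "sY_coeff s f l m =
     (LINT x:sphere_domain|lborel.
        (case x of (\<theta>, \<phi>) \<Rightarrow> f \<theta> \<phi> * cnj (sY s l m \<theta> \<phi>) * of_real (sin \<theta>)))"

text \<open>The linear extension of a spin operator from the harmonics to square integrable sections is,
  in general, unbounded. It is the relation that holds between two square integrable sections if
  their expansions in the harmonics correspond to each other.\<close>

definition spin_raise :: "int \<Rightarrow> (real \<Rightarrow> real \<Rightarrow> complex) \<Rightarrow> (real \<Rightarrow> real \<Rightarrow> complex) \<Rightarrow> bool" where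
  "spin_raise s f h \<longleftrightarrow> L2_section f \<and> L2_section h \<and>
     (\<forall>l m. \<bar>s + 1\<bar> \<le> int l \<and> \<bar>m\<bar> \<le> int l \<longrightarrow>
        sY_coeff (s + 1) h l m =
          of_real (sqrt (of_int ((int l - s) * (int l + s + 1)))) * sY_coeff s f l m)"

definition spin_lower :: "int \<Rightarrow> (real \<Rightarrow> real \<Rightarrow> complex) \<Rightarrow> (real \<Rightarrow> real \<Rightarrow> complex) \<Rightarrow> bool" where
  "spin_lower s f h \<longleftrightarrow> L2_section f \<and> L2_section h \<and>
     (\<forall>l m. \<bar>s - 1\<bar> \<le> int l \<and> \<bar>m\<bar> \<le> int l \<longrightarrow>
        sY_coeff (s - 1) h l m =
          - of_real (sqrt (of_int ((int l + s) * (int l - s + 1)))) * sY_coeff s f l m)"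


section \<open>Spin cosmological fields\<close>

datatype field_kind = Convergence | First_Flexion | Shear | Second_Flexion

fun spin :: "field_kind \<Rightarrow> nat" where
  "spin Convergence = 0"
| "spin First_Flexion = 1"
| "spin Shear = 2"
| "spin Second_Flexion = 3"

fun derived_from_potential ::
    "field_kind \<Rightarrow> (real \<Rightarrow> real \<Rightarrow> complex) \<Rightarrow> (real \<Rightarrow> real \<Rightarrow> complex) \<Rightarrow> bool" where
  "derived_from_potential Convergence p f \<longleftrightarrow>
     (\<exists>f1 f2. spin_raise 0 p f1 \<and> spin_lower 1 f1 f2 \<and> f = (\<lambda>\<theta> \<phi>. f2 \<theta> \<phi> / 2))"
| "derived_from_potential First_Flexion p f \<longleftrightarrow>
     (\<exists>f1 f2 f3. spin_raise 0 p f1 \<and> spin_lower 1 f1 f2 \<and> spin_raise 0 f2 f3 \<and>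
        f = (\<lambda>\<theta> \<phi>. f3 \<theta> \<phi> / 2))"
| "derived_from_potential Shear p f \<longleftrightarrow>
     (\<exists>f1 f2. spin_raise 0 p f1 \<and> spin_raise 1 f1 f2 \<and> f = (\<lambda>\<theta> \<phi>. f2 \<theta> \<phi> / 2))"
| "derived_from_potential Second_Flexion p f \<longleftrightarrow>
     (\<exists>f1 f2 f3. spin_raise 0 p f1 \<and> spin_raise 1 f1 f2 \<and> spin_raise 2 f2 f3 \<and>
        f = (\<lambda>\<theta> \<phi>. f3 \<theta> \<phi> / 2))"

definition spin_cosmological_field ::
    "'w measure \<Rightarrow> real \<Rightarrow> field_kind \<Rightarrow> (real^4 \<Rightarrow> 'w \<Rightarrow> real) \<Rightarrow>
       (real \<Rightarrow> real^3 \<Rightarrow> 'w \<Rightarrow> bundle_point set) \<Rightarrow> bool" where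
  "spin_cosmological_field M K k \<psi> X \<longleftrightarrow>
     random_section_field M K (int (spin k)) X \<and>
     (\<forall>r\<in>chi_range K. AE \<omega> in M. derived_from_potential k
        (\<lambda>\<theta> \<phi>. of_real (\<psi> (slice_point K r (direction \<theta> \<phi>)) \<omega>))
        (\<lambda>\<theta> \<phi>. field_value X r \<theta> \<phi> \<omega>)) \<and>
     ms_continuous_on M (chi_range K \<times> SO3) (\<lambda>(r, g). frame_value (X r) g) \<and>
     (\<forall>r\<in>chi_range K. isotropic_section M (X r))"

end

theory Submission
  imports Defs
begin

text \<open>
  The coefficient processes are the harmonic coefficients
  \<open>a l m r = (\<integral> X r \<cdot> cnj (sY s l m))\<close> of the field on the sphere of radius \<open>r\<close>. As \<open>X\<close> arises from
  the potential by spin operators, \<open>a l m r\<close> is almost surely a constant multiple, depending only on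
  \<open>l\<close>, of the coefficient of the potential. Invariance makes the covariance of the potential on two
  spheres a measurable function of the angle between the directions, and the addition theorem with
  orthonormality shows that such a zonal kernel is diagonal in the harmonics with eigenvalues
  independent of \<open>m\<close>; this holds for polynomials in the cosine and extends to bounded Borel
  functions because moments determine a finite measure on a compact interval.

  For fixed \<open>r\<close> the function \<open>x \<mapsto> E (X r x \<cdot> cnj (a l m r))\<close> is continuous and has the same harmonic
  coefficients as \<open>C l r r \<cdot> sY s l m\<close>, hence equals it by completeness. So the mean square error of
  the partial sum over \<open>l \<le> N\<close> is the variance minus \<open>\<Sum>l\<le>N. C l r r (2 l + 1) / (4 pi)\<close>, the same
  at every point, and completeness applied to \<open>E (X r x \<cdot> cnj (X r y)) - \<Sum>l. C l r r K\<^sub>l x y\<close>,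
  with \<open>K\<^sub>l\<close> the sum over \<open>m\<close> in the addition theorem, shows that it tends to 0. The correlation
  function is the limit of the inner products of the partial sums.

  The harmonics are handled through the coefficients of
  \<open>(sin (\<theta>/2) + cos (\<theta>/2) x)\<^sup>p (cos (\<theta>/2) - sin (\<theta>/2) x)\<^sup>q\<close> with \<open>p = l + s\<close>, \<open>q = l - s\<close>.
\<close>

section \<open>Half-angle polynomials\<close>

text \<open>Isotropy of \<open>X\<close> is assumed on each sphere separately and relates nothing at
  two different radii, whereas \<open>C l r1 r2\<close> does; therefore cross-radius covariances are
  taken from the potential, for which one isometry rotates all spheres at once. Of the potential
  only joint measurability and second moments are given, no continuity in the angle, so its
  covariance kernel cannot be approximated uniformly by polynomials; hence the detour through
  moments and distribution functions. Mean-square continuity of \<open>X\<close> makes the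
  covariances of \<open>X\<close> continuous, and completeness is proved for continuous functions.
  These live on the closed coordinate rectangle, without periodicity in \<phi> or constancy at the
  poles. The polynomial \<open>wig_poly p q\<close> is the image of a monomial under a rotation
  acting on binary forms of degree \<open>p + q\<close>, written in an affine coordinate: its
  coefficients are Wigner d-functions up to normalisation. Differentiation in \<theta> and in the
  polynomial variable gives two first order relations that yield orthogonality and norms;
  multiplicativity yields the addition theorem.\<close>

definition wig_poly :: "nat \<Rightarrow> nat \<Rightarrow> real \<Rightarrow> real poly" where
  "wig_poly p q \<theta> = [:sin (\<theta> / 2), cos (\<theta> / 2):] ^ p * [:cos (\<theta> / 2), - sin (\<theta> / 2):] ^ q"

definition wig :: "nat \<Rightarrow> nat \<Rightarrow> nat \<Rightarrow> real \<Rightarrow> real" where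
  "wig p q k \<theta> = coeff (wig_poly p q \<theta>) k"

text \<open>Differentiating coefficient by coefficient lets the product and power rules treat all
  \<open>wig p q k\<close> at once, without expanding the product.\<close>

definition has_poly_deriv :: "(real \<Rightarrow> real poly) \<Rightarrow> real poly \<Rightarrow> real \<Rightarrow> bool" where
  "has_poly_deriv F F' x \<longleftrightarrow> (\<forall>k. ((\<lambda>t. coeff (F t) k) has_real_derivative coeff F' k) (at x))"

lemma has_poly_deriv_mult:
  assumes "has_poly_deriv F F' x" "has_poly_deriv G G' x"
  shows "has_poly_deriv (\<lambda>t. F t * G t) (F' * G x + F x * G') x"
  unfolding has_poly_deriv_def
proof
  fix k
  have F: "((\<lambda>t. coeff (F t) i) has_real_derivative coeff F' i) (at x)" for i
    using assms by (simp add: has_poly_deriv_def)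
  have G: "((\<lambda>t. coeff (G t) i) has_real_derivative coeff G' i) (at x)" for i
    using assms by (simp add: has_poly_deriv_def)
  have "((\<lambda>t. \<Sum>i\<le>k. coeff (F t) i * coeff (G t) (k - i)) has_real_derivative
        (\<Sum>i\<le>k. coeff F' i * coeff (G x) (k - i) + coeff G' (k - i) * coeff (F x) i)) (at x)"
    by (intro DERIV_sum DERIV_mult F G)
  then show "((\<lambda>t. coeff (F t * G t) k) has_real_derivative
      coeff (F' * G x + F x * G') k) (at x)"
    by (simp add: coeff_mult sum.distrib mult.commute[of "coeff G' _"])
qed

lemma has_poly_deriv_power:
  assumes "has_poly_deriv F F' x"
  shows "has_poly_deriv (\<lambda>t. F t ^ n) (of_nat n * F x ^ (n - 1) * F') x"
proof (induction n)
  case 0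
  then show ?case by (simp add: has_poly_deriv_def)
next
  case (Suc n)
  have "has_poly_deriv (\<lambda>t. F t * F t ^ n) (F' * F x ^ n + F x * (of_nat n * F x ^ (n - 1) * F')) x"
    by (intro has_poly_deriv_mult assms Suc)
  moreover have "F' * F x ^ n + F x * (of_nat n * F x ^ (n - 1) * F')
      = of_nat (Suc n) * F x ^ (Suc n - 1) * F'"
    by (cases n) (simp_all add: algebra_simps)
  ultimately show ?case by simp
qed

lemma has_poly_deriv_linear:
  assumes "(a has_real_derivative a') (at x)" "(b has_real_derivative b') (at x)"
  shows "has_poly_deriv (\<lambda>t. [:a t, b t:]) [:a', b':] x"
  using assms by (auto simp: has_poly_deriv_def coeff_pCons split: nat.splits)

text \<open>Each linear factor differentiates into half of the other one, \<open>A' = B / 2\<close>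
  and \<open>B' = - A / 2\<close>. The product rule therefore moves one factor from one power to the
  other, which changes the spin \<open>(p - q) / 2\<close> by one in either direction. The truncated
  \<open>p - 1\<close> and \<open>q - 1\<close> are harmless because of the factors \<open>p\<close>
  and \<open>q\<close>.\<close>

lemma wig_deriv:
  "((wig p q k) has_real_derivative
     (real p * wig (p - 1) (Suc q) k \<theta> - real q * wig (Suc p) (q - 1) k \<theta>) / 2) (at \<theta>)"
proof -
  let ?A = "\<lambda>t. [:sin (t / 2), cos (t / 2):] :: real poly"
  let ?B = "\<lambda>t. [:cos (t / 2), - sin (t / 2):] :: real poly"
  have A: "has_poly_deriv ?A (smult (1/2) (?B \<theta>)) \<theta>"
    by (auto intro!: has_poly_deriv_linear derivative_eq_intros)
  have B: "has_poly_deriv ?B (smult (- 1/2) (?A \<theta>)) \<theta>"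
    by (auto intro!: has_poly_deriv_linear derivative_eq_intros)
  have "has_poly_deriv (\<lambda>t. ?A t ^ p * ?B t ^ q)
     (of_nat p * ?A \<theta> ^ (p - 1) * smult (1/2) (?B \<theta>) * ?B \<theta> ^ q +
      ?A \<theta> ^ p * (of_nat q * ?B \<theta> ^ (q - 1) * smult (- 1/2) (?A \<theta>))) \<theta>"
    by (intro has_poly_deriv_mult has_poly_deriv_power A B)
  also have "of_nat p * ?A \<theta> ^ (p - 1) * smult (1/2) (?B \<theta>) * ?B \<theta> ^ q +
      ?A \<theta> ^ p * (of_nat q * ?B \<theta> ^ (q - 1) * smult (- 1/2) (?A \<theta>))
    = smult (real p / 2) (wig_poly (p - 1) (Suc q) \<theta>) - smult (real q / 2) (wig_poly (Suc p) (q - 1) \<theta>)"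
  proof -
    have h: "smult (real n / 2) P = smult (1/2) (of_nat n * P)" for n and P :: "real poly"
      by (simp add: of_nat_poly)
    show ?thesis
      unfolding h
      by (simp add: wig_poly_def algebra_simps del: mult_pCons_left mult_pCons_right smult_pCons)
  qed
  finally show ?thesis
    unfolding has_poly_deriv_def wig_def wig_poly_def[symmetric] 
    by (simp add: diff_divide_distrib)
qed

lemma coeff_X_pderiv: "coeff ([:0, 1:] * pderiv (P :: real poly)) k = real k * coeff P k"
  by (cases k) (simp_all add: coeff_pderiv coeff_pCons)

text \<open>The Euler operator \<open>X d/dX\<close> multiplies the coefficient of
  \<open>X^k\<close> by \<open>k\<close>; applied to the two linear factors it returns combinations
  of the same factors with coefficients \<open>cos \<theta>\<close> and \<open>sin \<theta>\<close>.
  Together with \<open>wig_deriv\<close> this separates the two shifted terms from each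
  other.\<close>

lemma wig_weight:
  "(2 * real k - real (p + q)) * wig p q k \<theta> =
     (real p - real q) * cos \<theta> * wig p q k \<theta> -
     sin \<theta> * (real p * wig (p - 1) (Suc q) k \<theta> + real q * wig (Suc p) (q - 1) k \<theta>)"
proof -
  define c where "c = cos (\<theta> / 2)"
  define \<sigma> where "\<sigma> = sin (\<theta> / 2)"
  define A :: "real poly" where "A = [:\<sigma>, c:]"
  define B :: "real poly" where "B = [:c, - \<sigma>:]"
  have cs: "c * c + \<sigma> * \<sigma> = 1" by (simp add: c_def \<sigma>_def flip: power2_eq_square)
  have C: "cos \<theta> = c * c - \<sigma> * \<sigma>" "sin \<theta> = 2 * c * \<sigma>"
    using cos_double[of "\<theta>/2"] sin_double[of "\<theta>/2"]
    by (simp_all add: c_def \<sigma>_def power2_eq_square)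
  have *: "c = c * (c * c) + c * (\<sigma> * \<sigma>)" "\<sigma> = \<sigma> * (c * c) + \<sigma> * (\<sigma> * \<sigma>)"
    using cs by algebra+
  have i: "smult 2 ([:0, 1:] * [:c:]) - A = smult (cos \<theta>) A - smult (sin \<theta>) B"
    using * by (simp add: A_def B_def C algebra_simps)
  have ii: "smult 2 ([:0, 1:] * [:- \<sigma>:]) - B = - (smult (cos \<theta>) B) - smult (sin \<theta>) A"
    using * by (simp add: A_def B_def C algebra_simps)
  define P where "P = smult (real p) (A ^ (p - 1) * B ^ q)"
  define Q where "Q = smult (real q) (A ^ p * B ^ (q - 1))"
  have W: "wig_poly p q \<theta> = A ^ p * B ^ q" for p q
    by (simp add: wig_poly_def A_def B_def c_def \<sigma>_def)
  have PA: "P * A = smult (real p) (wig_poly p q \<theta>)"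
    by (cases p) (simp_all add: P_def W mult_ac)
  have QB: "Q * B = smult (real q) (wig_poly p q \<theta>)"
    by (cases q) (simp_all add: Q_def W mult_ac)
  have PB: "P * B = smult (real p) (wig_poly (p - 1) (Suc q) \<theta>)"
    by (simp add: P_def W mult_ac)
  have QA: "Q * A = smult (real q) (wig_poly (Suc p) (q - 1) \<theta>)"
    by (simp add: Q_def W mult_ac)
  have dA': "pderiv A = [:c:]" and dB': "pderiv B = [:- \<sigma>:]"
    by (simp_all add: A_def B_def pderiv_pCons)
  have dA: "pderiv (A ^ p) = smult (real p) (A ^ (p - 1)) * [:c:]"
    by (simp only: pderiv_power dA' mult_smult_left)
  have dB: "pderiv (B ^ q) = smult (real q) (B ^ (q - 1)) * [:- \<sigma>:]"
    by (simp only: pderiv_power dB' mult_smult_left)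
  have d: "pderiv (wig_poly p q \<theta>) = P * [:c:] + Q * [:- \<sigma>:]"
    unfolding W pderiv_mult dA dB P_def Q_def
    by (simp only: mult_smult_left mult_smult_right mult_ac add_ac)
  have nW: "smult (real (p + q)) (wig_poly p q \<theta>) = P * A + Q * B"
    by (simp add: PA QB smult_add_left)
  \<comment> \<open>Given the relations \<open>i\<close> and \<open>ii\<close>, the identity holds
    in every commutative ring; with letters in place of the polynomials it is an ideal membership
    problem.\<close>
  have ring: "u * (x * D) - N = C * (P * A) - S * (P * B) - C * (Q * B) - S * (Q * A)"
    if "D = P * c' + Q * s'" "N = P * A + Q * B" "u * (x * c') - A = C * A - S * B"
      "u * (x * s') - B = - (C * B) - S * A" for u x D N C S c' s' :: "real poly"
    using that by algebra
  have sm: "smult a R = [:a:] * R" for a :: real and R by simp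
  have "smult 2 ([:0, 1:] * pderiv (wig_poly p q \<theta>)) - smult (real (p + q)) (wig_poly p q \<theta>)
     = smult (cos \<theta>) (P * A) - smult (sin \<theta>) (P * B) - smult (cos \<theta>) (Q * B) - smult (sin \<theta>) (Q * A)"
    using ring[OF d nW i[unfolded sm[of 2] sm[of _ A] sm[of _ B]]
       ii[unfolded sm[of 2] sm[of _ A] sm[of _ B]]]
    unfolding sm[of 2] sm[of "cos \<theta>"] sm[of "sin \<theta>"] .
  then have "coeff (smult 2 ([:0, 1:] * pderiv (wig_poly p q \<theta>)) - smult (real (p + q)) (wig_poly p q \<theta>)) k
    = coeff (smult (cos \<theta>) (P * A) - smult (sin \<theta>) (P * B) - smult (cos \<theta>) (Q * B) - smult (sin \<theta>) (Q * A)) k"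
    by simp
  then show ?thesis
    unfolding PA PB QB QA coeff_diff coeff_smult coeff_X_pderiv
    by (simp add: wig_def algebra_simps)
qed

lemma wig_continuous: "continuous_on A (wig p q k)"
  by (rule DERIV_continuous_on, rule DERIV_subset[OF wig_deriv]) simp

lemma wig_continuous_comp [continuous_intros]:
  "continuous_on A f \<Longrightarrow> continuous_on A (\<lambda>x. wig p q k (f x))"
  by (rule continuous_on_compose2[OF wig_continuous[of UNIV]]) auto

section \<open>Inner products over the polar angle: orthogonality and norms\<close>

definition wig_inner :: "nat \<Rightarrow> nat \<Rightarrow> nat \<Rightarrow> nat \<Rightarrow> nat \<Rightarrow> nat \<Rightarrow> real" where
  "wig_inner p q k p' q' k' = integral {0..pi} (\<lambda>\<theta>. sin \<theta> * (wig p q k \<theta> * wig p' q' k' \<theta>))"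

lemma wig_inner_commute: "wig_inner p q k p' q' k' = wig_inner p' q' k' p q k"
  by (simp add: wig_inner_def mult.commute)

lemma wig_inner_integrable:
  "(\<lambda>\<theta>. sin \<theta> * (wig p q k \<theta> * wig p' q' k' \<theta>)) integrable_on {0..pi}"
  by (intro integrable_continuous_real continuous_intros)

text \<open>Integration by parts: the derivative of \<open>sin \<theta>\<close> times both functions
  integrates to zero, as \<open>sin\<close> vanishes at both ends. \<open>wig_deriv\<close> produces
  four terms, of which \<open>wig_weight\<close> eliminates two; as the weights agree and the spins
  of the two functions differ by one, all multiples of \<open>cos \<theta>\<close> cancel. In effect
  spin raising and spin lowering are adjoint.\<close>

lemma wig_inner_shift:
  assumes s: "real p - real (Suc q) = real p' - real q'"
    and m: "2 * real k - real (p + Suc q) = 2 * real k' - real (p' + q')"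
  shows "real (Suc p) * wig_inner p (Suc q) k p' q' k' = real q' * wig_inner (Suc p) q k (Suc p') (q' - 1) k'"
proof -
  let ?f = "wig (Suc p) q k" and ?g = "wig p' q' k'"
  let ?f' = "\<lambda>\<theta>. (real (Suc p) * wig p (Suc q) k \<theta> - real q * wig (Suc (Suc p)) (q - 1) k \<theta>) / 2"
  let ?g' = "\<lambda>\<theta>. (real p' * wig (p' - 1) (Suc q') k' \<theta> - real q' * wig (Suc p') (q' - 1) k' \<theta>) / 2"
  have eq: "cos \<theta> * (?f \<theta> * ?g \<theta>) + sin \<theta> * (?f' \<theta> * ?g \<theta> + ?f \<theta> * ?g' \<theta>) =
      real (Suc p) * (sin \<theta> * (wig p (Suc q) k \<theta> * wig p' q' k' \<theta>)) -
      real q' * (sin \<theta> * (wig (Suc p) q k \<theta> * wig (Suc p') (q' - 1) k' \<theta>))" for \<theta>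
  proof -
    define S where "S = sin \<theta>"
    define C where "C = cos \<theta>"
    define F where "F = ?f \<theta>"
    define G where "G = ?g \<theta>"
    define F1 where "F1 = wig p (Suc q) k \<theta>"
    define F2 where "F2 = real q * wig (Suc (Suc p)) (q - 1) k \<theta>"
    define G1 where "G1 = real p' * wig (p' - 1) (Suc q') k' \<theta>"
    define G2 where "G2 = wig (Suc p') (q' - 1) k' \<theta>"
    define P where "P = real p"
    define Q where "Q = real q"
    define R where "R = real q'"
    define \<mu> where "\<mu> = 2 * real k' - real (p' + q')"
    have a: "\<mu> * F = (P + 1 - Q) * C * F - S * ((P + 1) * F1 + F2)"
    proof -
      have m': "2 * real k - real (Suc p + q) = \<mu>" using m by (simp add: \<mu>_def)
      show ?thesis
        using wig_weight[of k "Suc p" q \<theta>]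
        unfolding m' F_def C_def S_def F1_def F2_def P_def Q_def by (simp add: add.commute)
    qed
    have b: "\<mu> * G = (P - Q - 1) * C * G - S * (G1 + R * G2)"
      using wig_weight[of k' p' q' \<theta>] s
      by (simp add: G_def C_def S_def G1_def G2_def P_def Q_def \<mu>_def R_def)
    have "C * (F * G) + S * (((P + 1) * F1 - F2) / 2 * G + F * ((G1 - R * G2) / 2)) =
        (P + 1) * (S * (F1 * G)) - R * (S * (F * G2))"
    proof -
      have a': "S * F2 = (P + 1 - Q) * C * F - S * (P + 1) * F1 - \<mu> * F" using a by (simp add: algebra_simps)
      have b': "S * G1 = (P - Q - 1) * C * G - S * R * G2 - \<mu> * G" using b by (simp add: algebra_simps)
      have "C * (F * G) + S * (((P + 1) * F1 - F2) / 2 * G + F * ((G1 - R * G2) / 2)) =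
          C * (F * G) + ((P + 1) * S * F1 * G - (S * F2) * G + (S * G1) * F - R * S * F * G2) / 2"
        by (simp add: field_simps)
      also have "\<dots> = (P + 1) * (S * (F1 * G)) - R * (S * (F * G2))"
        unfolding a' b' by (simp add: field_simps)
      finally show ?thesis .
    qed
    then show ?thesis
      by (simp add: F_def C_def S_def F1_def F2_def P_def Q_def G_def G1_def G2_def R_def algebra_simps)
  qed
  have "((\<lambda>\<theta>. cos \<theta> * (?f \<theta> * ?g \<theta>) + sin \<theta> * (?f' \<theta> * ?g \<theta> + ?f \<theta> * ?g' \<theta>)) has_integral
      sin pi * (?f pi * ?g pi) - sin 0 * (?f 0 * ?g 0)) {0..pi}"
    by (intro fundamental_theorem_of_calculus)
      (auto intro!: derivative_eq_intros DERIV_subset[OF wig_deriv]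
         simp flip: has_real_derivative_iff_has_vector_derivative simp: algebra_simps)
  then have "((\<lambda>\<theta>. real (Suc p) * (sin \<theta> * (wig p (Suc q) k \<theta> * wig p' q' k' \<theta>)) -
      real q' * (sin \<theta> * (wig (Suc p) q k \<theta> * wig (Suc p') (q' - 1) k' \<theta>))) has_integral 0) {0..pi}"
    unfolding eq by simp
  moreover have "((\<lambda>\<theta>. real (Suc p) * (sin \<theta> * (wig p (Suc q) k \<theta> * wig p' q' k' \<theta>)) -
      real q' * (sin \<theta> * (wig (Suc p) q k \<theta> * wig (Suc p') (q' - 1) k' \<theta>))) has_integral
      (real (Suc p) * wig_inner p (Suc q) k p' q' k' - real q' * wig_inner (Suc p) q k (Suc p') (q' - 1) k')) {0..pi}"
    unfolding wig_inner_def
    by (intro has_integral_diff has_integral_mult_right integrable_integral wig_inner_integrable)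
  ultimately show ?thesis
    using has_integral_unique by (simp only: eq_iff_diff_eq_0[of "real (Suc p) * _"]) blast
qed

text \<open>Shifting a factor in the first function and shifting one in the second lead to the same
  inner product up to constants. Comparing them multiplies the inner product by
  \<open>q (p + 1)\<close> and by \<open>q' (p' + 1)\<close> with the same result, as for
  eigenvectors of a symmetric operator with distinct eigenvalues.\<close>

lemma wig_orthogonal:
  assumes s: "real p - real q = real p' - real q'"
    and m: "2 * real k - real (p + q) = 2 * real k' - real (p' + q')" and "p \<noteq> p'"
  shows "wig_inner p q k p' q' k' = 0"
proof (cases q)
  case 0
  \<comment> \<open>The first function has no factor left to shift, so the shift is applied to the
    second one; it then produces the constant \<open>q = 0\<close>.\<close>
  then obtain q'' where q': "q' = Suc q''" using s \<open>p \<noteq> p'\<close> by (cases q') auto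
  show ?thesis
    using wig_inner_shift[of p' q'' p q k' k] s m unfolding 0 q' by (simp add: wig_inner_commute)
next
  case (Suc r)
  note q = Suc
  have 1: "real (Suc p) * wig_inner p q k p' q' k' = real q' * wig_inner (Suc p) r k (Suc p') (q' - 1) k'"
    using wig_inner_shift[of p r p' q' k k'] s m unfolding q by simp
  show ?thesis
  proof (cases q')
    case 0
    then show ?thesis using 1 by simp
  next
    case (Suc r')
    have 2: "real (Suc p') * wig_inner p q k p' q' k' = real q * wig_inner (Suc p) r k (Suc p') r' k'"
      using wig_inner_shift[of p' r' p q k' k] s m unfolding q Suc by (simp add: wig_inner_commute)
    define I where "I = wig_inner p q k p' q' k'"
    have "real q * (real (Suc p) * I) = real q' * (real (Suc p') * I)"
      using 1 2 by (simp add: I_def Suc)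
    then have "(real q * real (Suc p) - real q' * real (Suc p')) * I = 0"
      by (simp add: algebra_simps)
    \<comment> \<open>For equal spins the difference of the two eigenvalues factors as
      \<open>(p - p') (p + q' + 1)\<close>.\<close>
    moreover have "real q * real (Suc p) - real q' * real (Suc p') \<noteq> 0"
    proof -
      have "real q * real (Suc p) - real q' * real (Suc p') = (real p - real p') * (real p + real q' + 1)"
        using s by (simp add: ring_distribs) algebra
      then show ?thesis using \<open>p \<noteq> p'\<close> by (simp add: add_nonneg_eq_0_iff)
    qed
    ultimately show ?thesis by (simp add: I_def)
  qed
qed

lemma cos_half_power_deriv:
  "((\<lambda>\<theta>. cos (\<theta> / 2) ^ n) has_real_derivative
     - (real n * cos (\<theta> / 2) ^ (n - 1) * sin (\<theta> / 2) / 2)) (at \<theta>)"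
  by (auto intro!: derivative_eq_intros)

lemma sin_half_power_deriv:
  "((\<lambda>\<theta>. sin (\<theta> / 2) ^ n) has_real_derivative
     real n * sin (\<theta> / 2) ^ (n - 1) * cos (\<theta> / 2) / 2) (at \<theta>)"
  by (auto intro!: derivative_eq_intros)

text \<open>With \<open>u = cos^2 (\<theta>/2)\<close> this is twice the Beta integral of
  \<open>u^k (1 - u)^(n - k)\<close>. The induction descends from \<open>k = n\<close>, where a
  primitive is explicit.\<close>

lemma cos_sin_half_integral:
  assumes "k \<le> n"
  shows "integral {0..pi} (\<lambda>\<theta>. sin \<theta> * (cos (\<theta> / 2) ^ (2 * k) * sin (\<theta> / 2) ^ (2 * (n - k))))
     = 2 * fact k * fact (n - k) / fact (Suc n)"
  using assms
proof (induction "n - k" arbitrary: k)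
  case 0
  then have k: "k = n" by simp
  have factor: "- 2 / N * - (K * x * y / 2) = K / N * x * y" for N K x y :: real
    by simp
  have "((\<lambda>\<theta>. sin \<theta> * cos (\<theta> / 2) ^ (2 * n)) has_integral
      (- 2 / (real n + 1) * cos (pi / 2) ^ (2 * n + 2) - (- 2 / (real n + 1) * cos (0 / 2) ^ (2 * n + 2)))) {0..pi}"
  proof (intro fundamental_theorem_of_calculus)
    fix \<theta> :: real
    have "((\<lambda>\<theta>. - 2 / (real n + 1) * cos (\<theta> / 2) ^ (2 * n + 2)) has_real_derivative
        - 2 / (real n + 1) * - (real (2 * n + 2) * cos (\<theta> / 2) ^ (2 * n + 2 - 1) * sin (\<theta> / 2) / 2)) (at \<theta>)"
      by (intro DERIV_cmult cos_half_power_deriv)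
    also have "- 2 / (real n + 1) * - (real (2 * n + 2) * cos (\<theta> / 2) ^ (2 * n + 2 - 1) * sin (\<theta> / 2) / 2)
       = (real (2 * n + 2) / (real n + 1)) * cos (\<theta> / 2) ^ (2 * n + 2 - 1) * sin (\<theta> / 2)"
      by (rule factor)
    also have "real (2 * n + 2) / (real n + 1) = 2"
      by (simp add: field_simps)
    also have "2 * cos (\<theta> / 2) ^ (2 * n + 2 - 1) * sin (\<theta> / 2) = sin \<theta> * cos (\<theta> / 2) ^ (2 * n)"
      using sin_double[of "\<theta>/2"] by simp
    finally show "((\<lambda>\<theta>. - 2 / (real n + 1) * cos (\<theta> / 2) ^ (2 * n + 2)) has_vector_derivative
        sin \<theta> * cos (\<theta> / 2) ^ (2 * n)) (at \<theta> within {0..pi})"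
      by (simp add: has_real_derivative_iff_has_vector_derivative has_vector_derivative_at_within)
  qed simp
  then have "integral {0..pi} (\<lambda>\<theta>. sin \<theta> * cos (\<theta> / 2) ^ (2 * n)) = 2 / (real n + 1)"
    by (simp add: has_integral_iff)
  then show ?case by (simp add: k add.commute)
next
  case (Suc d)
  then have kn: "k < n" by simp
  let ?I = "\<lambda>k. integral {0..pi} (\<lambda>\<theta>. sin \<theta> * (cos (\<theta> / 2) ^ (2 * k) * sin (\<theta> / 2) ^ (2 * (n - k))))"
  have IH: "?I (Suc k) = 2 * fact (Suc k) * fact (n - Suc k) / fact (Suc n)"
    by (rule Suc.hyps(1)) (use Suc.hyps(2) kn in auto)
  let ?h = "\<lambda>k \<theta>. sin \<theta> * (cos (\<theta> / 2) ^ (2 * k) * sin (\<theta> / 2) ^ (2 * (n - k)))"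
  \<comment> \<open>The primitive \<open>2 cos^(2 k + 2) sin^(2 (n - k))\<close> of half-angles
    vanishes at both ends because \<open>k < n\<close>; its derivative links the integrals for
    \<open>k\<close> and \<open>k + 1\<close>.\<close>
  have "((\<lambda>\<theta>. real (n - k) * ?h (Suc k) \<theta> - real (Suc k) * ?h k \<theta>) has_integral
      2 * (cos (pi / 2) ^ (2 * k + 2) * sin (pi / 2) ^ (2 * (n - k))) -
      2 * (cos (0 / 2) ^ (2 * k + 2) * sin (0 / 2) ^ (2 * (n - k)))) {0..pi}"
  proof (intro fundamental_theorem_of_calculus)
    fix \<theta> :: real
    obtain e where e: "n - k = Suc e" "n - Suc k = e" using kn by (metis Suc_diff_Suc)
    have "((\<lambda>\<theta>. 2 * (cos (\<theta> / 2) ^ (2 * k + 2) * sin (\<theta> / 2) ^ (2 * Suc e))) has_real_derivative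
      2 * (- (real (2 * k + 2) * cos (\<theta> / 2) ^ (2 * k + 2 - 1) * sin (\<theta> / 2) / 2) * sin (\<theta> / 2) ^ (2 * Suc e)
       + real (2 * Suc e) * sin (\<theta> / 2) ^ (2 * Suc e - 1) * cos (\<theta> / 2) / 2 * cos (\<theta> / 2) ^ (2 * k + 2))) (at \<theta>)"
      by (intro DERIV_cmult DERIV_mult cos_half_power_deriv sin_half_power_deriv)
    also have "2 * (- (real (2 * k + 2) * cos (\<theta> / 2) ^ (2 * k + 2 - 1) * sin (\<theta> / 2) / 2) * sin (\<theta> / 2) ^ (2 * Suc e)
       + real (2 * Suc e) * sin (\<theta> / 2) ^ (2 * Suc e - 1) * cos (\<theta> / 2) / 2 * cos (\<theta> / 2) ^ (2 * k + 2))
       = real (n - k) * ?h (Suc k) \<theta> - real (Suc k) * ?h k \<theta>"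
      unfolding e using sin_double[of "\<theta>/2"] by (simp add: field_simps)
    finally show "((\<lambda>\<theta>. 2 * (cos (\<theta> / 2) ^ (2 * k + 2) * sin (\<theta> / 2) ^ (2 * (n - k)))) has_vector_derivative
        (real (n - k) * ?h (Suc k) \<theta> - real (Suc k) * ?h k \<theta>)) (at \<theta> within {0..pi})"
      by (simp add: e has_real_derivative_iff_has_vector_derivative has_vector_derivative_at_within)
  qed simp
  then have "((\<lambda>\<theta>. real (n - k) * ?h (Suc k) \<theta> - real (Suc k) * ?h k \<theta>) has_integral 0) {0..pi}"
    using kn by (simp add: zero_power)
  moreover have "((\<lambda>\<theta>. real (n - k) * ?h (Suc k) \<theta> - real (Suc k) * ?h k \<theta>) has_integral
      (real (n - k) * ?I (Suc k) - real (Suc k) * ?I k)) {0..pi}"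
    by (intro has_integral_diff has_integral_mult_right integrable_integral integrable_continuous_real
         continuous_intros) auto
  ultimately have "real (n - k) * ?I (Suc k) - real (Suc k) * ?I k = 0"
    by (rule has_integral_unique[rotated])
  then have "real (n - k) * ?I (Suc k) = real (Suc k) * ?I k"
    by simp
  moreover have "(fact (n - k) :: real) = real (n - k) * fact (n - Suc k)"
    using kn by (metis Suc_diff_Suc fact_Suc of_nat_fact of_nat_mult)
  ultimately have "real (Suc k) * ?I k = real (Suc k) * (2 * fact k * fact (n - k) / fact (Suc n))"
    unfolding IH by (simp add: mult_ac del: distrib_left_numeral distrib_right_numeral)
  then show ?case by (simp only: mult_left_cancel[OF of_nat_neq_0])
qed

lemma coeff_linear_power:
  "coeff ([:a, b:] ^ n) k = of_nat (n choose k) * b ^ k * (a :: 'a :: comm_semiring_1) ^ (n - k)"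
proof -
  have "[:a, b:] = [:a:] + monom b 1" by (simp add: monom_altdef)
  then have "[:a, b:] ^ n = (\<Sum>j\<le>n. of_nat (n choose j) * (monom b 1) ^ j * [:a:] ^ (n - j))"
    by (simp add: add.commute[of "[:a:]"] binomial_ring)
  also have "\<dots> = (\<Sum>j\<le>n. monom (of_nat (n choose j) * b ^ j * a ^ (n - j)) j)"
    by (intro sum.cong refl)
      (simp add: monom_power poly_const_pow of_nat_poly smult_monom mult.commute mult.left_commute)
  finally show ?thesis by (simp add: coeff_sum if_distrib not_le binomial_eq_0 cong: if_cong)
qed

text \<open>\<open>wig_inner_shift\<close> with equal arguments trades a factor of the second kind
  for one of the first, down to \<open>q = 0\<close>. There \<open>wig\<close> is a single binomial
  term and its norm is the Beta integral above.\<close>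

lemma wig_norm:
  assumes "k \<le> p + q"
  shows "wig_inner p q k p q k = 2 * fact p * fact q / (real (p + q + 1) * fact k * fact (p + q - k))"
  using assms
proof (induction q arbitrary: p)
  case 0
  have "wig_inner p 0 k p 0 k = (real (p choose k))\<^sup>2 *
      integral {0..pi} (\<lambda>\<theta>. sin \<theta> * (cos (\<theta> / 2) ^ (2 * k) * sin (\<theta> / 2) ^ (2 * (p - k))))"
    unfolding wig_inner_def integral_mult_right[symmetric] using 0
    by (intro integral_cong) (simp add: wig_def wig_poly_def coeff_linear_power power_mult power2_eq_square power_mult_distrib ac_simps)
  also have "\<dots> = (real (p choose k))\<^sup>2 * (2 * fact k * fact (p - k) / fact (Suc p))"
    using 0 by (simp only: cos_sin_half_integral)
  also have "real (p choose k) = fact p / (fact k * fact (p - k))"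
    using 0 by (simp add: binomial_fact)
  also have "(fact p / (fact k * fact (p - k)))\<^sup>2 * (2 * fact k * fact (p - k) / fact (Suc p))
      = 2 * fact p / (real (p + 1) * fact k * fact (p - k))"
  proof -
    have "(P / (K * L))\<^sup>2 * (2 * K * L / (N * P)) = 2 * P / (N * K * L)"
      if "P \<noteq> 0" "K \<noteq> 0" "L \<noteq> 0" "N \<noteq> 0" for P K L N :: real
      using that by (simp add: field_simps power2_eq_square)
    from this[of "fact p" "fact k" "fact (p - k)" "real (p + 1)"] show ?thesis by (simp add: add.commute)
  qed
  finally show ?case by simp
next
  case (Suc q)
  have "real (Suc p) * wig_inner p (Suc q) k p (Suc q) k = real (Suc q) * wig_inner (Suc p) q k (Suc p) q k"
    using wig_inner_shift[of p q p "Suc q" k k] by simp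
  also have "\<dots> = real (Suc q) * (2 * fact (Suc p) * fact q / (real (Suc p + q + 1) * fact k * fact (Suc p + q - k)))"
    using Suc.IH[of "Suc p"] Suc.prems by simp
  also have "\<dots> = real (Suc p) * (2 * fact p * fact (Suc q) / (real (p + Suc q + 1) * fact k * fact (p + Suc q - k)))"
    by simp
  finally show ?case by (simp only: mult_left_cancel[OF of_nat_neq_0])
qed

section \<open>Explicit sums and comparison with the spin weighted harmonics\<close>

lemma wig_explicit:
  "wig p q k \<theta> = (\<Sum>j\<le>k. real (q choose j) * real (p choose (k - j)) * (- 1) ^ j *
     cos (\<theta> / 2) ^ ((q - j) + (k - j)) * sin (\<theta> / 2) ^ (j + (p - (k - j))))"
proof -
  have "wig p q k \<theta> = (\<Sum>i\<le>k. coeff ([:sin (\<theta> / 2), cos (\<theta> / 2):] ^ p) i *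
      coeff ([:cos (\<theta> / 2), - sin (\<theta> / 2):] ^ q) (k - i))"
    by (simp add: wig_def wig_poly_def coeff_mult)
  also have "\<dots> = (\<Sum>j\<le>k. coeff ([:sin (\<theta> / 2), cos (\<theta> / 2):] ^ p) (k - j) *
      coeff ([:cos (\<theta> / 2), - sin (\<theta> / 2):] ^ q) j)"
    by (rule sum.reindex_bij_witness[of _ "\<lambda>j. k - j" "\<lambda>j. k - j"]) auto
  also have "\<dots> = (\<Sum>j\<le>k. real (q choose j) * real (p choose (k - j)) * (- 1) ^ j *
     cos (\<theta> / 2) ^ ((q - j) + (k - j)) * sin (\<theta> / 2) ^ (j + (p - (k - j))))"
    unfolding coeff_linear_power power_minus[of "sin (\<theta>/2)"] power_add
    by (intro sum.cong refl) (simp only: mult_ac)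
  finally show ?thesis .
qed

text \<open>The two sums are matched by \<open>u = q - j\<close>: while \<open>j\<close> counts the
  factors of the second power that contribute \<open>- sin\<close>, the index \<open>u\<close>
  counts those that contribute \<open>cos\<close>. The sum over \<open>j \<le> k\<close> has further
  indices, at which a binomial coefficient vanishes.\<close>

lemma sY_eq_wig:
  assumes p: "int p = int l + s" and q: "int q = int l - s" and k: "int k = int l - m" "k \<le> p + q"
  shows "sY s l m \<theta> \<phi> = cis (of_int m * \<phi>) * of_real ((- 1) powi (m + s) *
    sqrt (real (2 * l + 1) * fact (p + q - k) * fact k / (4 * pi * fact p * fact q)) * wig p q k \<theta>)"
proof -
  have l: "int p + int q = 2 * int l" using p q by simp
  have "(\<Sum>u\<in>{max 0 (m - s)..min (int l + m) (int l - s)}.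
           real (nat (int l - s) choose nat u) * real (nat (int l + s) choose nat (u - m + s)) *
           (- 1) powi (int l - u - s) *
           cos (\<theta> / 2) ^ nat (2 * u - m + s) * sin (\<theta> / 2) ^ nat (2 * int l - (2 * u - m + s)))
      = (\<Sum>j\<in>{j. j \<le> k \<and> j \<le> q \<and> k - j \<le> p}. real (q choose j) * real (p choose (k - j)) * (- 1) ^ j *
     cos (\<theta> / 2) ^ ((q - j) + (k - j)) * sin (\<theta> / 2) ^ (j + (p - (k - j))))"
  proof (rule sum.reindex_bij_witness[of _ "\<lambda>j. int q - int j" "\<lambda>u. nat (int q - u)"], goal_cases)
    case (5 u)
    then have u: "0 \<le> u" "m - s \<le> u" "u \<le> int l + m" "u \<le> int l - s" by auto
    define j where "j = nat (int q - u)"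
    have j: "u = int q - int j" "j \<le> q" "j \<le> k" "k - j \<le> p"
      using u p q k(1) by (auto simp: j_def)
    have 1: "nat (int l - s) = q" "nat (int l + s) = p" using p q by auto
    have 2: "nat u = q - j" using j by auto
    have 3: "nat (u - m + s) = k - j" using j p q k by auto
    have 4: "int l - u - s = int j" using j p q by auto
    have 5: "nat (2 * u - m + s) = (q - j) + (k - j)" using j p q k by auto
    have 6: "nat (2 * int l - (2 * u - m + s)) = j + (p - (k - j))" using j p q k by auto
    have 7: "q choose (q - j) = q choose j" using j by (simp add: binomial_symmetric[of j q])
    show ?case unfolding j_def[symmetric] 1 2 3 4 5 6 7 by simp
  qed (use p q k in auto)
  also have "\<dots> = wig p q k \<theta>"
    unfolding wig_explicit by (rule sum.mono_neutral_left) (auto simp: not_le binomial_eq_0)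
  finally have S: "(\<Sum>u\<in>{max 0 (m - s)..min (int l + m) (int l - s)}.
           real (nat (int l - s) choose nat u) * real (nat (int l + s) choose nat (u - m + s)) *
           (- 1) powi (int l - u - s) *
           cos (\<theta> / 2) ^ nat (2 * u - m + s) * sin (\<theta> / 2) ^ nat (2 * int l - (2 * u - m + s)))
    = wig p q k \<theta>" .
  have 1: "nat (int l + m) = p + q - k" "nat (int l - m) = k" "nat (int l + s) = p" "nat (int l - s) = q"
    using l p q k by auto
  show ?thesis
    unfolding sY_def unfolding S unfolding 1 ..
qed

section \<open>Generating functions and the addition theorem\<close>

lemma of_real_powers_eq_imp_coeffs_eq:
  fixes x y :: "nat \<Rightarrow> 'a :: real_normed_field"
  assumes "\<And>t. (\<Sum>i\<le>n. x i * of_real t ^ i) = (\<Sum>i\<le>n. y i * of_real t ^ i)" "i \<le> n"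
  shows "x i = y i"
proof -
  define P where "P = (\<Sum>i\<le>n. monom (x i - y i) i)"
  have "poly P (of_real t) = 0" for t
    using assms(1)[of t] by (simp add: P_def poly_sum poly_monom left_diff_distrib sum_subtractf)
  then have "range (of_real :: real \<Rightarrow> 'a) \<subseteq> {x. poly P x = 0}" by auto
  moreover have "infinite (range (of_real :: real \<Rightarrow> 'a))"
    by (simp add: finite_image_iff inj_on_def infinite_UNIV_char_0)
  ultimately have "P = 0"
    using finite_subset poly_roots_finite by blast
  then have "coeff P i = 0" by simp
  then show ?thesis using assms(2) by (simp add: P_def coeff_sum if_distrib cong: if_cong)
qed

text \<open>Summation over \<open>q\<close> turns the products of powers into the
  \<open>n\<close>-th power of the single linear polynomial \<open>A + t B\<close>, whose
  coefficients are binomial. The variable \<open>t\<close> thereby does for \<open>q\<close> what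
  the polynomial variable does for \<open>k\<close>.\<close>

lemma wig_generating:
  assumes "k \<le> n"
  shows "(\<Sum>q\<le>n. real (n choose q) * wig (n - q) q k \<theta> * t ^ q) =
    real (n choose k) * (cos (\<theta> / 2) - t * sin (\<theta> / 2)) ^ k * (sin (\<theta> / 2) + t * cos (\<theta> / 2)) ^ (n - k)"
proof -
  let ?A = "[:sin (\<theta> / 2), cos (\<theta> / 2):]" and ?B = "[:cos (\<theta> / 2), - sin (\<theta> / 2):]"
  have "[:sin (\<theta> / 2) + t * cos (\<theta> / 2), cos (\<theta> / 2) - t * sin (\<theta> / 2):] = [:t:] * ?B + ?A"
    by simp
  then have "[:sin (\<theta> / 2) + t * cos (\<theta> / 2), cos (\<theta> / 2) - t * sin (\<theta> / 2):] ^ n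
     = (\<Sum>q\<le>n. of_nat (n choose q) * ([:t:] * ?B) ^ q * ?A ^ (n - q))"
    by (simp only: binomial_ring)
  also have "\<dots> = (\<Sum>q\<le>n. smult (real (n choose q) * t ^ q) (wig_poly (n - q) q \<theta>))"
  proof (intro sum.cong refl)
    fix q
    have t: "[:t:] ^ q = [:t ^ q:]" by (simp add: poly_const_pow)
    have n: "of_nat (n choose q) * P = smult (real (n choose q)) P" for P :: "real poly"
      by (simp add: of_nat_poly)
    have c: "smult a ([:b:] * (P * Q)) = smult (a * b) (Q * P)" for a b :: real and P Q
      by (simp add: mult.commute)
    show "of_nat (n choose q) * ([:t:] * ?B) ^ q * ?A ^ (n - q)
        = smult (real (n choose q) * t ^ q) (wig_poly (n - q) q \<theta>)"
      by (simp only: wig_poly_def power_mult_distrib t n mult_smult_left mult.assoc c)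
  qed
  finally have "coeff ([:sin (\<theta> / 2) + t * cos (\<theta> / 2), cos (\<theta> / 2) - t * sin (\<theta> / 2):] ^ n) k
      = (\<Sum>q\<le>n. real (n choose q) * t ^ q * wig (n - q) q k \<theta>)"
    by (simp add: coeff_sum wig_def)
  then show ?thesis unfolding coeff_linear_power by (simp add: mult_ac)
qed

text \<open>For \<open>q \<le> p\<close> this is the Jacobi polynomial of degree \<open>q\<close>
  with parameters \<open>0\<close> and \<open>p - q\<close> at the argument \<open>2 T - 1\<close>,
  which is \<open>cos \<beta>\<close> for \<open>T = cos^2 (\<beta>/2)\<close>. For
  \<open>p = q\<close> it is a Legendre polynomial.\<close>

definition zonal :: "nat \<Rightarrow> nat \<Rightarrow> real \<Rightarrow> real" where
  "zonal p q T = (\<Sum>i\<le>q. real (q choose i) * real (p choose (q - i)) * T ^ i * (T - 1) ^ (q - i))"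

text \<open>Both functions are replaced by their generating functions in \<open>t\<close> and
  \<open>\<tau>\<close>. The weight \<open>1 / (n choose k)\<close> cancels one of the two binomial
  coefficients, so the sum over \<open>k\<close> is again a binomial expansion, of one
  \<open>n\<close>-th power bilinear in \<open>t\<close> and \<open>\<tau>\<close>; its coefficient
  at \<open>t^q \<tau>^q\<close> is the claim. This is the composition of rotations, computed on
  binary forms.\<close>

lemma wig_addition:
  fixes z :: complex
  assumes "q \<le> p" and T: "complex_of_real T * z = (z * of_real (cos (\<theta>1 / 2) * cos (\<theta>2 / 2)) + of_real (sin (\<theta>1 / 2) * sin (\<theta>2 / 2))) *
       (of_real (cos (\<theta>1 / 2) * cos (\<theta>2 / 2)) + z * of_real (sin (\<theta>1 / 2) * sin (\<theta>2 / 2)))"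
  shows "of_nat ((p + q) choose q) * (\<Sum>k\<le>p + q. z ^ k / of_nat ((p + q) choose k) * of_real (wig p q k \<theta>1 * wig p q k \<theta>2))
     = (z * of_real (cos (\<theta>1 / 2) * cos (\<theta>2 / 2)) + of_real (sin (\<theta>1 / 2) * sin (\<theta>2 / 2))) ^ (p - q) * z ^ q * of_real (zonal p q T)"
proof -
  define n where "n = p + q"
  define c1 c2 s1 s2 :: complex where "c1 = of_real (cos (\<theta>1 / 2))" "c2 = of_real (cos (\<theta>2 / 2))" "s1 = of_real (sin (\<theta>1 / 2))" "s2 = of_real (sin (\<theta>2 / 2))"
  have cs: "c1 * c1 + s1 * s1 = 1" "c2 * c2 + s2 * s2 = 1"
    by (simp_all add: c1_c2_s1_s2_def flip: power2_eq_square of_real_power of_real_add)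
  \<comment> \<open>Entries of the matrix of the composed rotation: the \<open>n\<close>-th power in
    question is that of \<open>(\<alpha> + t B) + \<tau> (B' + t \<delta>)\<close>.\<close>
  define \<alpha> \<delta> B B' where "\<alpha> = z * c1 * c2 + s1 * s2" "\<delta> = c1 * c2 + z * s1 * s2"
    "B = c1 * s2 - z * s1 * c2" "B' = s1 * c2 - z * c1 * s2"
  note defs = \<alpha>_\<delta>_B_B'_def
  define W where "W q q' = (\<Sum>k\<le>n. z ^ k / of_nat (n choose k) * of_real (wig (n - q) q k \<theta>1 * wig (n - q') q' k \<theta>2))" for q q'
  have gen: "(\<Sum>q'\<le>n. of_nat (n choose q') * (\<Sum>q\<le>n. of_nat (n choose q) * W q q' * of_real t ^ q) * of_real \<tau> ^ q')
     = (\<Sum>q'\<le>n. of_nat (n choose q') * poly ([:B', \<delta>:] ^ q' * [:\<alpha>, B:] ^ (n - q')) (of_real t) * of_real \<tau> ^ q')" for t \<tau> :: real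
  proof -
    let ?a1 = "cos (\<theta>1 / 2) - t * sin (\<theta>1 / 2)" and ?b1 = "sin (\<theta>1 / 2) + t * cos (\<theta>1 / 2)"
    let ?a2 = "cos (\<theta>2 / 2) - \<tau> * sin (\<theta>2 / 2)" and ?b2 = "sin (\<theta>2 / 2) + \<tau> * cos (\<theta>2 / 2)"
    let ?G1 = "\<lambda>k. \<Sum>q\<le>n. real (n choose q) * wig (n - q) q k \<theta>1 * t ^ q"
    let ?G2 = "\<lambda>k. \<Sum>q\<le>n. real (n choose q) * wig (n - q) q k \<theta>2 * \<tau> ^ q"
    have "(\<Sum>q'\<le>n. of_nat (n choose q') * (\<Sum>q\<le>n. of_nat (n choose q) * W q q' * of_real t ^ q) * of_real \<tau> ^ q')
      = (\<Sum>q'\<le>n. \<Sum>q\<le>n. \<Sum>k\<le>n. z ^ k / of_nat (n choose k) *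
          of_real ((real (n choose q) * wig (n - q) q k \<theta>1 * t ^ q) * (real (n choose q') * wig (n - q') q' k \<theta>2 * \<tau> ^ q')))"
      unfolding W_def sum_distrib_left sum_distrib_right
      by (intro sum.cong refl) (simp add: mult_ac)
    also have "\<dots> = (\<Sum>k\<le>n. z ^ k / of_nat (n choose k) * of_real (?G1 k * ?G2 k))"
    proof -
      have "complex_of_real (?G1 k * ?G2 k) = (\<Sum>q'\<le>n. \<Sum>q\<le>n.
          of_real ((real (n choose q) * wig (n - q) q k \<theta>1 * t ^ q) * (real (n choose q') * wig (n - q') q' k \<theta>2 * \<tau> ^ q')))" for k
        unfolding sum_product of_real_sum by (rule sum.swap)
      then have "(\<Sum>k\<le>n. z ^ k / of_nat (n choose k) * of_real (?G1 k * ?G2 k)) = (\<Sum>k\<le>n. \<Sum>q'\<le>n. \<Sum>q\<le>n. z ^ k / of_nat (n choose k) *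
          of_real ((real (n choose q) * wig (n - q) q k \<theta>1 * t ^ q) * (real (n choose q') * wig (n - q') q' k \<theta>2 * \<tau> ^ q')))"
        by (simp only: sum_distrib_left)
      moreover have "(\<Sum>q'\<le>n. \<Sum>q\<le>n. \<Sum>k\<le>n. f q' q k) = (\<Sum>k\<le>n. \<Sum>q'\<le>n. \<Sum>q\<le>n. f q' q k)" for f :: "nat \<Rightarrow> nat \<Rightarrow> nat \<Rightarrow> complex"
      proof -
        have "(\<Sum>q'\<le>n. \<Sum>q\<le>n. \<Sum>k\<le>n. f q' q k) = (\<Sum>q'\<le>n. \<Sum>k\<le>n. \<Sum>q\<le>n. f q' q k)"
          by (intro sum.cong refl sum.swap)
        also have "\<dots> = (\<Sum>k\<le>n. \<Sum>q'\<le>n. \<Sum>q\<le>n. f q' q k)"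
          by (rule sum.swap)
        finally show ?thesis .
      qed
      ultimately show ?thesis by simp
    qed
    also have "\<dots> = (\<Sum>k\<le>n. of_nat (n choose k) * (z * of_real (?a1 * ?a2)) ^ k * (of_real (?b1 * ?b2)) ^ (n - k))"
    proof (intro sum.cong refl)
      fix k assume "k \<in> {..n}"
      then have k: "k \<le> n" and nz: "of_nat (n choose k) \<noteq> (0::complex)" by auto
      show "z ^ k / of_nat (n choose k) * of_real (?G1 k * ?G2 k)
        = of_nat (n choose k) * (z * of_real (?a1 * ?a2)) ^ k * (of_real (?b1 * ?b2)) ^ (n - k)"
      proof -
        have *: "Z / N * ((N * A * B) * (N * A' * B')) = N * (Z * (A * A')) * (B * B')"
          if "N \<noteq> 0" for Z N A B A' B' :: complex
          using that by simp
        show ?thesis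
          unfolding wig_generating[OF k]
          by (simp only: of_real_mult of_real_power power_mult_distrib of_real_of_nat_eq *[OF nz])
      qed
    qed
    also have "\<dots> = (z * of_real (?a1 * ?a2) + of_real (?b1 * ?b2)) ^ n"
      by (simp only: binomial_ring)
    also have "z * of_real (?a1 * ?a2) + of_real (?b1 * ?b2) = of_real \<tau> * (B' + of_real t * \<delta>) + (\<alpha> + of_real t * B)"
      unfolding defs c1_c2_s1_s2_def by (simp add: algebra_simps)
    also have "\<dots> ^ n = (\<Sum>q'\<le>n. of_nat (n choose q') * poly ([:B', \<delta>:] ^ q' * [:\<alpha>, B:] ^ (n - q')) (of_real t) * of_real \<tau> ^ q')"
      by (subst binomial_ring, intro sum.cong refl) (simp add: poly_power power_mult_distrib mult_ac)
    finally show ?thesis .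
  qed
  have q: "q \<le> n" "n - q = p" by (auto simp: n_def)
  \<comment> \<open>The coefficients at \<open>\<tau>^q\<close> are compared here for arbitrary real
    \<open>t\<close>; those at \<open>t^q\<close> follow below.\<close>
  have gen1: "(\<Sum>j\<le>n. of_nat (n choose j) * W j q * of_real t ^ j) = poly ([:B', \<delta>:] ^ q * [:\<alpha>, B:] ^ p) (of_real t)" for t :: real
  proof -
    have "of_nat (n choose q) * (\<Sum>j\<le>n. of_nat (n choose j) * W j q * of_real t ^ j) =
        of_nat (n choose q) * poly ([:B', \<delta>:] ^ q * [:\<alpha>, B:] ^ (n - q)) (of_real t)"
      by (rule of_real_powers_eq_imp_coeffs_eq[OF gen q(1)])
    moreover have "of_nat (n choose q) \<noteq> (0::complex)" using q by simp
    ultimately show ?thesis unfolding q by simp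
  qed
  have deg: "degree ([:B', \<delta>:] ^ q * [:\<alpha>, B:] ^ p) \<le> n"
  proof -
    have d1: "degree [:x, y:] \<le> 1" for x y :: complex by simp
    have "degree ([:B', \<delta>:] ^ q * [:\<alpha>, B:] ^ p) \<le> degree ([:B', \<delta>:] ^ q) + degree ([:\<alpha>, B:] ^ p)"
      by (rule degree_mult_le)
    also have "\<dots> \<le> degree [:B', \<delta>:] * q + degree [:\<alpha>, B:] * p"
      by (intro add_mono degree_power_le)
    also have "\<dots> \<le> 1 * q + 1 * p" by (intro add_mono mult_mono d1) auto
    finally show ?thesis by (simp add: n_def)
  qed
  have "of_nat (n choose q) * W q q = coeff ([:B', \<delta>:] ^ q * [:\<alpha>, B:] ^ p) q"
  proof (rule of_real_powers_eq_imp_coeffs_eq[OF _ q(1), where x = "\<lambda>j. of_nat (n choose j) * W j q"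
        and y = "coeff ([:B', \<delta>:] ^ q * [:\<alpha>, B:] ^ p)"])
    fix t :: real
    show "(\<Sum>j\<le>n. of_nat (n choose j) * W j q * of_real t ^ j) =
       (\<Sum>j\<le>n. coeff ([:B', \<delta>:] ^ q * [:\<alpha>, B:] ^ p) j * of_real t ^ j)"
      unfolding gen1 poly_altdef
      by (intro sum.mono_neutral_left) (use deg in \<open>auto simp: coeff_eq_0\<close>)
  qed
  also have "\<dots> = (\<Sum>i\<le>q. of_nat (q choose i) * \<delta> ^ i * B' ^ (q - i) * (of_nat (p choose (q - i)) * B ^ (q - i) * \<alpha> ^ (p - (q - i))))"
    by (simp add: coeff_mult coeff_linear_power)
  \<comment> \<open>As \<open>q \<le> p\<close>, every term contains at least \<open>p - q\<close>
    factors \<open>\<alpha>\<close>; the remaining ones pair with \<open>\<delta>\<close>, and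
    \<open>B\<close> pairs with \<open>B'\<close>.\<close>
  also have "\<dots> = (\<Sum>i\<le>q. \<alpha> ^ (p - q) * (of_nat (q choose i) * of_nat (p choose (q - i)) * (\<alpha> * \<delta>) ^ i * (B * B') ^ (q - i)))"
  proof (intro sum.cong refl)
    fix i assume "i \<in> {..q}"
    then have "p - (q - i) = (p - q) + i" using \<open>q \<le> p\<close> by auto
    then show "of_nat (q choose i) * \<delta> ^ i * B' ^ (q - i) * (of_nat (p choose (q - i)) * B ^ (q - i) * \<alpha> ^ (p - (q - i)))
      = \<alpha> ^ (p - q) * (of_nat (q choose i) * of_nat (p choose (q - i)) * (\<alpha> * \<delta>) ^ i * (B * B') ^ (q - i))"
      by (simp add: power_add power_mult_distrib mult_ac)
  qed
  also have "\<alpha> * \<delta> = z * of_real T"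
    using T by (simp add: defs c1_c2_s1_s2_def mult_ac)
  \<comment> \<open>The matrix has determinant \<open>\<alpha> \<delta> - B B' = z\<close>, so both
    products are governed by the one real number \<open>T\<close>.\<close>
  also have "B * B' = z * of_real (T - 1)"
  proof -
    have "\<alpha> * \<delta> - B * B' = z" using cs unfolding defs by algebra
    then show ?thesis unfolding \<open>\<alpha> * \<delta> = z * of_real T\<close> by (simp add: algebra_simps)
  qed
  also have "(\<Sum>i\<le>q. \<alpha> ^ (p - q) * (of_nat (q choose i) * of_nat (p choose (q - i)) * (z * of_real T) ^ i * (z * of_real (T - 1)) ^ (q - i)))
     = \<alpha> ^ (p - q) * z ^ q * of_real (zonal p q T)"
  proof -
    have "z ^ i * z ^ (q - i) = z ^ q" if "i \<le> q" for i
      using that by (simp flip: power_add)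
    then have *: "(z * of_real T) ^ i * (z * of_real (T - 1)) ^ (q - i) = z ^ q * of_real (T ^ i * (T - 1) ^ (q - i))" if "i \<le> q" for i
      using that unfolding power_mult_distrib by (simp add: mult_ac)
    show ?thesis
      unfolding zonal_def of_real_sum sum_distrib_left
    proof (intro sum.cong refl)
      fix i assume "i \<in> {..q}"
      then have "i \<le> q" by simp
      have "\<alpha> ^ (p - q) * (of_nat (q choose i) * of_nat (p choose (q - i)) * (z * of_real T) ^ i * (z * of_real (T - 1)) ^ (q - i))
        = \<alpha> ^ (p - q) * (of_nat (q choose i) * of_nat (p choose (q - i)) * ((z * of_real T) ^ i * (z * of_real (T - 1)) ^ (q - i)))"
        by (simp only: mult_ac)
      also have "\<dots> = \<alpha> ^ (p - q) * z ^ q * complex_of_real (real (q choose i) * real (p choose (q - i)) * T ^ i * (T - 1) ^ (q - i))"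
        unfolding *[OF \<open>i \<le> q\<close>] by (simp add: mult_ac)
      finally show "\<alpha> ^ (p - q) * (of_nat (q choose i) * of_nat (p choose (q - i)) * (z * of_real T) ^ i * (z * of_real (T - 1)) ^ (q - i))
        = \<alpha> ^ (p - q) * z ^ q * complex_of_real (real (q choose i) * real (p choose (q - i)) * T ^ i * (T - 1) ^ (q - i))" .
    qed
  qed
  finally show ?thesis
    unfolding W_def q n_def[symmetric] by (simp add: defs c1_c2_s1_s2_def mult_ac)
qed

text \<open>\<open>wig_addition\<close> with \<open>\<theta>2 = 0\<close> and \<open>z = 1\<close>:
  at angle zero the polynomial is the monomial of exponent \<open>p\<close>, so only
  \<open>k = p\<close> survives in the sum.\<close>

lemma wig_diagonal:
  assumes "q \<le> p"
  shows "wig p q p \<theta> = cos (\<theta> / 2) ^ (p - q) * zonal p q ((cos (\<theta> / 2))\<^sup>2)"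
proof -
  have w0: "wig p q k 0 = (if k = p then 1 else 0)" for k
  proof -
    have "wig_poly p q 0 = monom 1 p"
      by (simp add: wig_poly_def monom_altdef flip: one_pCons)
    then show ?thesis by (simp add: wig_def)
  qed
  have "of_nat ((p + q) choose q) * (\<Sum>k\<le>p + q. (1::complex) ^ k / of_nat ((p + q) choose k) * of_real (wig p q k \<theta> * wig p q k 0))
     = of_real (cos (\<theta> / 2) ^ (p - q) * zonal p q ((cos (\<theta> / 2))\<^sup>2))"
    using wig_addition[OF assms, where z = 1 and ?\<theta>1.0 = \<theta> and ?\<theta>2.0 = 0 and T = "(cos (\<theta> / 2))\<^sup>2"]
    by (simp add: power2_eq_square)
  also have "(\<Sum>k\<le>p + q. 1 ^ k / of_nat ((p + q) choose k) * complex_of_real (wig p q k \<theta> * wig p q k 0))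
      = of_real (wig p q p \<theta>) / of_nat ((p + q) choose p)"
    unfolding w0 by (simp add: if_distrib[of "\<lambda>x. _ * x"] if_distrib[of of_real] sum.delta cong: if_cong)
  also have "(p + q) choose p = (p + q) choose q"
    using binomial_symmetric[of p "p + q"] by simp
  finally have "complex_of_real (wig p q p \<theta>) = of_real (cos (\<theta> / 2) ^ (p - q) * zonal p q ((cos (\<theta> / 2))\<^sup>2))"
    by simp
  then show ?thesis by (simp only: of_real_eq_iff)
qed

section \<open>Spin weighted harmonics and the addition theorem\<close>

definition sY_norm :: "nat \<Rightarrow> nat \<Rightarrow> int \<Rightarrow> real" where
  "sY_norm s l m = (- 1) powi (m + int s) *
     sqrt (real (2 * l + 1) * fact (nat (int l + m)) * fact (nat (int l - m)) / (4 * pi * fact (l + s) * fact (l - s)))"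

lemma sY_norm_square:
  "(sY_norm s l m)\<^sup>2 =
     real (2 * l + 1) * fact (nat (int l + m)) * fact (nat (int l - m)) / (4 * pi * fact (l + s) * fact (l - s))"
  by (simp add: sY_norm_def power_mult_distrib power_int_minus_left)

lemma sY_norm_nonzero: "sY_norm s l m \<noteq> 0"
proof -
  have "(sY_norm s l m)\<^sup>2 > 0" unfolding sY_norm_square by simp
  then show ?thesis by auto
qed

lemma sY_eq:
  assumes "s \<le> l" "\<bar>m\<bar> \<le> int l"
  shows "sY (int s) l m \<theta> \<phi> =
    cis (of_int m * \<phi>) * of_real (sY_norm s l m * wig (l + s) (l - s) (nat (int l - m)) \<theta>)"
proof -
  have *: "l + s + (l - s) - nat (int l - m) = nat (int l + m)" using assms by auto
  have "sY (int s) l m \<theta> \<phi> = cis (of_int m * \<phi>) * of_real ((- 1) powi (m + int s) *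
    sqrt (real (2 * l + 1) * fact (l + s + (l - s) - nat (int l - m)) * fact (nat (int l - m)) /
      (4 * pi * fact (l + s) * fact (l - s))) * wig (l + s) (l - s) (nat (int l - m)) \<theta>)"
    by (rule sY_eq_wig) (use assms in auto)
  then show ?thesis unfolding * sY_norm_def .
qed

lemma zonal_1: "zonal p q 1 = 1"
proof -
  have "zonal p q 1 = (\<Sum>i\<le>q. if i = q then 1 else 0)"
    unfolding zonal_def by (intro sum.cong refl) auto
  then show ?thesis by simp
qed

text \<open>The square of an entry of the composed matrix, up to the phase in front. Its
  \<open>s\<close>-th power is the spin dependent factor in the addition theorem. Since only a
  square occurs, the sign ambiguity of half-angles does not matter.\<close>

definition half_angle :: "real \<Rightarrow> real \<Rightarrow> real \<Rightarrow> real \<Rightarrow> complex" where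
  "half_angle \<theta>1 \<phi>1 \<theta>2 \<phi>2 = cis (\<phi>1 - \<phi>2) *
     (cis (\<phi>2 - \<phi>1) * of_real (cos (\<theta>1 / 2) * cos (\<theta>2 / 2)) + of_real (sin (\<theta>1 / 2) * sin (\<theta>2 / 2)))\<^sup>2"

definition sphere_dot :: "real \<Rightarrow> real \<Rightarrow> real \<Rightarrow> real \<Rightarrow> real" where
  "sphere_dot \<theta>1 \<phi>1 \<theta>2 \<phi>2 = cos \<theta>1 * cos \<theta>2 + sin \<theta>1 * sin \<theta>2 * cos (\<phi>1 - \<phi>2)"

text \<open>With \<open>k = l - m\<close>, \<open>z = cis (\<phi>2 - \<phi>1)\<close> and
  \<open>E\<close> the inverse of \<open>z\<close>, the phase of the term with index
  \<open>m\<close> is \<open>E^l z^k\<close>, and the squared normalisation contains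
  \<open>(n choose q) / (n choose k)\<close>. The sum is thus the left-hand side of
  \<open>wig_addition\<close>; afterwards \<open>z^q\<close> cancels against \<open>E^q\<close>, and
  \<open>E^s\<close> goes into \<open>half_angle\<close>.\<close>

lemma sY_addition_aux:
  assumes "s \<le> l"
  shows "(\<Sum>m\<in>{- int l..int l}. sY (int s) l m \<theta>1 \<phi>1 * cnj (sY (int s) l m \<theta>2 \<phi>2)) =
    of_real (real (2 * l + 1) / (4 * pi)) * half_angle \<theta>1 \<phi>1 \<theta>2 \<phi>2 ^ s *
      of_real (zonal (l + s) (l - s) ((1 + sphere_dot \<theta>1 \<phi>1 \<theta>2 \<phi>2) / 2))"
proof -
  define p where "p = l + s"
  define q where "q = l - s"
  define n where "n = p + q"
  have pq: "q \<le> p" "p - q = 2 * s" "n = 2 * l" using assms by (auto simp: p_def q_def n_def)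
  define z where "z = cis (\<phi>2 - \<phi>1)"
  define E where "E = cis (\<phi>1 - \<phi>2)"
  have zE: "z * E = 1" by (simp add: z_def E_def cis_mult)
  define T where "T = (1 + sphere_dot \<theta>1 \<phi>1 \<theta>2 \<phi>2) / 2"
  define c1 c2 s1 s2 where "c1 = cos (\<theta>1 / 2)" "c2 = cos (\<theta>2 / 2)" "s1 = sin (\<theta>1 / 2)" "s2 = sin (\<theta>2 / 2)"
  note cs_defs = this
  have cs: "c1\<^sup>2 + s1\<^sup>2 = 1" "c2\<^sup>2 + s2\<^sup>2 = 1" by (simp_all add: cs_defs)
  have dbl: "cos \<theta>1 = c1\<^sup>2 - s1\<^sup>2" "sin \<theta>1 = 2 * s1 * c1" "cos \<theta>2 = c2\<^sup>2 - s2\<^sup>2" "sin \<theta>2 = 2 * s2 * c2"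
    using cos_double[of "\<theta>1 / 2"] sin_double[of "\<theta>1 / 2"] cos_double[of "\<theta>2 / 2"] sin_double[of "\<theta>2 / 2"]
    by (simp_all add: cs_defs)
  have T: "T = (c1 * c2)\<^sup>2 + (s1 * s2)\<^sup>2 + 2 * (c1 * c2) * (s1 * s2) * cos (\<phi>1 - \<phi>2)"
  proof -
    have "1 + (c1\<^sup>2 - s1\<^sup>2) * (c2\<^sup>2 - s2\<^sup>2) = 2 * ((c1 * c2)\<^sup>2 + (s1 * s2)\<^sup>2)"
      using cs by algebra
    then show ?thesis
      unfolding T_def sphere_dot_def dbl by (simp add: field_simps)
  qed
  have zz: "z\<^sup>2 + 1 = 2 * of_real (cos (\<phi>1 - \<phi>2)) * z"
  proof -
    have "z + E = 2 * of_real (cos (\<phi>1 - \<phi>2))"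
      unfolding z_def E_def by (simp add: complex_eq_iff cos_diff sin_diff)
    then have "(z + E) * z = 2 * of_real (cos (\<phi>1 - \<phi>2)) * z" by simp
    then show ?thesis using zE by (simp add: algebra_simps power2_eq_square)
  qed
  have Tz: "complex_of_real T * z = (z * of_real (c1 * c2) + of_real (s1 * s2)) * (of_real (c1 * c2) + z * of_real (s1 * s2))"
  proof -
    have "(z * C + S) * (C + z * S) = (C\<^sup>2 + S\<^sup>2) * z + C * S * (z\<^sup>2 + 1)" for C S :: complex
      by (simp add: algebra_simps power2_eq_square)
    from this[of "of_real (c1 * c2)" "of_real (s1 * s2)"] show ?thesis
      unfolding T zz by (simp add: algebra_simps power_mult_distrib)
  qed
  note add = wig_addition[OF pq(1) Tz[unfolded cs_defs]]
  have "(\<Sum>m\<in>{- int l..int l}. sY (int s) l m \<theta>1 \<phi>1 * cnj (sY (int s) l m \<theta>2 \<phi>2)) =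
     (\<Sum>k\<le>n. of_real (real (2 * l + 1) / (4 * pi)) * E ^ l * (of_nat (n choose q) *
        (z ^ k / of_nat (n choose k) * of_real (wig p q k \<theta>1 * wig p q k \<theta>2))))"
  proof (rule sum.reindex_bij_witness[of _ "\<lambda>k. int l - int k" "\<lambda>m. nat (int l - m)"], goal_cases)
    case (5 m)
    define k where "k = nat (int l - m)"
    have m: "m = int l - int k" "k \<le> n" using 5 by (auto simp: k_def pq)
    have "\<bar>m\<bar> \<le> int l" using 5 by auto
    have kk: "nat (int l + m) = n - k" using m pq by auto
    have "cis (of_int m * \<phi>1) * cnj (cis (of_int m * \<phi>2)) = cis (of_int m * (\<phi>1 - \<phi>2))"
      by (simp add: cis_cnj cis_mult algebra_simps)
    also have "\<dots> = E ^ l * z ^ k"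
    proof -
      have "of_int m * (\<phi>1 - \<phi>2) = real l * (\<phi>1 - \<phi>2) + real k * (\<phi>2 - \<phi>1)"
        by (simp add: m algebra_simps)
      then show ?thesis
        unfolding E_def z_def Complex.DeMoivre cis_mult by (rule arg_cong)
    qed
    finally have ph: "cis (of_int m * \<phi>1) * cnj (cis (of_int m * \<phi>2)) = E ^ l * z ^ k" .
    have "(sY_norm s l m)\<^sup>2 = real (2 * l + 1) / (4 * pi) * (real (n choose q) / real (n choose k))"
    proof -
      have "(sY_norm s l m)\<^sup>2 = real (2 * l + 1) * fact (n - k) * fact k / (4 * pi * fact p * fact q)"
        unfolding sY_norm_square kk k_def[symmetric] p_def q_def ..
      moreover have "real (n choose q) = fact n / (fact q * fact p)"
        using binomial_fact[of q n, where 'a = real] by (simp add: n_def)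
      moreover have "real (n choose k) = fact n / (fact k * fact (n - k))"
        using binomial_fact[of k n, where 'a = real] m by simp
      ultimately show ?thesis by (simp add: mult_ac)
    qed
    then have N: "complex_of_real (sY_norm s l m) * of_real (sY_norm s l m) = of_real (real (2 * l + 1) / (4 * pi)) * (of_nat (n choose q) / of_nat (n choose k))"
    proof -
      have "complex_of_real a * of_real a = of_real (a\<^sup>2)" for a by (simp add: power2_eq_square)
      then show ?thesis
        by (simp only: \<open>(sY_norm s l m)\<^sup>2 = _\<close> of_real_mult of_real_divide of_real_of_nat_eq)
    qed
    have "sY (int s) l m \<theta>1 \<phi>1 * cnj (sY (int s) l m \<theta>2 \<phi>2) =
        (cis (of_int m * \<phi>1) * cnj (cis (of_int m * \<phi>2))) * (complex_of_real (sY_norm s l m) * of_real (sY_norm s l m)) *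
        of_real (wig p q k \<theta>1 * wig p q k \<theta>2)"
      unfolding sY_eq[OF assms \<open>\<bar>m\<bar> \<le> int l\<close>] k_def[symmetric] p_def[symmetric] q_def[symmetric]
      by (simp add: mult_ac)
    then show ?case unfolding ph N k_def[symmetric] by simp
  qed (auto simp: pq)
  also have "\<dots> = of_real (real (2 * l + 1) / (4 * pi)) * E ^ l * (of_nat (n choose q) *
        (\<Sum>k\<le>n. z ^ k / of_nat (n choose k) * of_real (wig p q k \<theta>1 * wig p q k \<theta>2)))"
    by (simp only: sum_distrib_left)
  also have "\<dots> = of_real (real (2 * l + 1) / (4 * pi)) * E ^ l *
     ((z * of_real (c1 * c2) + of_real (s1 * s2)) ^ (2 * s) * z ^ q * of_real (zonal p q T))"
    unfolding n_def add by (simp add: cs_defs pq)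
  also have "E ^ l = E ^ s * E ^ q"
    using assms by (simp add: q_def flip: power_add)
  also have "of_real (real (2 * l + 1) / (4 * pi)) * (E ^ s * E ^ q) *
     ((z * of_real (c1 * c2) + of_real (s1 * s2)) ^ (2 * s) * z ^ q * of_real (zonal p q T)) =
     of_real (real (2 * l + 1) / (4 * pi)) * (E * (z * of_real (c1 * c2) + of_real (s1 * s2))\<^sup>2) ^ s * (z * E) ^ q * of_real (zonal p q T)"
  proof -
    have "X ^ (2 * s) = (X\<^sup>2) ^ s" for X :: complex by (simp add: power_mult)
    then show ?thesis
      unfolding power_mult_distrib by (simp only:) (simp only: mult_ac)
  qed
  finally show ?thesis
    unfolding zE unfolding half_angle_def E_def z_def T_def p_def q_def cs_defs by simp
qed

text \<open>At coinciding points \<open>half_angle\<close> and \<open>zonal\<close> are both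
  \<open>1\<close>. This bounds every single harmonic and makes the diagonal of the reproducing
  kernel constant.\<close>

lemma sY_square_sum:
  assumes "s \<le> l"
  shows "(\<Sum>m\<in>{- int l..int l}. sY (int s) l m \<theta> \<phi> * cnj (sY (int s) l m \<theta> \<phi>)) = of_real (real (2 * l + 1) / (4 * pi))"
proof -
  have "(sin \<theta>)\<^sup>2 + (cos \<theta>)\<^sup>2 = 1" by simp
  then have 1: "sphere_dot \<theta> \<phi> \<theta> \<phi> = 1"
    by (simp add: sphere_dot_def power2_eq_square add.commute)
  have "cos (\<theta> / 2) * cos (\<theta> / 2) + sin (\<theta> / 2) * sin (\<theta> / 2) = 1"
    by (metis cos_squared_eq power2_eq_square diff_add_cancel)
  then have "half_angle \<theta> \<phi> \<theta> \<phi> = 1"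
    by (simp add: half_angle_def flip: of_real_mult of_real_add)
  then show ?thesis
    unfolding sY_addition_aux[OF assms] 1 by (simp add: zonal_1)
qed

lemma sY_bound:
  assumes "s \<le> l" "\<bar>m\<bar> \<le> int l"
  shows "(cmod (sY (int s) l m \<theta> \<phi>))\<^sup>2 \<le> real (2 * l + 1) / (4 * pi)"
proof -
  have "complex_of_real (\<Sum>m\<in>{- int l..int l}. (cmod (sY (int s) l m \<theta> \<phi>))\<^sup>2) = of_real (real (2 * l + 1) / (4 * pi))"
    unfolding sY_square_sum[OF assms(1), of \<theta> \<phi>, symmetric] by (simp only: of_real_sum complex_norm_square)
  then have "(\<Sum>m\<in>{- int l..int l}. (cmod (sY (int s) l m \<theta> \<phi>))\<^sup>2) = real (2 * l + 1) / (4 * pi)"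
    by (simp only: of_real_eq_iff)
  moreover have "(cmod (sY (int s) l m \<theta> \<phi>))\<^sup>2 \<le> (\<Sum>m\<in>{- int l..int l}. (cmod (sY (int s) l m \<theta> \<phi>))\<^sup>2)"
    using assms(2) by (intro member_le_sum) auto
  ultimately show ?thesis by simp
qed

text \<open>The index \<open>m = - s\<close> corresponds to \<open>k = l + s = p\<close>, the one
  coefficient that \<open>wig_diagonal\<close> evaluates.\<close>

lemma sY_zonal:
  assumes "s \<le> l"
  shows "sY (int s) l (- int s) \<beta> 0 = of_real (sqrt (real (2 * l + 1) / (4 * pi)) *
     ((cos (\<beta> / 2))\<^sup>2) ^ s * zonal (l + s) (l - s) ((cos (\<beta> / 2))\<^sup>2))"
proof -
  have 1: "nat (int l - - int s) = l + s" by simp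
  have m: "\<bar>- int s\<bar> \<le> int l" using assms by simp
  have 2: "nat (int l + - int s) = l - s" using assms by simp
  have "sY_norm s l (- int s) = sqrt (real (2 * l + 1) / (4 * pi))"
    unfolding sY_norm_def 1 2 by simp
  moreover have "wig (l + s) (l - s) (l + s) \<beta> = ((cos (\<beta> / 2))\<^sup>2) ^ s * zonal (l + s) (l - s) ((cos (\<beta> / 2))\<^sup>2)"
    using assms wig_diagonal[of "l - s" "l + s" \<beta>] by (simp add: power_mult flip: mult_2)
  ultimately show ?thesis
    unfolding sY_eq[OF assms m] 1 by simp
qed

section \<open>The addition theorem in terms of Euler angles\<close>

lemma euler_entries:
  "euler \<alpha> \<beta> \<gamma> $ 1 $ 1 = cos \<alpha> * cos \<beta> * cos \<gamma> - sin \<alpha> * sin \<gamma>"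
  "euler \<alpha> \<beta> \<gamma> $ 1 $ 2 = - cos \<alpha> * cos \<beta> * sin \<gamma> - sin \<alpha> * cos \<gamma>"
  "euler \<alpha> \<beta> \<gamma> $ 1 $ 3 = cos \<alpha> * sin \<beta>"
  "euler \<alpha> \<beta> \<gamma> $ 2 $ 1 = sin \<alpha> * cos \<beta> * cos \<gamma> + cos \<alpha> * sin \<gamma>"
  "euler \<alpha> \<beta> \<gamma> $ 2 $ 2 = - sin \<alpha> * cos \<beta> * sin \<gamma> + cos \<alpha> * cos \<gamma>"
  "euler \<alpha> \<beta> \<gamma> $ 2 $ 3 = sin \<alpha> * sin \<beta>"
  "euler \<alpha> \<beta> \<gamma> $ 3 $ 1 = - sin \<beta> * cos \<gamma>"
  "euler \<alpha> \<beta> \<gamma> $ 3 $ 2 = sin \<beta> * sin \<gamma>"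
  "euler \<alpha> \<beta> \<gamma> $ 3 $ 3 = cos \<beta>"
  by (simp_all add: euler_def Rz_def Ry_def matrix_matrix_mult_def sum_3)

text \<open>In the rotation matrix \<open>R\<close> the combinations \<open>R11 + R22\<close> and
  \<open>R21 - R12\<close> depend on \<open>\<alpha>\<close> and \<open>\<gamma>\<close> only
  through their sum, with the factor \<open>1 + cos \<beta>\<close>. Hence no case distinction
  arises at \<open>\<beta> = 0\<close> and \<open>\<beta> = pi\<close>, where the two angles are not
  determined separately.\<close>

lemma relative_euler_angles_half_angle:
  assumes "relative_euler_angles \<theta>1 \<phi>1 \<theta>2 \<phi>2 \<alpha> \<beta> \<gamma>"
  shows "cos \<beta> = sphere_dot \<theta>1 \<phi>1 \<theta>2 \<phi>2"
    and "half_angle \<theta>1 \<phi>1 \<theta>2 \<phi>2 = of_real ((cos (\<beta> / 2))\<^sup>2) * cis (- (\<alpha> + \<gamma>))"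
proof -
  define R where "R = transpose (euler \<phi>2 \<theta>2 0) ** euler \<phi>1 \<theta>1 0"
  have R: "euler \<alpha> \<beta> \<gamma> = R" using assms by (simp add: relative_euler_angles_def R_def)
  have 33: "R $ 3 $ 3 = sphere_dot \<theta>1 \<phi>1 \<theta>2 \<phi>2"
    by (simp add: R_def matrix_matrix_mult_def sum_3 transpose_def euler_entries sphere_dot_def cos_diff algebra_simps)
  show cb: "cos \<beta> = sphere_dot \<theta>1 \<phi>1 \<theta>2 \<phi>2"
    unfolding 33[symmetric] R[symmetric] by (simp add: euler_entries)
  have a: "R $ 1 $ 1 + R $ 2 $ 2 = (1 + cos \<beta>) * cos (\<alpha> + \<gamma>)"
    and b: "R $ 2 $ 1 - R $ 1 $ 2 = (1 + cos \<beta>) * sin (\<alpha> + \<gamma>)"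
    unfolding R[symmetric] by (simp_all add: euler_entries cos_add sin_add algebra_simps)
  have c: "R $ 1 $ 1 + R $ 2 $ 2 = (1 + cos \<theta>1 * cos \<theta>2) * cos (\<phi>1 - \<phi>2) + sin \<theta>1 * sin \<theta>2"
    and d: "R $ 2 $ 1 - R $ 1 $ 2 = (cos \<theta>1 + cos \<theta>2) * sin (\<phi>1 - \<phi>2)"
    by (simp_all add: R_def matrix_matrix_mult_def sum_3 transpose_def euler_entries cos_diff sin_diff algebra_simps)
  define c1 c2 s1 s2 where "c1 = cos (\<theta>1 / 2)" "c2 = cos (\<theta>2 / 2)" "s1 = sin (\<theta>1 / 2)" "s2 = sin (\<theta>2 / 2)"
  note cs_defs = this
  have cs: "c1\<^sup>2 + s1\<^sup>2 = 1" "c2\<^sup>2 + s2\<^sup>2 = 1" by (simp_all add: cs_defs)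
  have dbl: "cos \<theta>1 = c1\<^sup>2 - s1\<^sup>2" "sin \<theta>1 = 2 * s1 * c1" "cos \<theta>2 = c2\<^sup>2 - s2\<^sup>2" "sin \<theta>2 = 2 * s2 * c2"
    using cos_double[of "\<theta>1 / 2"] sin_double[of "\<theta>1 / 2"] cos_double[of "\<theta>2 / 2"] sin_double[of "\<theta>2 / 2"]
    by (simp_all add: cs_defs)
  have e: "1 + (c1\<^sup>2 - s1\<^sup>2) * (c2\<^sup>2 - s2\<^sup>2) = 2 * ((c1 * c2)\<^sup>2 + (s1 * s2)\<^sup>2)"
    and f: "(c1\<^sup>2 - s1\<^sup>2) + (c2\<^sup>2 - s2\<^sup>2) = 2 * ((c1 * c2)\<^sup>2 - (s1 * s2)\<^sup>2)"
    using cs by algebra+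
  have half: "(cos (\<beta> / 2))\<^sup>2 = (1 + cos \<beta>) / 2"
    using cos_double_cos[of "\<beta> / 2"] by simp
  define \<delta> where "\<delta> = \<phi>1 - \<phi>2"
  have "half_angle \<theta>1 \<phi>1 \<theta>2 \<phi>2 =
      (cis \<delta> * cis (- \<delta>)) * cis (- \<delta>) * of_real ((c1 * c2)\<^sup>2) + (cis \<delta> * cis (- \<delta>)) * of_real (2 * (c1 * c2) * (s1 * s2)) +
      cis \<delta> * of_real ((s1 * s2)\<^sup>2)"
    unfolding half_angle_def cs_defs[symmetric] \<delta>_def minus_diff_eq
    by (simp add: power2_eq_square algebra_simps)
  also have "\<dots> = cis (- \<delta>) * of_real ((c1 * c2)\<^sup>2) + of_real (2 * (c1 * c2) * (s1 * s2)) + cis \<delta> * of_real ((s1 * s2)\<^sup>2)"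
    by (simp add: cis_mult)
  also have "\<dots> = Complex ((R $ 1 $ 1 + R $ 2 $ 2) / 2) (- (R $ 2 $ 1 - R $ 1 $ 2) / 2)"
    unfolding c d unfolding dbl e f \<delta>_def[symmetric] by (simp add: complex_eq_iff algebra_simps)
  also have "\<dots> = of_real ((cos (\<beta> / 2))\<^sup>2) * cis (- (\<alpha> + \<gamma>))"
    unfolding a b half by (simp add: complex_eq_iff del: minus_add_distrib)
  finally show "half_angle \<theta>1 \<phi>1 \<theta>2 \<phi>2 = of_real ((cos (\<beta> / 2))\<^sup>2) * cis (- (\<alpha> + \<gamma>))" .
qed

lemma sY_addition:
  assumes "s \<le> l" "relative_euler_angles \<theta>1 \<phi>1 \<theta>2 \<phi>2 \<alpha> \<beta> \<gamma>"
  shows "(\<Sum>m\<in>{- int l..int l}. sY (int s) l m \<theta>1 \<phi>1 * cnj (sY (int s) l m \<theta>2 \<phi>2)) =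
    of_real (sqrt (real (2 * l + 1) / (4 * pi))) * (sY (int s) l (- int s) \<beta> 0 * cis (- (of_nat s * (\<alpha> + \<gamma>))))"
proof -
  have "(cos (\<beta> / 2))\<^sup>2 = (1 + cos \<beta>) / 2"
    using cos_double_cos[of "\<beta> / 2"] by simp
  then have h: "(1 + sphere_dot \<theta>1 \<phi>1 \<theta>2 \<phi>2) / 2 = (cos (\<beta> / 2))\<^sup>2"
    using relative_euler_angles_half_angle(1)[OF assms(2)] by simp
  have "cis (- (\<alpha> + \<gamma>)) ^ s = cis (- (of_nat s * (\<alpha> + \<gamma>)))"
    unfolding Complex.DeMoivre by (simp only: mult_minus_right)
  then have p: "half_angle \<theta>1 \<phi>1 \<theta>2 \<phi>2 ^ s = of_real (((cos (\<beta> / 2))\<^sup>2) ^ s) * cis (- (of_nat s * (\<alpha> + \<gamma>)))"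
    unfolding relative_euler_angles_half_angle(2)[OF assms(2)] power_mult_distrib by simp
  have sq: "of_real (real (2 * l + 1) / (4 * pi)) = complex_of_real (sqrt (real (2 * l + 1) / (4 * pi))) * of_real (sqrt (real (2 * l + 1) / (4 * pi)))"
    by (simp flip: of_real_mult)
  show ?thesis
    unfolding sY_addition_aux[OF assms(1)] sY_zonal[OF assms(1)] h p sq
    by (simp only: of_real_mult mult_ac)
qed

section \<open>Integration over the sphere and orthonormality\<close>

text \<open>The closed coordinate rectangle with weight \<open>sin\<close> stands for the sphere:
  points are not identified at the poles or along \<open>\<phi> = 0\<close> and
  \<open>\<phi> = 2 pi\<close>, so the coordinate of a section in the frame
  \<open>euler \<phi> \<theta> 0\<close> is an ordinary function.\<close>

definition sphere_measure :: "(real \<times> real) measure" where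
  "sphere_measure = density (restrict_space lborel sphere_domain) (\<lambda>x. ennreal (sin (fst x)))"

lemma sphere_domain_cbox: "sphere_domain = cbox (0, 0) (pi, 2 * pi)"
  by (simp add: sphere_domain_def cbox_Pair_eq)

lemma sphere_domain_borel [measurable]: "sphere_domain \<in> sets borel"
  by (simp add: sphere_domain_cbox)

lemma space_sphere_measure [simp]: "space sphere_measure = sphere_domain"
  by (simp add: sphere_measure_def space_restrict_space)

lemma sets_sphere_measure: "sets sphere_measure = sets (restrict_space borel sphere_domain)"
  by (simp add: sphere_measure_def cong: sets_restrict_space_cong)

lemma sin_fst_measurable: "(\<lambda>x. sin (fst x)) \<in> borel_measurable (restrict_space lborel sphere_domain)"
  by (rule measurable_restrict_space1) (simp add: borel_measurable_continuous_onI continuous_on_sin continuous_on_fst)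

lemma measurable_sphere_measure_iff:
  "f \<in> borel_measurable sphere_measure \<longleftrightarrow> f \<in> borel_measurable (restrict_space lborel sphere_domain)"
  by (simp add: sphere_measure_def)

lemma sin_fst_nonneg: "x \<in> sphere_domain \<Longrightarrow> 0 \<le> sin (fst x)"
  by (auto simp: sphere_domain_def sin_ge_zero)

lemma AE_sin_fst_nonneg: "AE x in restrict_space lborel sphere_domain. 0 \<le> sin (fst x)"
  by (rule AE_I2) (auto simp: space_restrict_space sin_fst_nonneg)

lemma finite_measure_sphere_measure: "finite_measure sphere_measure"
proof
  have "emeasure sphere_measure sphere_domain = (\<integral>\<^sup>+x. ennreal (sin (fst x)) * indicator sphere_domain x \<partial>restrict_space lborel sphere_domain)"
    unfolding sphere_measure_def using sin_fst_measurable
    by (subst emeasure_density) (auto simp: sets_restrict_space_iff)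
  also have "\<dots> \<le> (\<integral>\<^sup>+x. 1 \<partial>restrict_space lborel sphere_domain)"
    by (intro nn_integral_mono) (auto split: split_indicator simp: ennreal_le_1)
  also have "\<dots> = emeasure lborel sphere_domain"
    by (simp add: emeasure_restrict_space space_restrict_space)
  also have "\<dots> < \<infinity>"
    unfolding sphere_domain_cbox by (rule emeasure_lborel_cbox_finite)
  finally show "emeasure sphere_measure (space sphere_measure) \<noteq> \<infinity>" by simp
qed

interpretation sphere: finite_measure sphere_measure
  by (rule finite_measure_sphere_measure)

lemma integral_sphere_measure:
  fixes f :: "real \<times> real \<Rightarrow> complex"
  assumes "f \<in> borel_measurable sphere_measure"
  shows "(LINT x|sphere_measure. f x) = (LINT x:sphere_domain|lborel. sin (fst x) *\<^sub>R f x)"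
proof -
  have "(LINT x|sphere_measure. f x) = (LINT x|restrict_space lborel sphere_domain. sin (fst x) *\<^sub>R f x)"
    unfolding sphere_measure_def
    by (rule integral_density) (use assms measurable_sphere_measure_iff sin_fst_measurable AE_sin_fst_nonneg in auto)
  then show ?thesis
    by (simp add: integral_restrict_space set_lebesgue_integral_def)
qed

lemma measurable_sphere_continuous:
  fixes f :: "real \<times> real \<Rightarrow> 'b :: topological_space"
  shows "continuous_on sphere_domain f \<Longrightarrow> f \<in> borel_measurable sphere_measure"
  by (simp add: borel_measurable_continuous_on_restrict cong: measurable_cong_sets[OF sets_sphere_measure refl])

lemma compact_sphere_domain: "compact sphere_domain"
  unfolding sphere_domain_cbox by (rule compact_cbox)

lemma integrable_sphere_continuous:
  fixes f :: "real \<times> real \<Rightarrow> 'b :: {banach, second_countable_topology}"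
  assumes "continuous_on sphere_domain f"
  shows "integrable sphere_measure f"
proof -
  have "bounded (f ` sphere_domain)"
    using assms compact_sphere_domain by (intro compact_imp_bounded compact_continuous_image)
  then obtain B where "\<And>x. x \<in> sphere_domain \<Longrightarrow> norm (f x) \<le> B"
    by (auto simp: bounded_iff)
  then show ?thesis
    by (intro sphere.integrable_const_bound[of _ B] measurable_sphere_continuous assms AE_I2) auto
qed

lemma integral_sphere_continuous:
  fixes f :: "real \<times> real \<Rightarrow> complex"
  assumes f: "continuous_on sphere_domain f"
  shows "(LINT x|sphere_measure. f x) =
    integral {0..pi} (\<lambda>\<theta>. sin \<theta> *\<^sub>R integral {0..2 * pi} (\<lambda>\<phi>. f (\<theta>, \<phi>)))"
proof -
  let ?g = "\<lambda>x. sin (fst x) *\<^sub>R f x"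
  have g: "continuous_on sphere_domain ?g"
    by (intro continuous_intros f)
  have "(LINT x|sphere_measure. f x) = (LINT x:sphere_domain|lborel. ?g x)"
    by (intro integral_sphere_measure measurable_sphere_continuous f)
  also have "\<dots> = integral sphere_domain ?g"
    by (rule set_borel_integral_eq_integral, unfold set_integrable_def)
      (rule borel_integrable_compact[OF compact_sphere_domain g])
  also have "\<dots> = integral (cbox 0 pi) (\<lambda>\<theta>. integral (cbox 0 (2 * pi)) (\<lambda>\<phi>. ?g (\<theta>, \<phi>)))"
    using g unfolding sphere_domain_cbox by (rule integral_prod_continuous)
  finally show ?thesis by (simp add: cbox_interval)
qed

lemma sY_continuous:
  assumes "s \<le> l" "\<bar>m\<bar> \<le> int l"
  shows "continuous_on A (\<lambda>x. sY (int s) l m (fst x) (snd x))"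
  unfolding sY_eq[OF assms] by (intro continuous_intros)

lemma integral_cis_int:
  "integral {0..2 * pi} (\<lambda>\<phi>. cis (of_int k * \<phi>)) = (if k = 0 then of_real (2 * pi) else 0)"
proof (cases "k = 0")
  case False
  have "((\<lambda>\<phi>. cis (of_int k * \<phi>)) has_integral
      cis (of_int k * (2 * pi)) / (\<i> * of_int k) - cis (of_int k * 0) / (\<i> * of_int k)) {0..2 * pi}"
  proof (intro fundamental_theorem_of_calculus)
    fix \<phi> :: real
    have i: "\<i> * (x * \<i>) = - x" for x :: complex by (simp add: mult.commute[of x] mult.assoc[symmetric])
    have "((\<lambda>z. exp (\<i> * (of_int k * z)) / (\<i> * of_int k)) has_field_derivative
        exp (\<i> * (of_int k * of_real \<phi>))) (at (of_real \<phi>))"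
      using False by (auto intro!: derivative_eq_intros simp: i)
    then have "((\<lambda>t. exp (\<i> * (of_int k * of_real t)) / (\<i> * of_int k)) has_vector_derivative
        exp (\<i> * (of_int k * of_real \<phi>))) (at \<phi> within {0..2 * pi})"
      by (rule has_vector_derivative_real_field)
    then show "((\<lambda>\<phi>. cis (of_int k * \<phi>) / (\<i> * of_int k)) has_vector_derivative cis (of_int k * \<phi>))
        (at \<phi> within {0..2 * pi})"
      by (simp add: cis_conv_exp)
  qed simp
  moreover have "cis (of_int k * (2 * pi)) = 1"
    by (metis cis_multiple_2pi Ints_of_int mult.commute)
  ultimately show ?thesis using False by (simp add: has_integral_iff)
qed (simp add: scaleR_conv_of_real)

lemma integral_of_real_complex:
  assumes "f integrable_on A"
  shows "integral A (\<lambda>x. complex_of_real (f x)) = of_real (integral A f)"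
  using integral_linear[OF assms bounded_linear_of_real[where 'a = complex]] by (simp add: o_def)

text \<open>The integral over \<phi> forces \<open>m = m'\<close>; then both polar parts have the
  same spin and weight, and \<open>wig_orthogonal\<close> or \<open>wig_norm\<close> applies. The
  constant \<open>sY_norm\<close> is the one that makes \<open>2 pi\<close> times the polar norm
  equal to \<open>1\<close>.\<close>

lemma sY_orthonormal:
  assumes "s \<le> l" "\<bar>m\<bar> \<le> int l" "s \<le> l'" "\<bar>m'\<bar> \<le> int l'"
  shows "(LINT x|sphere_measure. sY (int s) l m (fst x) (snd x) * cnj (sY (int s) l' m' (fst x) (snd x))) =
    (if l = l' \<and> m = m' then 1 else 0)"
proof -
  define w where "w = wig (l + s) (l - s) (nat (int l - m))"
  define w' where "w' = wig (l' + s) (l' - s) (nat (int l' - m'))"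
  define N where "N = sY_norm s l m * sY_norm s l' m'"
  have [continuous_intros]: "continuous_on A (\<lambda>x. w (f x))" "continuous_on A (\<lambda>x. w' (f x))"
    if "continuous_on A f" for A and f :: "real \<times> real \<Rightarrow> real"
    unfolding w_def w'_def using that by (auto intro!: continuous_intros)
  have ph: "cis (of_int m * \<phi>) * cnj (cis (of_int m' * \<phi>)) = cis (of_int (m - m') * \<phi>)" for \<phi>
    by (simp add: cis_cnj cis_mult algebra_simps)
  have prod: "sY (int s) l m \<theta> \<phi> * cnj (sY (int s) l' m' \<theta> \<phi>) =
      of_real (N * (w \<theta> * w' \<theta>)) * cis (of_int (m - m') * \<phi>)" for \<theta> \<phi>
    unfolding sY_eq[OF assms(1,2)] sY_eq[OF assms(3,4)] ph[symmetric] w_def w'_def N_def by (simp add: mult_ac)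
  have "(LINT x|sphere_measure. sY (int s) l m (fst x) (snd x) * cnj (sY (int s) l' m' (fst x) (snd x))) =
     integral {0..pi} (\<lambda>\<theta>. sin \<theta> *\<^sub>R integral {0..2 * pi} (\<lambda>\<phi>. of_real (N * (w \<theta> * w' \<theta>)) * cis (of_int (m - m') * \<phi>)))"
    by (subst integral_sphere_continuous) (auto intro!: continuous_intros sY_continuous assms simp: prod)
  also have "\<dots> = integral {0..pi} (\<lambda>\<theta>. of_real (sin \<theta> * (w \<theta> * w' \<theta>)) * (of_real N * (if m = m' then of_real (2 * pi) else 0)))"
    by (intro integral_cong) (simp add: integral_cis_int scaleR_conv_of_real del: of_int_diff)
  also have "\<dots> = of_real (wig_inner (l + s) (l - s) (nat (int l - m)) (l' + s) (l' - s) (nat (int l' - m'))) *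
      (of_real N * (if m = m' then of_real (2 * pi) else 0))"
    unfolding wig_inner_def w_def w'_def
    by (subst integral_of_real_complex[symmetric]) (auto simp: wig_inner_integrable)
  also have "\<dots> = (if l = l' \<and> m = m' then 1 else 0)"
  proof (cases "m = m'")
    case True
    note m = True
    show ?thesis
    proof (cases "l = l'")
      case True
      have kk: "l + s + (l - s) - nat (int l - m) = nat (int l + m)" "l + s + (l - s) = 2 * l" using assms by auto
      have "nat (int l - m) \<le> l + s + (l - s)" using assms by auto
      note n = wig_norm[OF this, unfolded kk(1), unfolded kk(2)]
      have N: "N = real (2 * l + 1) * fact (nat (int l + m)) * fact (nat (int l - m)) / (4 * pi * fact (l + s) * fact (l - s))"
        using sY_norm_square[of s l m] m True by (simp add: N_def power2_eq_square)
      have "wig_inner (l + s) (l - s) (nat (int l - m)) (l + s) (l - s) (nat (int l - m)) * (N * (2 * pi)) = 1"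
        unfolding n N by simp
      then show ?thesis using m True by (simp flip: of_real_mult)
    next
      case False
      have "wig_inner (l + s) (l - s) (nat (int l - m)) (l' + s) (l' - s) (nat (int l' - m')) = 0"
        by (rule wig_orthogonal) (use assms m False in \<open>auto simp: of_nat_diff\<close>)
      then show ?thesis using False by simp
    qed
  qed simp
  finally show ?thesis .
qed

section \<open>Completeness\<close>

text \<open>Each \<open>J d\<close> has degree exactly \<open>d\<close>, so subtracting a multiple
  of it removes the leading term. Strong induction on the degree then reaches every
  polynomial.\<close>

lemma poly_functional_zero:
  fixes L :: "real poly \<Rightarrow> real"
  assumes add: "\<And>p q. L (p + q) = L p + L q" and smult: "\<And>c p. L (smult c p) = c * L p"
    and deg: "\<And>d. degree (J d) \<le> d" "\<And>d. coeff (J d) d \<noteq> 0" and zero: "\<And>d. L (J d) = 0"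
  shows "L p = 0"
proof (induction "degree p" arbitrary: p rule: less_induct)
  case less
  define d where "d = degree p"
  define c where "c = coeff p d / coeff (J d) d"
  define r where "r = p - smult c (J d)"
  have p: "p = r + smult c (J d)" by (simp add: r_def)
  have L0: "L 0 = 0" using smult[of 0 0] by simp
  \<comment> \<open>In degree zero the remainder is itself zero; its degree cannot drop, so the
    induction hypothesis does not apply there.\<close>
  have "L r = 0"
  proof (cases "d = 0")
    case True
    then have "degree r = 0"
      using deg(1)[of 0] unfolding r_def d_def by (metis degree_diff_le degree_smult_le le_zero_eq order_trans)
    moreover have "coeff r 0 = 0" using deg(2)[of d] True by (simp add: r_def c_def)
    ultimately have "r = 0" by (metis leading_coeff_0_iff)
    then show ?thesis using L0 by simp
  next
    case False
    have "coeff r i = 0" if "i \<ge> d" for i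
    proof (cases "i = d")
      case True
      then show ?thesis using deg(2)[of d] by (simp add: r_def c_def)
    next
      case False
      then have "i > d" using that by simp
      then have "coeff p i = 0" "coeff (J d) i = 0"
        using deg(1)[of d] by (auto simp: d_def intro!: coeff_eq_0)
      then show ?thesis by (simp add: r_def)
    qed
    then have "degree r < d"
      using False by (metis degree_0 leading_coeff_0_iff not_le neq0_conv)
    then show ?thesis using less unfolding d_def by blast
  qed
  then show ?case
    by (subst p) (simp add: add smult zero)
qed

text \<open>Consecutive terms of the explicit sum differ by trading \<open>cos^2\<close> for
  \<open>sin^2\<close>, so the smallest exponents factor out. The alternating signs turn
  \<open>sin^2\<close> into \<open>cos^2 - 1\<close>; all contributions to the leading coefficient
  then have the same sign, and the degree is exactly \<open>d\<close>.\<close>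

lemma wig_factor:
  assumes "k \<le> p + q" and d: "d = min q k - (k - p)"
  shows "\<exists>J. degree J \<le> d \<and> coeff J d \<noteq> 0 \<and>
    (\<forall>\<theta>. wig p q k \<theta> = cos (\<theta> / 2) ^ ((q - k) + (k - q)) * sin (\<theta> / 2) ^ ((p - k) + (k - p)) * poly J ((cos (\<theta> / 2))\<^sup>2))"
proof -
  \<comment> \<open>The first index with \<open>k - j \<le> p\<close>; the last one with a nonzero
    term is \<open>min q k\<close>.\<close>
  define j0 where "j0 = k - p"
  define a where "a i = real (q choose (j0 + i)) * real (p choose (k - (j0 + i)))" for i
  define P :: "nat \<Rightarrow> real poly" where "P i = [:0, 1:] ^ (d - i) * [:- 1, 1:] ^ i" for i
  define J where "J = smult ((- 1) ^ j0) (\<Sum>i\<le>d. smult (a i) (P i))"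
  have jd: "j0 + d = min q k" using assms by (auto simp: j0_def)
  have a_pos: "a i > 0" if "i \<le> d" for i
    using that jd by (auto simp: a_def j0_def)
  have degP: "degree (P i) = d" "lead_coeff (P i) = 1" if "i \<le> d" for i
  proof -
    have m: "lead_coeff [:c, 1 :: real:] = 1" for c by simp
    show "lead_coeff (P i) = 1" unfolding P_def lead_coeff_mult lead_coeff_power by simp
    show "degree (P i) = d" using that unfolding P_def
      by (subst degree_mult_eq) (auto simp: degree_power_eq)
  qed
  have "degree J \<le> d"
    unfolding J_def using degP
    by (intro order_trans[OF degree_smult_le] degree_sum_le) (auto intro: order_trans[OF degree_smult_le])
  moreover have "coeff J d \<noteq> 0"
  proof -
    have "coeff J d = (- 1) ^ j0 * (\<Sum>i\<le>d. a i)"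
      unfolding J_def using degP by (simp add: coeff_sum)
    moreover have "(\<Sum>i\<le>d. a i) > 0" using a_pos by (intro sum_pos) auto
    ultimately show ?thesis by simp
  qed
  moreover have "wig p q k \<theta> = cos (\<theta> / 2) ^ ((q - k) + (k - q)) * sin (\<theta> / 2) ^ ((p - k) + (k - p)) * poly J ((cos (\<theta> / 2))\<^sup>2)" for \<theta>
  proof -
    define c where "c = cos (\<theta> / 2)"
    define \<sigma> where "\<sigma> = sin (\<theta> / 2)"
    have sq: "c\<^sup>2 - 1 = - (\<sigma>\<^sup>2)" by (simp add: c_def \<sigma>_def cos_squared_eq)
    have "wig p q k \<theta> = (\<Sum>j\<in>{j0..j0 + d}. real (q choose j) * real (p choose (k - j)) * (- 1) ^ j *
       c ^ ((q - j) + (k - j)) * \<sigma> ^ (j + (p - (k - j))))"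
      unfolding wig_explicit c_def \<sigma>_def jd unfolding j0_def
      by (rule sum.mono_neutral_right) (auto simp: not_le binomial_eq_0)
    also have "\<dots> = (\<Sum>i\<le>d. real (q choose (j0 + i)) * real (p choose (k - (j0 + i))) * (- 1) ^ (j0 + i) *
       c ^ ((q - (j0 + i)) + (k - (j0 + i))) * \<sigma> ^ (j0 + i + (p - (k - (j0 + i)))))"
      by (rule sum.reindex_bij_witness[of _ "\<lambda>i. j0 + i" "\<lambda>j. j - j0"]) auto
    also have "\<dots> = (\<Sum>i\<le>d. c ^ ((q - k) + (k - q)) * \<sigma> ^ ((p - k) + (k - p)) * ((- 1) ^ j0 * (a i * poly (P i) (c\<^sup>2))))"
    proof (intro sum.cong refl)
      fix i assume "i \<in> {..d}"
      then have i: "i \<le> d" by simp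
      have 1: "(q - (j0 + i)) + (k - (j0 + i)) = ((q - k) + (k - q)) + 2 * (d - i)"
        using i jd by (auto simp: j0_def)
      have 2: "j0 + i + (p - (k - (j0 + i))) = ((p - k) + (k - p)) + 2 * i"
        using i jd by (auto simp: j0_def)
      have "poly (P i) (c\<^sup>2) = (c\<^sup>2) ^ (d - i) * (c\<^sup>2 - 1) ^ i"
        by (simp add: P_def poly_power)
      also have "\<dots> = (- 1) ^ i * c ^ (2 * (d - i)) * \<sigma> ^ (2 * i)"
        unfolding sq power_mult by (simp add: power_minus[of "\<sigma>\<^sup>2"])
      finally show "real (q choose (j0 + i)) * real (p choose (k - (j0 + i))) * (- 1) ^ (j0 + i) *
          c ^ ((q - (j0 + i)) + (k - (j0 + i))) * \<sigma> ^ (j0 + i + (p - (k - (j0 + i))))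
        = c ^ ((q - k) + (k - q)) * \<sigma> ^ ((p - k) + (k - p)) * ((- 1) ^ j0 * (a i * poly (P i) (c\<^sup>2)))"
        unfolding 1 2 a_def power_add by (simp only: mult_ac)
    qed
    also have "\<dots> = c ^ ((q - k) + (k - q)) * \<sigma> ^ ((p - k) + (k - p)) * poly J (c\<^sup>2)"
      by (simp add: J_def poly_sum sum_distrib_left)
    finally show ?thesis by (simp add: c_def \<sigma>_def)
  qed
  ultimately show ?thesis by blast
qed

section \<open>Uniqueness from moments and from Fourier coefficients in one variable\<close>

lemma continuous_zero_of_cos_moments_real:
  fixes g :: "real \<Rightarrow> real"
  assumes g: "continuous_on {0..pi} g" and mom: "\<And>k. integral {0..pi} (\<lambda>\<theta>. g \<theta> * cos \<theta> ^ k) = 0"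
    and "\<theta> \<in> {0..pi}"
  shows "g \<theta> = 0"
proof -
  let ?h = "\<lambda>x. g (arccos x)"
  have h: "continuous_on {-1..1} ?h"
    by (rule continuous_on_compose2[OF g continuous_on_arccos']) (auto simp: arccos_lbound arccos_ubound)
  define B where "B = integral {0..pi} (\<lambda>\<theta>. \<bar>g \<theta>\<bar>)"
  have gi: "(\<lambda>\<theta>. \<bar>g \<theta>\<bar>) integrable_on {0..pi}"
    by (intro integrable_continuous_real continuous_intros g)
  have B: "B \<ge> 0" unfolding B_def by (intro integral_nonneg gi) auto
  \<comment> \<open>As the moments vanish, \<open>g\<close> is orthogonal to
    \<open>P (cos \<theta>)\<close>. So the integral of \<open>g^2\<close> equals that of
    \<open>g (g - P (cos \<theta>))\<close>, where the second factor is below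
    \<open>e\<close>.\<close>
  have le: "integral {0..pi} (\<lambda>\<theta>. g \<theta> * g \<theta>) \<le> e * B" if "e > 0" for e
  proof -
    obtain P where P: "real_polynomial_function P" "\<And>x. x \<in> {-1..1} \<Longrightarrow> \<bar>?h x - P x\<bar> < e"
      using Stone_Weierstrass_real_polynomial_function[OF _ h \<open>e > 0\<close>] by auto
    obtain a n where Pa: "P = (\<lambda>x. \<Sum>i\<le>n. a i * x ^ i)"
      using P(1) by (auto simp: real_polynomial_function_iff_sum)
    have cP: "continuous_on {0..pi} (\<lambda>\<theta>. P (cos \<theta>))"
      unfolding Pa by (intro continuous_intros)
    have "integral {0..pi} (\<lambda>\<theta>. g \<theta> * P (cos \<theta>)) = (\<Sum>i\<le>n. a i * integral {0..pi} (\<lambda>\<theta>. g \<theta> * cos \<theta> ^ i))"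
    proof -
      have "(\<lambda>\<theta>. g \<theta> * P (cos \<theta>)) = (\<lambda>\<theta>. \<Sum>i\<le>n. a i * (g \<theta> * cos \<theta> ^ i))"
        by (rule ext) (simp add: Pa sum_distrib_left mult_ac)
      moreover have "integral {0..pi} (\<lambda>\<theta>. \<Sum>i\<le>n. a i * (g \<theta> * cos \<theta> ^ i)) =
          (\<Sum>i\<le>n. integral {0..pi} (\<lambda>\<theta>. a i * (g \<theta> * cos \<theta> ^ i)))"
        by (rule integral_sum) (auto intro!: integrable_continuous_real continuous_intros g)
      ultimately show ?thesis by simp
    qed
    also have "\<dots> = 0" using mom by simp
    finally have 0: "integral {0..pi} (\<lambda>\<theta>. g \<theta> * P (cos \<theta>)) = 0" .
    have "integral {0..pi} (\<lambda>\<theta>. g \<theta> * g \<theta>) = integral {0..pi} (\<lambda>\<theta>. g \<theta> * g \<theta> - g \<theta> * P (cos \<theta>))"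
      by (subst integral_diff) (auto intro!: integrable_continuous_real continuous_intros g cP simp: 0)
    also have "\<dots> \<le> integral {0..pi} (\<lambda>\<theta>. e * \<bar>g \<theta>\<bar>)"
    proof (rule integral_le)
      fix \<theta> assume t: "\<theta> \<in> {0..pi}"
      have "\<bar>g \<theta> - P (cos \<theta>)\<bar> < e"
        using P(2)[of "cos \<theta>"] t by (auto simp: arccos_cos)
      then have "\<bar>g \<theta>\<bar> * \<bar>g \<theta> - P (cos \<theta>)\<bar> \<le> \<bar>g \<theta>\<bar> * e"
        by (intro mult_left_mono) auto
      moreover have "g \<theta> * (g \<theta> - P (cos \<theta>)) \<le> \<bar>g \<theta>\<bar> * \<bar>g \<theta> - P (cos \<theta>)\<bar>"
        by (simp flip: abs_mult)
      ultimately show "g \<theta> * g \<theta> - g \<theta> * P (cos \<theta>) \<le> e * \<bar>g \<theta>\<bar>"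
        by (simp add: right_diff_distrib mult.commute)
    qed (auto intro!: integrable_continuous_real continuous_intros g cP)
    also have "\<dots> = e * B" by (simp add: B_def)
    finally show ?thesis .
  qed
  have "integral {0..pi} (\<lambda>\<theta>. g \<theta> * g \<theta>) \<le> 0"
  proof (rule field_le_epsilon)
    fix e :: real assume "e > 0"
    then have "e / (B + 1) > 0" using B by simp
    from le[OF this] have "integral {0..pi} (\<lambda>\<theta>. g \<theta> * g \<theta>) \<le> e / (B + 1) * B" .
    also have "\<dots> \<le> e" using \<open>e > 0\<close> B by (simp add: field_simps)
    finally show "integral {0..pi} (\<lambda>\<theta>. g \<theta> * g \<theta>) \<le> 0 + e" by simp
  qed
  moreover have "integral {0..pi} (\<lambda>\<theta>. g \<theta> * g \<theta>) \<ge> 0"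
    by (intro integral_nonneg integrable_continuous_real continuous_intros g) auto
  ultimately have "integral {0..pi} (\<lambda>\<theta>. g \<theta> * g \<theta>) = 0" by simp
  moreover have "continuous_on {0..pi} (\<lambda>\<theta>. g \<theta> * g \<theta>)"
    by (intro continuous_intros g)
  ultimately have "\<forall>\<theta>\<in>{0..pi}. g \<theta> * g \<theta> = 0"
    using integral_eq_0_iff[of 0 pi "\<lambda>\<theta>. g \<theta> * g \<theta>"] by simp
  then have "g \<theta> * g \<theta> = 0" using \<open>\<theta> \<in> {0..pi}\<close> by blast
  then show ?thesis by simp
qed

lemma integral_Re_Im:
  fixes f :: "real \<Rightarrow> complex"
  assumes "continuous_on {a..b} f"
  shows "integral {a..b} (\<lambda>x. Re (f x)) = Re (integral {a..b} f)" "integral {a..b} (\<lambda>x. Im (f x)) = Im (integral {a..b} f)"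
  using integral_linear[OF integrable_continuous_real[OF assms] bounded_linear_Re]
    integral_linear[OF integrable_continuous_real[OF assms] bounded_linear_Im]
  by (simp_all add: o_def)

lemma continuous_zero_of_cos_moments:
  fixes g :: "real \<Rightarrow> complex"
  assumes g: "continuous_on {0..pi} g" and mom: "\<And>k. integral {0..pi} (\<lambda>\<theta>. g \<theta> * of_real (cos \<theta> ^ k)) = 0"
    and t: "\<theta> \<in> {0..pi}"
  shows "g \<theta> = 0"
proof -
  have c: "continuous_on {0..pi} (\<lambda>\<theta>. g \<theta> * of_real (cos \<theta> ^ k))" for k
    by (intro continuous_intros g)
  have "Re (g \<theta>) = 0"
    by (rule continuous_zero_of_cos_moments_real[OF _ _ t])
      (use integral_Re_Im[OF c] mom in \<open>auto intro!: continuous_intros g\<close>)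
  moreover have "Im (g \<theta>) = 0"
    by (rule continuous_zero_of_cos_moments_real[OF _ _ t])
      (use integral_Re_Im[OF c] mom in \<open>auto intro!: continuous_intros g\<close>)
  ultimately show ?thesis by (simp add: complex_eq_iff)
qed

lemma integral_reflect_2pi:
  fixes h :: "real \<Rightarrow> complex"
  assumes "continuous_on {0..2 * pi} h"
  shows "integral {0..2 * pi} h = integral {0..pi} (\<lambda>x. h x + h (2 * pi - x))"
proof -
  have h1: "continuous_on {0..pi} h" "continuous_on {pi..2 * pi} h"
    using assms by (auto elim: continuous_on_subset)
  have "(h has_integral integral {pi..2 * pi} h) (cbox pi (2 * pi))"
    using integrable_continuous_real[OF h1(2)] by (simp add: has_integral_iff cbox_interval)
  from has_integral_affinity[OF this, of "- 1" "2 * pi"]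
  have "((\<lambda>x. h (2 * pi - x)) has_integral integral {pi..2 * pi} h) ((\<lambda>x. 2 * pi - x) ` {pi..2 * pi})"
    by (simp add: cbox_interval algebra_simps)
  also have "(\<lambda>x. 2 * pi - x) ` {pi..2 * pi} = {0..pi}"
    by (simp add: image_diff_atLeastAtMost)
  finally have 2: "((\<lambda>x. h (2 * pi - x)) has_integral integral {pi..2 * pi} h) {0..pi}" .
  have "integral {0..2 * pi} h = integral {0..pi} h + integral {pi..2 * pi} h"
    by (rule Henstock_Kurzweil_Integration.integral_combine[symmetric])
      (auto intro!: integrable_continuous_real assms)
  also have "\<dots> = integral {0..pi} (\<lambda>x. h x + h (2 * pi - x))"
    using 2 integrable_continuous_real[OF h1(1)] by (subst integral_add) (auto simp: has_integral_iff)
  finally show ?thesis .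
qed

text \<open>Multiplication by \<open>cos \<phi>\<close> shifts the Fourier index by one both ways,
  so \<open>f\<close> has vanishing integrals against all powers of \<open>cos\<close>, also with an
  additional factor \<open>sin\<close>. Folding at \<open>pi\<close> turns these into moments on
  \<open>{0..pi}\<close> of the even part and of the odd part times \<open>sin\<close>. At the
  endpoints the even part only controls the sum of the two end values, so the statement concerns the
  open interval.\<close>

lemma fourier_unique:
  fixes f :: "real \<Rightarrow> complex"
  assumes f: "continuous_on {0..2 * pi} f"
    and zero: "\<And>m::int. integral {0..2 * pi} (\<lambda>\<phi>. f \<phi> * cis (of_int m * \<phi>)) = 0"
    and t: "\<phi> \<in> {0<..<2 * pi}"
  shows "f \<phi> = 0"
proof -
  have A: "integral {0..2 * pi} (\<lambda>\<phi>. f \<phi> * cis (of_int m * \<phi>) * of_real (cos \<phi> ^ k)) = 0" for m :: int and k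
  proof (induction k arbitrary: m)
    case 0
    then show ?case using zero by simp
  next
    case (Suc k)
    have *: "f \<phi> * cis (of_int m * \<phi>) * of_real (cos \<phi> ^ Suc k) =
      (f \<phi> * cis (of_int (m + 1) * \<phi>) * of_real (cos \<phi> ^ k)) * (1 / 2) + (f \<phi> * cis (of_int (m - 1) * \<phi>) * of_real (cos \<phi> ^ k)) * (1 / 2)" for \<phi>
    proof -
      have "cis (of_int m * \<phi>) * of_real (cos \<phi>) = (cis (of_int (m + 1) * \<phi>) + cis (of_int (m - 1) * \<phi>)) * (1 / 2)"
        by (simp add: complex_eq_iff field_simps cos_add sin_add cos_diff sin_diff)
      then have "f \<phi> * of_real (cos \<phi> ^ k) * (cis (of_int m * \<phi>) * of_real (cos \<phi>)) =
         f \<phi> * of_real (cos \<phi> ^ k) * ((cis (of_int (m + 1) * \<phi>) + cis (of_int (m - 1) * \<phi>)) * (1 / 2))" by (simp only:)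
      then show ?thesis by (simp only: power_Suc of_real_mult ring_distribs mult_ac)
    qed
    show ?case unfolding *
      by (subst integral_add) (auto intro!: integrable_continuous_real continuous_intros f simp: Suc.IH[of "m + 1", simplified] Suc.IH[of "m - 1", simplified])
  qed
  define e where "e \<phi> = f \<phi> + f (2 * pi - \<phi>)" for \<phi>
  define o' where "o' \<phi> = (f \<phi> - f (2 * pi - \<phi>)) * of_real (sin \<phi>)" for \<phi>
  have f': "continuous_on {0..pi} f" "continuous_on {0..pi} (\<lambda>\<phi>. f (2 * pi - \<phi>))"
    by (rule continuous_on_subset[OF f], simp, rule continuous_on_compose2[OF f], auto intro!: continuous_intros)
  have e: "e \<phi> = 0" if "\<phi> \<in> {0..pi}" for \<phi>
  proof (rule continuous_zero_of_cos_moments[OF _ _ that])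
    show "continuous_on {0..pi} e" unfolding e_def by (intro continuous_intros f')
    fix k
    have "0 = integral {0..2 * pi} (\<lambda>\<phi>. f \<phi> * of_real (cos \<phi> ^ k))" using A[of 0 k] by simp
    also have "\<dots> = integral {0..pi} (\<lambda>\<theta>. e \<theta> * complex_of_real (cos \<theta> ^ k))"
      by (subst integral_reflect_2pi, intro continuous_intros f) (simp add: e_def algebra_simps cos_diff)
    finally show "integral {0..pi} (\<lambda>\<theta>. e \<theta> * complex_of_real (cos \<theta> ^ k)) = 0" by simp
  qed
  have o: "o' \<phi> = 0" if "\<phi> \<in> {0..pi}" for \<phi>
  proof (rule continuous_zero_of_cos_moments[OF _ _ that])
    show "continuous_on {0..pi} o'" unfolding o'_def by (intro continuous_intros f')
    fix k
    have *: "f \<phi> * of_real (sin \<phi>) * of_real (cos \<phi> ^ k) =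
        (f \<phi> * cis (of_int 1 * \<phi>) * of_real (cos \<phi> ^ k)) * (- \<i> / 2) - (f \<phi> * cis (of_int (- 1) * \<phi>) * of_real (cos \<phi> ^ k)) * (- \<i> / 2)" for \<phi>
    proof -
      have "complex_of_real (sin \<phi>) = cis (of_int 1 * \<phi>) * (- \<i> / 2) - cis (of_int (- 1) * \<phi>) * (- \<i> / 2)"
        by (simp add: complex_eq_iff)
      then show ?thesis by (simp only:) (simp only: algebra_simps)
    qed
    have "0 = integral {0..2 * pi} (\<lambda>\<phi>. f \<phi> * of_real (sin \<phi>) * of_real (cos \<phi> ^ k))"
      unfolding * by (subst integral_diff) (auto intro!: integrable_continuous_real continuous_intros f simp: A[of 1 k, simplified] A[of "- 1" k, simplified])
    also have "\<dots> = integral {0..pi} (\<lambda>\<theta>. o' \<theta> * complex_of_real (cos \<theta> ^ k))"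
      by (subst integral_reflect_2pi, intro continuous_intros f) (simp add: o'_def algebra_simps cos_diff sin_diff)
    finally show "integral {0..pi} (\<lambda>\<theta>. o' \<theta> * complex_of_real (cos \<theta> ^ k)) = 0" by simp
  qed
  \<comment> \<open>At \<open>pi\<close> the factor \<open>sin\<close> hides the odd part, but there
    the two reflected arguments coincide and the even part suffices.\<close>
  have main: "f \<phi> = 0 \<and> f (2 * pi - \<phi>) = 0" if "\<phi> \<in> {0<..pi}" for \<phi>
  proof (cases "\<phi> = pi")
    case True
    then show ?thesis using e[of pi] by (simp add: e_def)
  next
    case False
    then have "sin \<phi> > 0" using that by (intro sin_gt_zero) auto
    then have "f \<phi> - f (2 * pi - \<phi>) = 0" using o[of \<phi>] that by (simp add: o'_def)
    then show ?thesis using e[of \<phi>] that by (simp add: e_def)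
  qed
  show ?thesis
  proof (cases "\<phi> \<le> pi")
    case True
    then show ?thesis using main[of \<phi>] t by simp
  next
    case False
    then show ?thesis using main[of "2 * pi - \<phi>"] t by simp
  qed
qed

text \<open>For fixed \<open>m\<close> the harmonics with \<open>l = l0 + d\<close> share one polar
  factor, multiplied by a polynomial of exact degree \<open>d\<close> in
  \<open>cos^2 (\<theta>/2)\<close>. So the Fourier coefficient of \<open>f\<close> with index
  \<open>m\<close>, times this factor and \<open>sin \<theta>\<close>, is orthogonal to all powers
  of \<open>cos \<theta>\<close>. The factor is positive away from the poles, and continuity carries
  the conclusion from the open rectangle to its closure.\<close>

lemma sphere_unique:
  fixes f :: "real \<times> real \<Rightarrow> complex"
  assumes f: "continuous_on sphere_domain f"
    and zero: "\<And>l m. s \<le> l \<Longrightarrow> \<bar>m\<bar> \<le> int l \<Longrightarrow>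
        (LINT x|sphere_measure. f x * cnj (sY (int s) l m (fst x) (snd x))) = 0"
    and x: "x \<in> sphere_domain"
  shows "f x = 0"
proof -
  have fsec: "continuous_on {0..2 * pi} (\<lambda>\<phi>. f (\<theta>, \<phi>))" if "\<theta> \<in> {0..pi}" for \<theta>
    by (rule continuous_on_compose2[OF f]) (use that in \<open>auto intro!: continuous_intros simp: sphere_domain_def\<close>)
  define F where "F m \<theta> = integral {0..2 * pi} (\<lambda>\<phi>. f (\<theta>, \<phi>) * cis (of_int (- m) * \<phi>))" for m :: int and \<theta>
  have F0: "F m \<theta> = 0" if t: "\<theta> \<in> {0<..<pi}" for m \<theta>
  proof -
    have Fc: "continuous_on {0..pi} (F m)"
    proof -
      have "continuous_on ({0..pi} \<times> cbox 0 (2 * pi)) (\<lambda>(\<theta>, \<phi>). f (\<theta>, \<phi>) * cis (of_int (- m) * \<phi>))"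
        using f unfolding split_beta by (intro continuous_intros) (simp_all add: sphere_domain_def cbox_interval)
      from integral_continuous_on_param[OF this] show ?thesis
        by (simp add: F_def[abs_def] cbox_interval)
    qed
    \<comment> \<open>The exponents \<open>|m - s|\<close> and \<open>|m + s|\<close> of the common
      factor do not depend on \<open>d\<close>; this is what permits one family \<open>J\<close> for
      fixed \<open>m\<close>.\<close>
    define A where "A = nat \<bar>m - int s\<bar>"
    define B where "B = nat \<bar>m + int s\<bar>"
    \<comment> \<open>The smallest degree that carries both the spin \<open>s\<close> and the index
      \<open>m\<close>.\<close>
    define l0 where "l0 = nat (max \<bar>m\<bar> (int s))"
    have "\<exists>J. degree J \<le> d \<and> coeff J d \<noteq> 0 \<and>
      (\<forall>\<theta>. wig (l0 + d + s) (l0 + d - s) (nat (int (l0 + d) - m)) \<theta> =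
         cos (\<theta> / 2) ^ A * sin (\<theta> / 2) ^ B * poly J ((cos (\<theta> / 2))\<^sup>2))" for d
    proof -
      define k where "k = nat (int (l0 + d) - m)"
      have k: "int k = int l0 + int d - m" by (auto simp: k_def l0_def)
      have sl: "s \<le> l0" "\<bar>m\<bar> \<le> int l0" by (auto simp: l0_def)
      have A: "(l0 + d - s - k) + (k - (l0 + d - s)) = A" using k sl unfolding A_def by arith
      have B: "(l0 + d + s - k) + (k - (l0 + d + s)) = B" using k sl unfolding B_def by arith
      \<comment> \<open>One of the bounds on \<open>l0\<close> is attained, which makes the number
        of nonzero terms in the explicit sum exactly \<open>d + 1\<close>.\<close>
      have "int l0 = int s \<or> int l0 = m \<or> int l0 = - m" by (auto simp: l0_def max_def abs_if)
      then have d: "d = min (l0 + d - s) k - (k - (l0 + d + s))" using k sl by arith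
      have "k \<le> l0 + d + s + (l0 + d - s)" using k sl by auto
      from wig_factor[OF this d] show ?thesis unfolding A B unfolding k_def .
    qed
    then obtain J where J: "\<And>d. degree (J d) \<le> d" "\<And>d. coeff (J d) d \<noteq> 0"
      "\<And>d \<theta>. wig (l0 + d + s) (l0 + d - s) (nat (int (l0 + d) - m)) \<theta> =
         cos (\<theta> / 2) ^ A * sin (\<theta> / 2) ^ B * poly (J d) ((cos (\<theta> / 2))\<^sup>2)"
      by metis
    define G where "G \<theta> = F m \<theta> * of_real (sin \<theta> * (cos (\<theta> / 2) ^ A * sin (\<theta> / 2) ^ B))" for \<theta>
    have Gc: "continuous_on {0..pi} G" unfolding G_def by (intro continuous_intros Fc) auto
    have Gi: "(\<lambda>\<theta>. G \<theta> * of_real (poly p ((cos (\<theta> / 2))\<^sup>2))) integrable_on {0..pi}" for p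
      by (intro integrable_continuous_real continuous_intros Gc) auto
    have GJ: "integral {0..pi} (\<lambda>\<theta>. G \<theta> * of_real (poly (J d) ((cos (\<theta> / 2))\<^sup>2))) = 0" for d
    proof -
      define l where "l = l0 + d"
      have l: "s \<le> l" "\<bar>m\<bar> \<le> int l" by (auto simp: l_def l0_def)
      have c: "cnj (cis (of_int m * \<phi>)) = cis (of_int (- m) * \<phi>)" for \<phi> by (simp add: cis_cnj)
      have "0 = (LINT x|sphere_measure. f x * cnj (sY (int s) l m (fst x) (snd x)))"
        using zero[OF l] by simp
      also have "\<dots> = integral {0..pi} (\<lambda>\<theta>. sin \<theta> *\<^sub>R integral {0..2 * pi} (\<lambda>\<phi>. f (\<theta>, \<phi>) * cnj (sY (int s) l m \<theta> \<phi>)))"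
        by (subst integral_sphere_continuous) (auto intro!: continuous_intros f sY_continuous l)
      also have "\<dots> = integral {0..pi} (\<lambda>\<theta>. of_real (sY_norm s l m) * (G \<theta> * of_real (poly (J d) ((cos (\<theta> / 2))\<^sup>2))))"
      proof (intro integral_cong)
        fix \<theta> assume "\<theta> \<in> {0..pi}"
        have "f (\<theta>, \<phi>) * cnj (sY (int s) l m \<theta> \<phi>) = of_real (sY_norm s l m * wig (l + s) (l - s) (nat (int l - m)) \<theta>) * (f (\<theta>, \<phi>) * cis (of_int (- m) * \<phi>))" for \<phi>
          unfolding sY_eq[OF l] complex_cnj_mult c complex_cnj_complex_of_real by (simp only: mult_ac)
        then have *: "integral {0..2 * pi} (\<lambda>\<phi>. f (\<theta>, \<phi>) * cnj (sY (int s) l m \<theta> \<phi>)) =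
            of_real (sY_norm s l m * wig (l + s) (l - s) (nat (int l - m)) \<theta>) * F m \<theta>"
          by (simp only: F_def integral_mult_right)
        show "sin \<theta> *\<^sub>R integral {0..2 * pi} (\<lambda>\<phi>. f (\<theta>, \<phi>) * cnj (sY (int s) l m \<theta> \<phi>)) =
           of_real (sY_norm s l m) * (G \<theta> * of_real (poly (J d) ((cos (\<theta> / 2))\<^sup>2)))"
          unfolding * unfolding l_def J(3) by (simp add: G_def scaleR_conv_of_real mult_ac)
      qed
      also have "\<dots> = of_real (sY_norm s l m) * integral {0..pi} (\<lambda>\<theta>. G \<theta> * of_real (poly (J d) ((cos (\<theta> / 2))\<^sup>2)))"
        by simp
      finally show ?thesis using sY_norm_nonzero[of s l m] by simp
    qed
    define L where "L p = integral {0..pi} (\<lambda>\<theta>. G \<theta> * of_real (poly p ((cos (\<theta> / 2))\<^sup>2)))" for p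
    have La: "L (p + q) = L p + L q" for p q
      unfolding L_def by (subst integral_add[symmetric]) (auto intro!: Gi simp: algebra_simps)
    have Ls: "L (smult c p) = of_real c * L p" for c p
      unfolding L_def integral_mult_right[symmetric] by (simp add: mult_ac)
    have "Re (L p) = 0" "Im (L p) = 0" for p
      by (rule poly_functional_zero[where J = J]; use GJ in \<open>simp add: La Ls J L_def[of "J _"]\<close>)+
    then have L0: "L p = 0" for p by (simp add: complex_eq_iff)
    have "G \<theta> = 0"
    proof (rule continuous_zero_of_cos_moments[OF Gc])
      fix k
      have c: "2 * (cos (\<theta> / 2))\<^sup>2 - 1 = cos \<theta>" for \<theta> :: real
        using cos_double_cos[of "\<theta> / 2"] by simp
      \<comment> \<open>The double angle formula
        \<open>cos \<theta> = 2 cos^2 (\<theta>/2) - 1\<close> makes powers of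
        \<open>cos \<theta>\<close> polynomials in the variable of \<open>J\<close>.\<close>
      have "poly ([:- 1, 2:] ^ k) y = (2 * y - 1) ^ k" for y :: real
        by (simp add: poly_power mult.commute)
      then have P: "poly ([:- 1, 2:] ^ k) ((cos (\<theta> / 2))\<^sup>2) = cos \<theta> ^ k" for \<theta> :: real
        by (simp only: c)
      show "integral {0..pi} (\<lambda>\<theta>. G \<theta> * complex_of_real (cos \<theta> ^ k)) = 0"
        using L0[of "[:- 1, 2:] ^ k"] unfolding L_def P .
    qed (use t in auto)
    moreover have "sin \<theta> > 0" by (rule sin_gt_zero) (use t in auto)
    moreover have "cos (\<theta> / 2) > 0" by (rule cos_gt_zero_pi) (use t in auto)
    moreover have "sin (\<theta> / 2) > 0" by (rule sin_gt_zero) (use t in auto)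
    ultimately show ?thesis by (simp add: G_def)
  qed
  have int0: "f (\<theta>, \<phi>) = 0" if "\<theta> \<in> {0<..<pi}" "\<phi> \<in> {0<..<2 * pi}" for \<theta> \<phi>
  proof (rule fourier_unique[OF fsec _ that(2)])
    show "integral {0..2 * pi} (\<lambda>\<phi>. f (\<theta>, \<phi>) * cis (of_int m * \<phi>)) = 0" for m
      using F0[OF that(1), of "- m"] by (simp add: F_def)
  qed (use that in auto)
  have "closure ({0<..<pi} \<times> {0<..<2 * pi}) = sphere_domain"
    by (simp add: closure_Times sphere_domain_def)
  then show ?thesis
    using continuous_constant_on_closure[of "{0<..<pi} \<times> {0<..<2 * pi}" f 0 x] f x int0 by auto
qed

section \<open>Second order fields on the sphere\<close>

lemma borel_measurable_cnj [measurable]: "cnj \<in> borel_measurable borel"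
  by (intro borel_measurable_continuous_onI continuous_intros)

lemma mult_le_sum_squares:
  fixes x y :: real
  assumes "0 \<le> x" "0 \<le> y"
  shows "x * y \<le> x\<^sup>2 + y\<^sup>2"
  using sum_squares_bound[of x y] mult_nonneg_nonneg[OF assms] by linarith

lemma integrable_mult_cnj:
  fixes f g :: "'a \<Rightarrow> complex"
  assumes "square_integrable_rv M f" "square_integrable_rv M g"
  shows "integrable M (\<lambda>x. f x * cnj (g x))"
proof (rule Bochner_Integration.integrable_bound)
  show "integrable M (\<lambda>x. (cmod (f x))\<^sup>2 + (cmod (g x))\<^sup>2)"
    using assms by (simp add: square_integrable_rv_def)
  have [measurable]: "f \<in> borel_measurable M" "g \<in> borel_measurable M"
    using assms by (auto simp: square_integrable_rv_def)
  show "(\<lambda>x. f x * cnj (g x)) \<in> borel_measurable M"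
    by measurable
  show "AE x in M. norm (f x * cnj (g x)) \<le> norm ((cmod (f x))\<^sup>2 + (cmod (g x))\<^sup>2)"
    by (rule AE_I2) (simp add: norm_mult mult_le_sum_squares)
qed

lemma square_integrable_cmult:
  "square_integrable_rv M f \<Longrightarrow> square_integrable_rv M (\<lambda>x. c * f x)"
  by (auto simp: square_integrable_rv_def norm_mult power_mult_distrib)

lemma square_integrable_add:
  fixes f g :: "'a \<Rightarrow> complex"
  assumes "square_integrable_rv M f" "square_integrable_rv M g"
  shows "square_integrable_rv M (\<lambda>x. f x + g x)"
  unfolding square_integrable_rv_def
proof
  have [measurable]: "f \<in> borel_measurable M" "g \<in> borel_measurable M"
    using assms by (auto simp: square_integrable_rv_def)
  show "(\<lambda>x. f x + g x) \<in> borel_measurable M"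
    by measurable
  show "integrable M (\<lambda>x. (cmod (f x + g x))\<^sup>2)"
  proof (rule Bochner_Integration.integrable_bound)
    show "integrable M (\<lambda>x. 2 * (cmod (f x))\<^sup>2 + 2 * (cmod (g x))\<^sup>2)"
      using assms by (simp add: square_integrable_rv_def)
    show "(\<lambda>x. (cmod (f x + g x))\<^sup>2) \<in> borel_measurable M"
      by measurable
    show "AE x in M. norm ((cmod (f x + g x))\<^sup>2) \<le> norm (2 * (cmod (f x))\<^sup>2 + 2 * (cmod (g x))\<^sup>2)"
    proof (rule AE_I2)
      fix x
      have "(cmod (f x + g x))\<^sup>2 \<le> (cmod (f x) + cmod (g x))\<^sup>2"
        by (intro power_mono norm_triangle_ineq) auto
      also have "\<dots> \<le> 2 * (cmod (f x))\<^sup>2 + 2 * (cmod (g x))\<^sup>2"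
        using sum_squares_bound[of "cmod (f x)" "cmod (g x)"] by (simp add: power2_sum)
      finally show "norm ((cmod (f x + g x))\<^sup>2) \<le> norm (2 * (cmod (f x))\<^sup>2 + 2 * (cmod (g x))\<^sup>2)"
        by simp
    qed
  qed
qed

lemma square_integrable_diff:
  fixes f g :: "'a \<Rightarrow> complex"
  assumes "square_integrable_rv M f" "square_integrable_rv M g"
  shows "square_integrable_rv M (\<lambda>x. f x - g x)"
  using square_integrable_add[OF assms(1) square_integrable_cmult[OF assms(2), of "- 1"]] by simp

lemma square_integrable_zero: "square_integrable_rv M (\<lambda>x. 0)"
  by (simp add: square_integrable_rv_def)

lemma square_integrable_sum:
  fixes f :: "'i \<Rightarrow> 'a \<Rightarrow> complex"
  assumes "\<And>i. i \<in> I \<Longrightarrow> square_integrable_rv M (f i)"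
  shows "square_integrable_rv M (\<lambda>x. \<Sum>i\<in>I. f i x)"
  using assms
  by (induction I rule: infinite_finite_induct) (auto intro: square_integrable_zero square_integrable_add)

lemma Cauchy_Schwarz_complex:
  fixes f g :: "'a \<Rightarrow> complex"
  assumes f: "square_integrable_rv M f" and g: "square_integrable_rv M g"
  shows "(cmod (LINT x|M. f x * cnj (g x)))\<^sup>2 \<le> (LINT x|M. (cmod (f x))\<^sup>2) * (LINT x|M. (cmod (g x))\<^sup>2)"
proof -
  have [measurable]: "f \<in> borel_measurable M" "g \<in> borel_measurable M"
    using assms by (auto simp: square_integrable_rv_def)
  have fi: "integrable M (\<lambda>x. (cmod (f x))\<^sup>2)" and gi: "integrable M (\<lambda>x. (cmod (g x))\<^sup>2)"
    using assms by (auto simp: square_integrable_rv_def)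
  have "ennreal (cmod (LINT x|M. f x * cnj (g x))) \<le> (\<integral>\<^sup>+x. ennreal (cmod (f x)) * ennreal (cmod (g x)) \<partial>M)"
    using integral_norm_bound_ennreal[OF integrable_mult_cnj[OF f g]] by (simp add: norm_mult ennreal_mult)
  then have "(ennreal (cmod (LINT x|M. f x * cnj (g x))))\<^sup>2 \<le> (\<integral>\<^sup>+x. ennreal (cmod (f x)) * ennreal (cmod (g x)) \<partial>M)\<^sup>2"
    by (intro power_mono) auto
  also have "\<dots> \<le> (\<integral>\<^sup>+x. (ennreal (cmod (f x)))\<^sup>2 \<partial>M) * (\<integral>\<^sup>+x. (ennreal (cmod (g x)))\<^sup>2 \<partial>M)"
    by (rule Cauchy_Schwarz_nn_integral) auto
  also have "\<dots> = ennreal (LINT x|M. (cmod (f x))\<^sup>2) * ennreal (LINT x|M. (cmod (g x))\<^sup>2)"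
    using nn_integral_eq_integral[OF fi] nn_integral_eq_integral[OF gi] by (simp add: ennreal_power)
  also have "\<dots> = ennreal ((LINT x|M. (cmod (f x))\<^sup>2) * (LINT x|M. (cmod (g x))\<^sup>2))"
    by (simp add: ennreal_mult)
  finally have "ennreal ((cmod (LINT x|M. f x * cnj (g x)))\<^sup>2) \<le> ennreal ((LINT x|M. (cmod (f x))\<^sup>2) * (LINT x|M. (cmod (g x))\<^sup>2))"
    by (simp add: ennreal_power)
  then show ?thesis
    by (subst (asm) ennreal_le_iff) auto
qed

lemma cnj_integral_mult_cnj:
  fixes f g :: "'a \<Rightarrow> complex"
  assumes "square_integrable_rv M f" "square_integrable_rv M g"
  shows "cnj (LINT x|M. f x * cnj (g x)) = (LINT x|M. g x * cnj (f x))"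
  using Bochner_Integration.integral_cnj[of M "\<lambda>x. f x * cnj (g x)"] by (simp add: mult.commute)

lemma integral_cmod_square:
  fixes f :: "'a \<Rightarrow> complex"
  shows "(LINT x|M. f x * cnj (f x)) = of_real (LINT x|M. (cmod (f x))\<^sup>2)"
  by (simp only: complex_norm_square[symmetric] integral_complex_of_real)

text \<open>The difference of the inner products splits into three terms, each containing one of the
  errors \<open>f' - f n\<close> and \<open>g' - g n\<close>; Cauchy-Schwarz makes each of them tend
  to zero.\<close>

lemma tendsto_inner_L2:
  fixes f g :: "nat \<Rightarrow> 'a \<Rightarrow> complex"
  assumes f: "\<And>n. square_integrable_rv M (f n)" "square_integrable_rv M f'"
    and g: "\<And>n. square_integrable_rv M (g n)" "square_integrable_rv M g'"
    and cf: "(\<lambda>n. LINT x|M. (cmod (f' x - f n x))\<^sup>2) \<longlonglongrightarrow> 0"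
    and cg: "(\<lambda>n. LINT x|M. (cmod (g' x - g n x))\<^sup>2) \<longlonglongrightarrow> 0"
  shows "(\<lambda>n. LINT x|M. f n x * cnj (g n x)) \<longlonglongrightarrow> (LINT x|M. f' x * cnj (g' x))"
proof -
  let ?N = "\<lambda>h. LINT x|M. (cmod (h x))\<^sup>2"
  have *: "f' x * cnj (g' x) - f n x * cnj (g n x) =
      (f' x - f n x) * cnj (g' x) + f' x * cnj (g' x - g n x) - (f' x - f n x) * cnj (g' x - g n x)" for n x
    by (simp add: algebra_simps)
  note d = square_integrable_diff[OF f(2) f(1)] square_integrable_diff[OF g(2) g(1)]
  have eq: "(LINT x|M. f' x * cnj (g' x)) - (LINT x|M. f n x * cnj (g n x)) =
      (LINT x|M. (f' x - f n x) * cnj (g' x)) + (LINT x|M. f' x * cnj (g' x - g n x)) -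
      (LINT x|M. (f' x - f n x) * cnj (g' x - g n x))" for n
    unfolding Bochner_Integration.integral_diff[OF integrable_mult_cnj[OF f(2) g(2)] integrable_mult_cnj[OF f(1) g(1)], symmetric] *
    by (simp add: integrable_mult_cnj[OF d(1) g(2)] integrable_mult_cnj[OF f(2) d(2)] integrable_mult_cnj[OF d(1) d(2)]
        del: complex_cnj_diff)
  have lim: "(\<lambda>n. LINT x|M. u n x * cnj (v n x)) \<longlonglongrightarrow> 0"
    if u: "\<And>n. square_integrable_rv M (u n)" and v: "\<And>n. square_integrable_rv M (v n)"
      and 0: "(\<lambda>n. ?N (u n) * ?N (v n)) \<longlonglongrightarrow> 0" for u v :: "nat \<Rightarrow> 'a \<Rightarrow> complex"
  proof -
    have "(\<lambda>n. (cmod (LINT x|M. u n x * cnj (v n x)))\<^sup>2) \<longlonglongrightarrow> 0"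
      by (rule tendsto_sandwich[OF _ _ tendsto_const 0])
        (intro always_eventually allI Cauchy_Schwarz_complex u v zero_le_power2)+
    then have "(\<lambda>n. cmod (LINT x|M. u n x * cnj (v n x))) \<longlonglongrightarrow> 0"
      using tendsto_real_sqrt[of "\<lambda>n. (cmod (LINT x|M. u n x * cnj (v n x)))\<^sup>2" 0 sequentially] by simp
    then show ?thesis by (rule tendsto_norm_zero_cancel)
  qed
  have "(\<lambda>n. (LINT x|M. (f' x - f n x) * cnj (g' x)) + (LINT x|M. f' x * cnj (g' x - g n x)) -
      (LINT x|M. (f' x - f n x) * cnj (g' x - g n x))) \<longlonglongrightarrow> 0 + 0 - 0"
  proof (intro tendsto_intros lim d f(2) g(2))
    show "(\<lambda>n. ?N (\<lambda>x. f' x - f n x) * ?N g') \<longlonglongrightarrow> 0"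
      using tendsto_mult_right[OF cf, of "?N g'"] by simp
    show "(\<lambda>n. ?N f' * ?N (\<lambda>x. g' x - g n x)) \<longlonglongrightarrow> 0"
      using tendsto_mult_left[OF cg, of "?N f'"] by simp
    show "(\<lambda>n. ?N (\<lambda>x. f' x - f n x) * ?N (\<lambda>x. g' x - g n x)) \<longlonglongrightarrow> 0"
      using tendsto_mult[OF cf cg] by simp
  qed
  then have "(\<lambda>n. (LINT x|M. f' x * cnj (g' x)) - (LINT x|M. f n x * cnj (g n x))) \<longlonglongrightarrow> 0"
    unfolding eq by simp
  then have "(\<lambda>n. (LINT x|M. f' x * cnj (g' x)) - ((LINT x|M. f' x * cnj (g' x)) - (LINT x|M. f n x * cnj (g n x))))
      \<longlonglongrightarrow> (LINT x|M. f' x * cnj (g' x)) - 0"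
    by (intro tendsto_intros)
  then show ?thesis by simp
qed

text \<open>A bound on the second moment that is uniform in the point makes it integrable over the
  product with the finite measure of the sphere, as Fubini requires.\<close>

definition field_on_sphere :: "'w measure \<Rightarrow> ('w \<Rightarrow> real \<times> real \<Rightarrow> complex) \<Rightarrow> real \<Rightarrow> bool" where
  "field_on_sphere M Z B \<longleftrightarrow> case_prod Z \<in> borel_measurable (M \<Otimes>\<^sub>M sphere_measure) \<and>
     (\<forall>x\<in>sphere_domain. integrable M (\<lambda>\<omega>. (cmod (Z \<omega> x))\<^sup>2) \<and> (LINT \<omega>|M. (cmod (Z \<omega> x))\<^sup>2) \<le> B)"

definition sphere_coeff :: "('w \<Rightarrow> real \<times> real \<Rightarrow> complex) \<Rightarrow> (real \<times> real \<Rightarrow> complex) \<Rightarrow> 'w \<Rightarrow> complex" where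
  "sphere_coeff Z e \<omega> = (LINT x|sphere_measure. Z \<omega> x * cnj (e x))"

context prob_space
begin

lemma pair_sphere: "pair_sigma_finite M sphere_measure"
  by (intro pair_sigma_finite.intro sphere.sigma_finite_measure_axioms sigma_finite_measure_axioms)

lemma field_on_sphere_section:
  assumes "field_on_sphere M Z B" "x \<in> sphere_domain"
  shows "square_integrable_rv M (\<lambda>\<omega>. Z \<omega> x)"
proof -
  have "(\<lambda>\<omega>. (\<omega>, x)) \<in> measurable M (M \<Otimes>\<^sub>M sphere_measure)"
    using assms(2) by (intro measurable_Pair2') simp
  then have "(\<lambda>\<omega>. case_prod Z (\<omega>, x)) \<in> borel_measurable M"
    by (rule measurable_compose) (use assms(1) in \<open>simp add: field_on_sphere_def\<close>)
  then show ?thesis using assms by (auto simp: field_on_sphere_def square_integrable_rv_def)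
qed

lemma field_on_sphere_integrable:
  assumes Z: "field_on_sphere M Z B"
  shows "integrable (M \<Otimes>\<^sub>M sphere_measure) (\<lambda>(\<omega>, x). (cmod (Z \<omega> x))\<^sup>2)"
proof -
  interpret P: pair_sigma_finite M sphere_measure by (rule pair_sphere)
  have [measurable]: "case_prod Z \<in> borel_measurable (M \<Otimes>\<^sub>M sphere_measure)"
    using Z by (simp add: field_on_sphere_def)
  have "(\<integral>\<^sup>+z. ennreal ((cmod (case_prod Z z))\<^sup>2) \<partial>(M \<Otimes>\<^sub>M sphere_measure)) =
      (\<integral>\<^sup>+x. (\<integral>\<^sup>+\<omega>. ennreal ((cmod (Z \<omega> x))\<^sup>2) \<partial>M) \<partial>sphere_measure)"
    by (subst P.nn_integral_snd[symmetric]) auto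
  also have "\<dots> \<le> (\<integral>\<^sup>+x. ennreal B \<partial>sphere_measure)"
  proof (rule nn_integral_mono)
    fix x assume "x \<in> space sphere_measure"
    then have x: "integrable M (\<lambda>\<omega>. (cmod (Z \<omega> x))\<^sup>2)" "(LINT \<omega>|M. (cmod (Z \<omega> x))\<^sup>2) \<le> B"
      using Z by (auto simp: field_on_sphere_def)
    show "(\<integral>\<^sup>+\<omega>. ennreal ((cmod (Z \<omega> x))\<^sup>2) \<partial>M) \<le> ennreal B"
      by (subst nn_integral_eq_integral[OF x(1)]) (auto intro!: ennreal_leI x)
  qed
  also have "\<dots> < \<infinity>"
    by (simp add: sphere.emeasure_eq_measure ennreal_mult_less_top)
  finally have "(\<integral>\<^sup>+z. ennreal ((cmod (case_prod Z z))\<^sup>2) \<partial>(M \<Otimes>\<^sub>M sphere_measure)) < \<infinity>" .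
  then have "integrable (M \<Otimes>\<^sub>M sphere_measure) (\<lambda>z. (cmod (case_prod Z z))\<^sup>2)"
    by (intro integrableI_bounded) auto
  then show ?thesis by (simp add: split_beta')
qed

text \<open>Paths are square integrable over the sphere only almost surely. For these Cauchy-Schwarz
  holds path by path, and Fubini turns the expected norm of the path into the integral of the second
  moments.\<close>

lemma sphere_coeff_bound:
  assumes Z: "field_on_sphere M Z B" and e: "continuous_on sphere_domain e"
  shows "square_integrable_rv M (sphere_coeff Z e)"
    and "(LINT \<omega>|M. (cmod (sphere_coeff Z e \<omega>))\<^sup>2) \<le>
      (LINT x|sphere_measure. (LINT \<omega>|M. (cmod (Z \<omega> x))\<^sup>2)) * (LINT x|sphere_measure. (cmod (e x))\<^sup>2)"
proof -
  interpret P: pair_sigma_finite M sphere_measure by (rule pair_sphere)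
  have Zm [measurable]: "case_prod Z \<in> borel_measurable (M \<Otimes>\<^sub>M sphere_measure)"
    using Z by (simp add: field_on_sphere_def)
  have em [measurable]: "e \<in> borel_measurable sphere_measure"
    by (rule measurable_sphere_continuous[OF e])
  have e2: "square_integrable_rv sphere_measure e"
    unfolding square_integrable_rv_def
    by (intro conjI em integrable_sphere_continuous continuous_intros e)
  note int = field_on_sphere_integrable[OF Z]
  have m: "sphere_coeff Z e \<in> borel_measurable M"
    unfolding sphere_coeff_def[abs_def] by measurable
  have "AE \<omega> in M. integrable sphere_measure (\<lambda>x. (cmod (Z \<omega> x))\<^sup>2)"
    using P.AE_integrable_fst'[OF int] by simp
  then have bound: "AE \<omega> in M. (cmod (sphere_coeff Z e \<omega>))\<^sup>2 \<le>
      (LINT x|sphere_measure. (cmod (Z \<omega> x))\<^sup>2) * (LINT x|sphere_measure. (cmod (e x))\<^sup>2)"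
    using AE_space
  proof eventually_elim
    case (elim \<omega>)
    have "Z \<omega> \<in> borel_measurable sphere_measure"
      using measurable_compose[OF measurable_Pair1'[OF elim(2)] Zm] by simp
    then have "square_integrable_rv sphere_measure (Z \<omega>)"
      using elim(1) by (simp add: square_integrable_rv_def)
    from Cauchy_Schwarz_complex[OF this e2] show ?case by (simp add: sphere_coeff_def)
  qed
  have i1: "integrable M (\<lambda>\<omega>. (LINT x|sphere_measure. (cmod (Z \<omega> x))\<^sup>2) * (LINT x|sphere_measure. (cmod (e x))\<^sup>2))"
    using P.integrable_fst'[OF int] by simp
  have i2: "integrable M (\<lambda>\<omega>. (cmod (sphere_coeff Z e \<omega>))\<^sup>2)"
  proof (rule Bochner_Integration.integrable_bound[OF i1])
    show "AE \<omega> in M. norm ((cmod (sphere_coeff Z e \<omega>))\<^sup>2) \<le> norm ((LINT x|sphere_measure. (cmod (Z \<omega> x))\<^sup>2) * (LINT x|sphere_measure. (cmod (e x))\<^sup>2))"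
      using bound by eventually_elim simp
  qed (use m in measurable)
  show "square_integrable_rv M (sphere_coeff Z e)"
    using m i2 by (simp add: square_integrable_rv_def)
  have "(LINT \<omega>|M. (cmod (sphere_coeff Z e \<omega>))\<^sup>2) \<le>
      (LINT \<omega>|M. (LINT x|sphere_measure. (cmod (Z \<omega> x))\<^sup>2) * (LINT x|sphere_measure. (cmod (e x))\<^sup>2))"
    by (rule integral_mono_AE[OF i2 i1 bound])
  also have "\<dots> = (LINT \<omega>|M. (LINT x|sphere_measure. (cmod (Z \<omega> x))\<^sup>2)) * (LINT x|sphere_measure. (cmod (e x))\<^sup>2)"
    by simp
  also have "(LINT \<omega>|M. (LINT x|sphere_measure. (cmod (Z \<omega> x))\<^sup>2)) = (LINT x|sphere_measure. (LINT \<omega>|M. (cmod (Z \<omega> x))\<^sup>2))"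
    using P.Fubini_integral[OF int] by simp
  finally show "(LINT \<omega>|M. (cmod (sphere_coeff Z e \<omega>))\<^sup>2) \<le>
      (LINT x|sphere_measure. (LINT \<omega>|M. (cmod (Z \<omega> x))\<^sup>2)) * (LINT x|sphere_measure. (cmod (e x))\<^sup>2)" .
qed

lemma expectation_mult_cnj_sphere_coeff:
  assumes Z: "field_on_sphere M Z B" and e: "continuous_on sphere_domain e" and Y: "square_integrable_rv M Y"
  shows "(LINT \<omega>|M. Y \<omega> * cnj (sphere_coeff Z e \<omega>)) =
      (LINT x|sphere_measure. (LINT \<omega>|M. Y \<omega> * cnj (Z \<omega> x)) * e x)"
proof -
  interpret P: pair_sigma_finite M sphere_measure by (rule pair_sphere)
  have Zm [measurable]: "case_prod Z \<in> borel_measurable (M \<Otimes>\<^sub>M sphere_measure)"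
    using Z by (simp add: field_on_sphere_def)
  have em [measurable]: "e \<in> borel_measurable sphere_measure"
    by (rule measurable_sphere_continuous[OF e])
  have Ym [measurable]: "Y \<in> borel_measurable M"
    using Y by (simp add: square_integrable_rv_def)
  have "bounded (e ` sphere_domain)"
    using e compact_sphere_domain by (intro compact_imp_bounded compact_continuous_image)
  then obtain K where K: "\<And>x. x \<in> sphere_domain \<Longrightarrow> cmod (e x) \<le> K"
    by (auto simp: bounded_iff)
  have "pi \<ge> (0::real)" by simp
  then have "(0, 0) \<in> sphere_domain" by (simp add: sphere_domain_def)
  then have K0: "K \<ge> 0" using K norm_ge_zero order_trans by blast
  \<comment> \<open>A random variable is a field that is constant on the sphere, so the
    integrability result for fields covers it.\<close>
  have iY: "integrable (M \<Otimes>\<^sub>M sphere_measure) (\<lambda>(\<omega>, x). (cmod (Y \<omega>))\<^sup>2)"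
  proof -
    have "field_on_sphere M (\<lambda>\<omega> x. Y \<omega>) (LINT \<omega>|M. (cmod (Y \<omega>))\<^sup>2)"
      using Y by (auto simp: field_on_sphere_def square_integrable_rv_def)
    from field_on_sphere_integrable[OF this] show ?thesis .
  qed
  have int: "integrable (M \<Otimes>\<^sub>M sphere_measure) (\<lambda>(\<omega>, x). Y \<omega> * cnj (Z \<omega> x) * e x)"
  proof (rule Bochner_Integration.integrable_bound)
    show "integrable (M \<Otimes>\<^sub>M sphere_measure) (\<lambda>(\<omega>, x). K * ((cmod (Y \<omega>))\<^sup>2 + (cmod (Z \<omega> x))\<^sup>2))"
      using iY field_on_sphere_integrable[OF Z] by (simp add: split_beta')
    show "(\<lambda>(\<omega>, x). Y \<omega> * cnj (Z \<omega> x) * e x) \<in> borel_measurable (M \<Otimes>\<^sub>M sphere_measure)"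
      by measurable
    show "AE z in M \<Otimes>\<^sub>M sphere_measure. norm (case z of (\<omega>, x) \<Rightarrow> Y \<omega> * cnj (Z \<omega> x) * e x)
        \<le> norm (case z of (\<omega>, x) \<Rightarrow> K * ((cmod (Y \<omega>))\<^sup>2 + (cmod (Z \<omega> x))\<^sup>2))"
    proof (rule AE_I2)
      fix z assume "z \<in> space (M \<Otimes>\<^sub>M sphere_measure)"
      then obtain \<omega> x where z: "z = (\<omega>, x)" "x \<in> sphere_domain" by (auto simp: space_pair_measure)
      have "cmod (Y \<omega>) * cmod (Z \<omega> x) \<le> (cmod (Y \<omega>))\<^sup>2 + (cmod (Z \<omega> x))\<^sup>2"
        by (intro mult_le_sum_squares) auto
      then have "cmod (Y \<omega>) * cmod (Z \<omega> x) * cmod (e x) \<le> ((cmod (Y \<omega>))\<^sup>2 + (cmod (Z \<omega> x))\<^sup>2) * K"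
        using K[OF z(2)] by (intro mult_mono) auto
      then show "norm (case z of (\<omega>, x) \<Rightarrow> Y \<omega> * cnj (Z \<omega> x) * e x)
        \<le> norm (case z of (\<omega>, x) \<Rightarrow> K * ((cmod (Y \<omega>))\<^sup>2 + (cmod (Z \<omega> x))\<^sup>2))"
        using K0 by (simp add: z norm_mult mult.commute)
    qed
  qed
  have "(LINT \<omega>|M. Y \<omega> * cnj (sphere_coeff Z e \<omega>)) = (LINT \<omega>|M. (LINT x|sphere_measure. Y \<omega> * cnj (Z \<omega> x) * e x))"
  proof (intro Bochner_Integration.integral_cong refl)
    fix \<omega>
    have "cnj (sphere_coeff Z e \<omega>) = (LINT x|sphere_measure. cnj (Z \<omega> x) * e x)"
      unfolding sphere_coeff_def Bochner_Integration.integral_cnj[symmetric] by simp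
    then show "Y \<omega> * cnj (sphere_coeff Z e \<omega>) = (LINT x|sphere_measure. Y \<omega> * cnj (Z \<omega> x) * e x)"
      by (simp add: mult.assoc)
  qed
  also have "\<dots> = (LINT x|sphere_measure. (LINT \<omega>|M. Y \<omega> * cnj (Z \<omega> x) * e x))"
    using P.Fubini_integral[OF int] by simp
  finally show ?thesis by simp
qed

lemma expectation_sphere_coeff_mult_cnj:
  assumes Z: "field_on_sphere M Z B" and e: "continuous_on sphere_domain e" and Y: "square_integrable_rv M Y"
  shows "(LINT \<omega>|M. sphere_coeff Z e \<omega> * cnj (Y \<omega>)) =
      (LINT x|sphere_measure. (LINT \<omega>|M. Z \<omega> x * cnj (Y \<omega>)) * cnj (e x))"
proof -
  have "(LINT \<omega>|M. sphere_coeff Z e \<omega> * cnj (Y \<omega>)) = cnj (LINT \<omega>|M. Y \<omega> * cnj (sphere_coeff Z e \<omega>))"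
    unfolding Bochner_Integration.integral_cnj[symmetric] by (simp add: mult.commute)
  also have "\<dots> = (LINT x|sphere_measure. cnj ((LINT \<omega>|M. Y \<omega> * cnj (Z \<omega> x)) * e x))"
    unfolding expectation_mult_cnj_sphere_coeff[OF assms] Bochner_Integration.integral_cnj ..
  also have "\<dots> = (LINT x|sphere_measure. (LINT \<omega>|M. Z \<omega> x * cnj (Y \<omega>)) * cnj (e x))"
    by (simp add: Bochner_Integration.integral_cnj[symmetric] mult.commute)
  finally show ?thesis .
qed

end

section \<open>Zonal kernels\<close>

text \<open>The signed weight is a difference of nonnegative bounded ones,
  \<open>V1 = |K| + W\<close> and \<open>V2 = |K|\<close>. The images under \<open>\<tau>\<close> of
  the two measures are concentrated on \<open>{-1..1}\<close> and have equal moments, so they agree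
  on polynomials, on continuous functions by Weierstrass, and on half-lines; equal distribution
  functions give equal measures. The function \<open>b\<close>, merely Borel and bounded, enters
  after that.\<close>

lemma integral_zero_of_moments:
  fixes \<tau> W :: "'a \<Rightarrow> real" and b :: "real \<Rightarrow> real"
  assumes N: "finite_measure N"
    and [measurable]: "\<tau> \<in> borel_measurable N" "W \<in> borel_measurable N" "b \<in> borel_measurable borel"
    and \<tau>: "\<And>z. z \<in> space N \<Longrightarrow> \<tau> z \<in> {-1..1}" and W: "\<And>z. z \<in> space N \<Longrightarrow> \<bar>W z\<bar> \<le> K"
    and b: "\<And>t. \<bar>b t\<bar> \<le> B"
    and mom: "\<And>k. (LINT z|N. \<tau> z ^ k * W z) = 0"
  shows "(LINT z|N. b (\<tau> z) * W z) = 0"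
proof -
  interpret N: finite_measure N by fact
  define \<mu> where "\<mu> V = distr (density N (\<lambda>z. ennreal (V z))) borel \<tau>" for V :: "'a \<Rightarrow> real"
  define V1 where "V1 z = \<bar>K\<bar> + W z" for z
  define V2 where "V2 z = \<bar>K\<bar>" for z :: 'a
  have V: "V1 \<in> borel_measurable N" "V2 \<in> borel_measurable N"
    unfolding V1_def[abs_def] V2_def[abs_def] by measurable
  have V0: "0 \<le> V1 z" "0 \<le> V2 z" "V1 z \<le> 2 * \<bar>K\<bar>" "V2 z \<le> 2 * \<bar>K\<bar>" if "z \<in> space N" for z
    using W[OF that] by (auto simp: V1_def V2_def)
  have fin: "finite_borel_measure (\<mu> V)" if [measurable]: "V \<in> borel_measurable N"
    and V: "\<And>z. z \<in> space N \<Longrightarrow> V z \<le> 2 * \<bar>K\<bar>" for V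
  proof (intro finite_borel_measure.intro finite_measureI finite_borel_measure_axioms.intro)
    have "emeasure (\<mu> V) (space (\<mu> V)) = (\<integral>\<^sup>+z. ennreal (V z) \<partial>N)"
      by (simp add: \<mu>_def emeasure_distr emeasure_density space_density cong: nn_integral_cong)
    also have "\<dots> \<le> (\<integral>\<^sup>+z. ennreal (2 * \<bar>K\<bar>) \<partial>N)"
      by (intro nn_integral_mono ennreal_leI V)
    also have "\<dots> < \<infinity>"
      by (simp add: N.emeasure_eq_measure ennreal_mult_less_top)
    finally show "emeasure (\<mu> V) (space (\<mu> V)) \<noteq> \<infinity>" by simp
    show "sets (\<mu> V) = sets borel" by (simp add: \<mu>_def)
  qed
  have int\<mu>: "integral\<^sup>L (\<mu> V) f = (LINT z|N. f (\<tau> z) * V z)" if [measurable]: "V \<in> borel_measurable N" "f \<in> borel_measurable borel"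
    and V: "\<And>z. z \<in> space N \<Longrightarrow> 0 \<le> V z" for V and f :: "real \<Rightarrow> real"
  proof -
    have "integral\<^sup>L (\<mu> V) f = (LINT z|density N (\<lambda>z. ennreal (V z)). f (\<tau> z))"
      unfolding \<mu>_def by (intro integral_distr) auto
    also have "\<dots> = (LINT z|N. V z *\<^sub>R f (\<tau> z))"
      by (intro integral_density) (auto intro!: AE_I2 V)
    finally show ?thesis by (simp add: mult.commute)
  qed
  have diff: "integral\<^sup>L (\<mu> V1) f - integral\<^sup>L (\<mu> V2) f = (LINT z|N. f (\<tau> z) * W z)"
    if [measurable]: "f \<in> borel_measurable borel" and f: "\<And>t. t \<in> {-1..1} \<Longrightarrow> \<bar>f t\<bar> \<le> C" for f :: "real \<Rightarrow> real" and C
  proof -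
    have C: "0 \<le> C" using f[of 0] by auto
    have i: "integrable N (\<lambda>z. f (\<tau> z) * V z)" if [measurable]: "V \<in> borel_measurable N"
      and V: "\<And>z. z \<in> space N \<Longrightarrow> 0 \<le> V z \<and> V z \<le> 2 * \<bar>K\<bar>" for V
    proof (rule N.integrable_const_bound[of _ "C * (2 * \<bar>K\<bar>)"])
      show "AE z in N. norm (f (\<tau> z) * V z) \<le> C * (2 * \<bar>K\<bar>)"
        using V f[OF \<tau>] C by (intro AE_I2) (auto simp: abs_mult intro!: mult_mono)
    qed measurable
    have "integral\<^sup>L (\<mu> V1) f - integral\<^sup>L (\<mu> V2) f = (LINT z|N. f (\<tau> z) * V1 z) - (LINT z|N. f (\<tau> z) * V2 z)"
      by (simp add: int\<mu> V V0)
    also have "\<dots> = (LINT z|N. f (\<tau> z) * V1 z - f (\<tau> z) * V2 z)"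
      by (intro Bochner_Integration.integral_diff[symmetric] i V) (auto simp: V0)
    also have "\<dots> = (LINT z|N. f (\<tau> z) * W z)"
      by (simp add: V1_def V2_def algebra_simps)
    finally show ?thesis .
  qed
  have iW: "integrable N (\<lambda>z. f (\<tau> z) * W z)" if [measurable]: "f \<in> borel_measurable borel"
    and f: "\<And>t. t \<in> {-1..1} \<Longrightarrow> \<bar>f t\<bar> \<le> C" for f :: "real \<Rightarrow> real" and C
  proof (rule N.integrable_const_bound[of _ "C * \<bar>K\<bar>"])
    have C: "0 \<le> C" using f[of 0] by auto
    have "norm (f (\<tau> z) * W z) \<le> C * \<bar>K\<bar>" if "z \<in> space N" for z
    proof -
      have "\<bar>W z\<bar> \<le> \<bar>K\<bar>" using W[OF that] by simp
      then show ?thesis using f[OF \<tau>[OF that]] C by (auto simp: abs_mult intro!: mult_mono)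
    qed
    then show "AE z in N. norm (f (\<tau> z) * W z) \<le> C * \<bar>K\<bar>" by (rule AE_I2)
  qed measurable
  have poly0: "(LINT z|N. (\<Sum>i\<le>n. a i * \<tau> z ^ i) * W z) = 0" for a n
  proof -
    have "(LINT z|N. (\<Sum>i\<le>n. a i * \<tau> z ^ i) * W z) = (LINT z|N. (\<Sum>i\<le>n. a i * (\<tau> z ^ i * W z)))"
      by (simp add: sum_distrib_right mult.assoc)
    also have "\<dots> = (\<Sum>i\<le>n. LINT z|N. a i * (\<tau> z ^ i * W z))"
    proof (rule Bochner_Integration.integral_sum)
      show "integrable N (\<lambda>z. a i * (\<tau> z ^ i * W z))" for i
        using iW[of "\<lambda>t. t ^ i" 1] by (auto simp: power_le_one abs_le_iff power_abs)
    qed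
    also have "\<dots> = 0" by (simp add: mom)
    finally show ?thesis .
  qed
  have cont0: "(LINT z|N. f (\<tau> z) * W z) = 0" if f: "continuous_on UNIV f" for f :: "real \<Rightarrow> real"
  proof -
    have [measurable]: "f \<in> borel_measurable borel" by (rule borel_measurable_continuous_onI[OF f])
    have "bounded (f ` {-1..1})"
      by (intro compact_imp_bounded compact_continuous_image continuous_on_subset[OF f]) auto
    then obtain C where C': "\<forall>t\<in>{-1..1}. \<bar>f t\<bar> \<le> C" unfolding bounded_iff by auto
    then have C: "\<And>t. t \<in> {-1..1} \<Longrightarrow> \<bar>f t\<bar> \<le> C" by blast
    define m where "m = measure N (space N) * \<bar>K\<bar>"
    have m: "m \<ge> 0" by (simp add: m_def)
    have le: "\<bar>LINT z|N. f (\<tau> z) * W z\<bar> \<le> e * m" if "e > 0" for e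
    proof -
      obtain P where P: "real_polynomial_function P" "\<And>x. x \<in> {-1..1} \<Longrightarrow> \<bar>f x - P x\<bar> < e"
        using Stone_Weierstrass_real_polynomial_function[of "{-1..1}" f e] continuous_on_subset[OF f] \<open>e > 0\<close> by auto
      obtain a n where Pa: "P = (\<lambda>x. \<Sum>i\<le>n. a i * x ^ i)"
        using P(1) by (auto simp: real_polynomial_function_iff_sum)
      have [measurable]: "P \<in> borel_measurable borel" unfolding Pa by measurable
      have PC: "\<bar>P t\<bar> \<le> C + e" if "t \<in> {-1..1}" for t
        using P(2)[OF that] C[OF that] by linarith
      have "(LINT z|N. f (\<tau> z) * W z) = (LINT z|N. f (\<tau> z) * W z) - (LINT z|N. P (\<tau> z) * W z)"
        using poly0[of a n] by (simp add: Pa)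
      also have "\<dots> = (LINT z|N. f (\<tau> z) * W z - P (\<tau> z) * W z)"
        by (intro Bochner_Integration.integral_diff[symmetric] iW[of f C] iW[of P "C + e"]) (auto simp: C PC)
      finally have "\<bar>LINT z|N. f (\<tau> z) * W z\<bar> \<le> (LINT z|N. \<bar>f (\<tau> z) * W z - P (\<tau> z) * W z\<bar>)"
        using integral_norm_bound[of N "\<lambda>z. f (\<tau> z) * W z - P (\<tau> z) * W z"] by simp
      also have "\<dots> \<le> (LINT z|N. e * \<bar>K\<bar>)"
      proof (rule integral_mono)
        show "integrable N (\<lambda>z. \<bar>f (\<tau> z) * W z - P (\<tau> z) * W z\<bar>)"
          by (intro Bochner_Integration.integrable_abs Bochner_Integration.integrable_diff iW[of f C] iW[of P "C + e"]) (auto simp: C PC)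
        fix z assume z: "z \<in> space N"
        have "\<bar>f (\<tau> z) - P (\<tau> z)\<bar> * \<bar>W z\<bar> \<le> e * \<bar>K\<bar>"
          using P(2)[OF \<tau>[OF z]] W[OF z] by (intro mult_mono) auto
        then show "\<bar>f (\<tau> z) * W z - P (\<tau> z) * W z\<bar> \<le> e * \<bar>K\<bar>"
          by (simp add: abs_mult[symmetric] left_diff_distrib)
      qed simp
      also have "\<dots> = e * m" by (simp add: m_def)
      finally show ?thesis .
    qed
    have "\<bar>LINT z|N. f (\<tau> z) * W z\<bar> \<le> 0"
    proof (rule field_le_epsilon)
      fix e :: real assume e: "e > 0"
      then have "e / (m + 1) > 0" using m by simp
      from le[OF this] have "\<bar>LINT z|N. f (\<tau> z) * W z\<bar> \<le> e / (m + 1) * m" .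
      also have "\<dots> \<le> e" using e m by (simp add: field_simps)
      finally show "\<bar>LINT z|N. f (\<tau> z) * W z\<bar> \<le> 0 + e" by simp
    qed
    then show ?thesis by simp
  qed
  \<comment> \<open>The continuous functions \<open>cts_step a (a + 1 / real (Suc n))\<close> tend
    to the indicator of \<open>{..a}\<close>, so dominated convergence passes from continuous
    functions to distribution functions.\<close>
  have cdf: "cdf (\<mu> V1) = cdf (\<mu> V2)"
  proof
    fix a
    have lim: "(\<lambda>n. integral\<^sup>L (\<mu> V) (cts_step a (a + 1 / real (Suc n)))) \<longlonglongrightarrow> cdf (\<mu> V) a"
      if "finite_borel_measure (\<mu> V)" for V
    proof -
      interpret f: finite_borel_measure "\<mu> V" by fact
      have "(\<lambda>n. integral\<^sup>L (\<mu> V) (cts_step a (a + 1 / real (Suc n)))) \<longlonglongrightarrow> integral\<^sup>L (\<mu> V) (indicator {..a})"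
      proof (rule integral_dominated_convergence[where w = "\<lambda>_. 1"])
        show "AE x in \<mu> V. (\<lambda>n. cts_step a (a + 1 / real (Suc n)) x) \<longlonglongrightarrow> indicator {..a} x"
        proof (rule AE_I2)
          fix x
          show "(\<lambda>n. cts_step a (a + 1 / real (Suc n)) x) \<longlonglongrightarrow> indicator {..a} x"
          proof (cases "x \<le> a")
            case False
            have "(\<lambda>n. a + 1 / real (Suc n)) \<longlonglongrightarrow> a + 0"
              by (intro tendsto_intros LIMSEQ_Suc lim_1_over_n)
            then have "\<forall>\<^sub>F n in sequentially. a + 1 / real (Suc n) < x"
              using False by (intro order_tendstoD) auto
            then have "\<forall>\<^sub>F n in sequentially. cts_step a (a + 1 / real (Suc n)) x = indicator {..a} x"
              by eventually_elim (use False in \<open>auto simp: cts_step_def\<close>)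
            then show ?thesis by (rule tendsto_eventually)
          qed (simp add: cts_step_def)
        qed
        show "indicat_real {..a} \<in> borel_measurable (\<mu> V)"
          by (rule borel_measurable_indicator) (simp add: \<mu>_def)
        show "cts_step a (a + 1 / real (Suc n)) \<in> borel_measurable (\<mu> V)" for n
        proof -
          have "cts_step a (a + 1 / real (Suc n)) \<in> borel_measurable borel"
            by (intro borel_measurable_continuous_onI uniformly_continuous_imp_continuous cts_step_uniformly_continuous) simp
          then show ?thesis by (simp add: \<mu>_def)
        qed
        show "AE x in \<mu> V. norm (cts_step a (a + 1 / real (Suc n)) x) \<le> 1" for n
          by (rule AE_I2) (auto simp: cts_step_def divide_simps)
      qed auto
      moreover have "space (\<mu> V) = UNIV" by (simp add: \<mu>_def)
      ultimately show ?thesis by (simp add: cdf_def)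
    qed
    have "integral\<^sup>L (\<mu> V1) (cts_step a (a + 1 / real (Suc n))) = integral\<^sup>L (\<mu> V2) (cts_step a (a + 1 / real (Suc n)))" for n
    proof -
      have c: "continuous_on UNIV (cts_step a (a + 1 / real (Suc n)))"
        by (intro uniformly_continuous_imp_continuous cts_step_uniformly_continuous) simp
      have "integral\<^sup>L (\<mu> V1) (cts_step a (a + 1 / real (Suc n))) - integral\<^sup>L (\<mu> V2) (cts_step a (a + 1 / real (Suc n))) = 0"
        unfolding cont0[OF c, symmetric]
        by (rule diff[OF borel_measurable_continuous_onI[OF c], of 1]) (simp add: cts_step_def divide_simps)
      then show ?thesis by simp
    qed
    then show "cdf (\<mu> V1) a = cdf (\<mu> V2) a"
      using lim[OF fin[OF V(1)]] lim[OF fin[OF V(2)]] V0 LIMSEQ_unique by auto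
  qed
  have "\<mu> V1 = \<mu> V2"
    by (rule cdf_unique'[OF fin[OF V(1)] fin[OF V(2)] cdf]) (use V0 in auto)
  then show ?thesis using diff[of b B] b by simp
qed

text \<open>These are the Legendre polynomials in \<open>2 T - 1\<close>. The leading coefficient is
  a sum of positive products of binomial coefficients, so the degree is exactly \<open>j\<close>, as
  \<open>poly_functional_zero\<close> demands.\<close>

lemma zonal_poly:
  "\<exists>J. degree J \<le> j \<and> coeff J j \<noteq> 0 \<and> (\<forall>T. zonal j j T = poly J T)"
proof -
  define P :: "nat \<Rightarrow> real poly" where "P i = [:0, 1:] ^ i * [:- 1, 1:] ^ (j - i)" for i
  define J where "J = (\<Sum>i\<le>j. smult (real (j choose i) * real (j choose (j - i))) (P i))"
  have degP: "degree (P i) = j" "lead_coeff (P i) = 1" if "i \<le> j" for i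
  proof -
    show "lead_coeff (P i) = 1" unfolding P_def lead_coeff_mult lead_coeff_power by simp
    show "degree (P i) = j" using that unfolding P_def
      by (subst degree_mult_eq) (auto simp: degree_power_eq)
  qed
  have "degree J \<le> j"
    unfolding J_def using degP by (intro degree_sum_le) (auto intro: order_trans[OF degree_smult_le])
  moreover have "coeff J j = (\<Sum>i\<le>j. real (j choose i) * real (j choose (j - i)))"
    unfolding J_def using degP by (simp add: coeff_sum)
  moreover have "(\<Sum>i\<le>j. real (j choose i) * real (j choose (j - i))) > 0"
    by (intro sum_pos) auto
  moreover have "zonal j j T = poly J T" for T
    by (simp add: zonal_def J_def P_def poly_sum poly_power mult.assoc)
  ultimately show ?thesis by (intro exI[of _ J]) auto
qed

text \<open>The second point comes first in the pair, because it is the outer variable of the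
  iterated integrals below.\<close>

abbreviation dot2 :: "(real \<times> real) \<times> (real \<times> real) \<Rightarrow> real" where
  "dot2 z \<equiv> sphere_dot (fst (snd z)) (snd (snd z)) (fst (fst z)) (snd (fst z))"

lemma sphere_dot_bounds: "sphere_dot \<theta>1 \<phi>1 \<theta>2 \<phi>2 \<in> {-1..1}"
proof -
  define A where "A = (sin \<theta>1 * cos \<phi>1, sin \<theta>1 * sin \<phi>1, cos \<theta>1)"
  define B where "B = (sin \<theta>2 * cos \<phi>2, sin \<theta>2 * sin \<phi>2, cos \<theta>2)"
  have n: "(sin a * cos b)\<^sup>2 + ((sin a * sin b)\<^sup>2 + (cos a)\<^sup>2) = 1" for a b :: real
  proof -
    have "(sin a)\<^sup>2 * ((sin b)\<^sup>2 + (cos b)\<^sup>2) = (sin a)\<^sup>2" by simp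
    then show ?thesis
      using sin_cos_squared_add[of a] unfolding power_mult_distrib distrib_left by linarith
  qed
  have "norm A = 1" "norm B = 1"
    using n by (simp_all add: A_def B_def norm_Pair)
  then have "\<bar>A \<bullet> B\<bar> \<le> 1" using Cauchy_Schwarz_ineq2[of A B] by simp
  moreover have "A \<bullet> B = sphere_dot \<theta>1 \<phi>1 \<theta>2 \<phi>2"
    by (simp add: A_def B_def inner_Pair sphere_dot_def cos_diff algebra_simps)
  ultimately show ?thesis by auto
qed

lemma finite_measure_sphere_pair: "finite_measure (sphere_measure \<Otimes>\<^sub>M sphere_measure)"
  by (intro finite_measure_pair_measure finite_measure_sphere_measure)

lemma pair_sigma_finite_sphere: "pair_sigma_finite sphere_measure sphere_measure"
  by (intro pair_sigma_finite.intro sphere.sigma_finite_measure_axioms)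

lemma measurable_dot2: "dot2 \<in> borel_measurable (sphere_measure \<Otimes>\<^sub>M sphere_measure)"
proof -
  have [measurable]: "fst \<in> borel_measurable sphere_measure" "snd \<in> borel_measurable sphere_measure"
    by (auto intro!: measurable_sphere_continuous continuous_intros)
  show ?thesis unfolding sphere_dot_def by measurable
qed

text \<open>The Legendre polynomials span all polynomials, so vanishing integrals against them give
  vanishing moments of \<open>dot2\<close>. The passage to \<open>b\<close> is then made for the
  real and the imaginary part of \<open>W\<close> separately.\<close>

lemma kernel_integral_zero:
  fixes W :: "(real \<times> real) \<times> (real \<times> real) \<Rightarrow> complex"
  assumes [measurable]: "W \<in> borel_measurable (sphere_measure \<Otimes>\<^sub>M sphere_measure)" "b \<in> borel_measurable borel"
    and W: "\<And>z. z \<in> sphere_domain \<times> sphere_domain \<Longrightarrow> cmod (W z) \<le> K"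
    and b: "\<And>t. \<bar>b t\<bar> \<le> B"
    and zero: "\<And>j. (LINT z|(sphere_measure \<Otimes>\<^sub>M sphere_measure). of_real (zonal j j ((1 + dot2 z) / 2)) * W z) = 0"
  shows "(LINT z|(sphere_measure \<Otimes>\<^sub>M sphere_measure). of_real (b (dot2 z)) * W z) = 0"
proof -
  let ?N = "sphere_measure \<Otimes>\<^sub>M sphere_measure"
  interpret N: finite_measure ?N by (rule finite_measure_sphere_pair)
  have sp: "space ?N = sphere_domain \<times> sphere_domain" by (simp add: space_pair_measure)
  note [measurable] = measurable_dot2
  have "((0, 0), (0, 0)) \<in> sphere_domain \<times> sphere_domain" by (simp add: sphere_domain_def)
  then have K: "0 \<le> K" by (rule order_trans[OF norm_ge_zero W])
  have bounded_int: "integrable ?N (\<lambda>z. of_real (f (dot2 z)) * W z)"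
    if [measurable]: "f \<in> borel_measurable borel" and f: "\<And>t. t \<in> {-1..1} \<Longrightarrow> \<bar>f t\<bar> \<le> C" for f :: "real \<Rightarrow> real" and C
  proof (rule N.integrable_const_bound[of _ "C * K"])
    have "0 \<le> C" using f[of 0] by auto
    then show "AE z in ?N. norm (of_real (f (dot2 z)) * W z) \<le> C * K"
      using f[OF sphere_dot_bounds] W by (intro AE_I2) (auto simp: sp norm_mult intro!: mult_mono)
  qed measurable
  have poly_int: "integrable ?N (\<lambda>z. of_real (poly p ((1 + dot2 z) / 2)) * W z)" for p
  proof -
    have c: "continuous_on UNIV (\<lambda>t. poly p ((1 + t) / 2))" by (intro continuous_intros) auto
    have "bounded ((\<lambda>t. poly p ((1 + t) / 2)) ` {-1..1})"
      by (intro compact_imp_bounded compact_continuous_image continuous_on_subset[OF c]) auto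
    then obtain C where "\<forall>t\<in>{-1..1}. \<bar>poly p ((1 + t) / 2)\<bar> \<le> C" unfolding bounded_iff by auto
    then show ?thesis
      by (intro bounded_int[of "\<lambda>t. poly p ((1 + t) / 2)" C] borel_measurable_continuous_onI c) auto
  qed
  define L where "L p = (LINT z|?N. of_real (poly p ((1 + dot2 z) / 2)) * W z)" for p
  obtain J where J: "\<And>j. degree (J j) \<le> j" "\<And>j. coeff (J j) j \<noteq> 0" "\<And>j T. zonal j j T = poly (J j) T"
    using zonal_poly by metis
  have LJ: "L (J j) = 0" for j using zero[of j] by (simp add: L_def J)
  have La: "L (p + q) = L p + L q" for p q
    unfolding L_def Bochner_Integration.integral_add[OF poly_int poly_int, symmetric]
    by (simp add: algebra_simps)
  have Ls: "L (smult c p) = of_real c * L p" for c p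
    unfolding L_def by (simp add: mult.assoc)
  have "Re (L p) = 0" "Im (L p) = 0" for p
    by (rule poly_functional_zero[where J = J]; simp add: La Ls J LJ)+
  then have L0: "L p = 0" for p by (simp add: complex_eq_iff)
  have mom: "(LINT z|?N. of_real (dot2 z ^ k) * W z) = 0" for k
  proof -
    have "poly [:- 1, 2:] ((1 + t) / 2) = t" for t :: real
      by (simp add: field_simps)
    then have "poly ([:- 1, 2:] ^ k) ((1 + t) / 2) = t ^ k" for t :: real
      by (simp only: poly_power)
    then show ?thesis using L0[of "[:- 1, 2:] ^ k"] unfolding L_def by (simp only:)
  qed
  have mi: "integrable ?N (\<lambda>z. of_real (dot2 z ^ k) * W z)" for k
    by (intro bounded_int[of "\<lambda>t. t ^ k" 1]) (auto simp: power_abs intro!: power_le_one)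
  have bi: "integrable ?N (\<lambda>z. of_real (b (dot2 z)) * W z)"
    by (intro bounded_int[of b B]) (auto simp: b)
  have "(LINT z|?N. b (dot2 z) * Re (W z)) = 0"
  proof (rule integral_zero_of_moments[OF N.finite_measure_axioms measurable_dot2 _ _ sphere_dot_bounds _ b])
    show "\<bar>Re (W z)\<bar> \<le> K" if "z \<in> space ?N" for z
      using W[of z] abs_Re_le_cmod[of "W z"] that sp by auto
    show "(LINT z|?N. dot2 z ^ k * Re (W z)) = 0" for k
      using Bochner_Integration.integral_Re[OF mi[of k]] mom[of k] by simp
  qed measurable
  moreover have "(LINT z|?N. b (dot2 z) * Im (W z)) = 0"
  proof (rule integral_zero_of_moments[OF N.finite_measure_axioms measurable_dot2 _ _ sphere_dot_bounds _ b])
    show "\<bar>Im (W z)\<bar> \<le> K" if "z \<in> space ?N" for z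
      using W[of z] abs_Im_le_cmod[of "W z"] that sp by auto
    show "(LINT z|?N. dot2 z ^ k * Im (W z)) = 0" for k
      using Bochner_Integration.integral_Im[OF mi[of k]] mom[of k] by simp
  qed measurable
  ultimately show ?thesis
    using Bochner_Integration.integral_Re[OF bi] Bochner_Integration.integral_Im[OF bi] by (simp add: complex_eq_iff)
qed

abbreviation Yf :: "nat \<Rightarrow> nat \<Rightarrow> int \<Rightarrow> real \<times> real \<Rightarrow> complex" where
  "Yf s l m x \<equiv> sY (int s) l m (fst x) (snd x)"

lemma Yf_measurable:
  "s \<le> l \<Longrightarrow> \<bar>m\<bar> \<le> int l \<Longrightarrow> Yf s l m \<in> borel_measurable sphere_measure"
  by (intro measurable_sphere_continuous sY_continuous)

lemma Yf_bound: "s \<le> l \<Longrightarrow> \<bar>m\<bar> \<le> int l \<Longrightarrow> cmod (Yf s l m x) \<le> sqrt (real (2 * l + 1) / (4 * pi))"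
  using sY_bound[of s l m "fst x" "snd x"] by (intro real_le_rsqrt)

text \<open>By the addition theorem for spin \<open>0\<close> the Legendre kernel is
  \<open>4 pi / (2 j + 1)\<close> times a sum of products of harmonics in one variable each;
  orthonormality evaluates both integrals of every product.\<close>

lemma zonal_kernel_integral:
  assumes "\<bar>m\<bar> \<le> int l" "\<bar>m'\<bar> \<le> int l'"
  shows "(LINT z|(sphere_measure \<Otimes>\<^sub>M sphere_measure). of_real (zonal j j ((1 + dot2 z) / 2)) * (cnj (Yf 0 l m (snd z)) * Yf 0 l' m' (fst z))) =
    (if l = j \<and> l' = j \<and> m = m' then of_real (4 * pi / real (2 * j + 1)) else 0)"
proof -
  let ?N = "sphere_measure \<Otimes>\<^sub>M sphere_measure"
  interpret P: pair_sigma_finite sphere_measure sphere_measure by (rule pair_sigma_finite_sphere)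
  define c :: complex where "c = of_real (4 * pi / real (2 * j + 1))"
  have z: "of_real (zonal j j ((1 + dot2 z) / 2)) = c * (\<Sum>M\<in>{- int j..int j}. Yf 0 j M (snd z) * cnj (Yf 0 j M (fst z)))" for z
    using sY_addition_aux[of 0 j "fst (snd z)" "snd (snd z)" "fst (fst z)" "snd (fst z)"]
    by (simp add: c_def field_simps flip: of_real_mult of_real_add)
  interpret N: finite_measure ?N by (rule finite_measure_sphere_pair)
  define D where "D l = sqrt (real (2 * l + 1) / (4 * pi))" for l :: nat
  have Yb: "cmod (Yf 0 l m x) \<le> D l" if "\<bar>m\<bar> \<le> int l" for l m x
    using Yf_bound[of 0 l m x] that by (simp add: D_def)
  have D0: "0 \<le> D l" for l by (simp add: D_def)
  have int: "integrable ?N (\<lambda>(y, x). (Yf 0 l' m' y * cnj (Yf 0 j M y)) * (Yf 0 j M x * cnj (Yf 0 l m x)))" if M: "\<bar>M\<bar> \<le> int j" for M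
  proof (rule N.integrable_const_bound[of _ "(D l' * D j) * (D j * D l)"])
    have [measurable]: "Yf 0 l m \<in> borel_measurable sphere_measure" "Yf 0 l' m' \<in> borel_measurable sphere_measure"
      "Yf 0 j M \<in> borel_measurable sphere_measure"
      using assms M Yf_measurable[of 0 l m] Yf_measurable[of 0 l' m'] Yf_measurable[of 0 j M] by simp_all
    show "(\<lambda>(y, x). (Yf 0 l' m' y * cnj (Yf 0 j M y)) * (Yf 0 j M x * cnj (Yf 0 l m x))) \<in> borel_measurable ?N"
      by measurable
    show "AE z in ?N. norm (case z of (y, x) \<Rightarrow> (Yf 0 l' m' y * cnj (Yf 0 j M y)) * (Yf 0 j M x * cnj (Yf 0 l m x))) \<le> (D l' * D j) * (D j * D l)"
    proof (rule AE_I2)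
      fix z :: "(real \<times> real) \<times> (real \<times> real)"
      obtain y x where "z = (y, x)" by (cases z)
      then show "norm (case z of (y, x) \<Rightarrow> (Yf 0 l' m' y * cnj (Yf 0 j M y)) * (Yf 0 j M x * cnj (Yf 0 l m x))) \<le> (D l' * D j) * (D j * D l)"
        unfolding norm_mult complex_mod_cnj prod.case
        by (simp only: norm_mult complex_mod_cnj prod.case) (intro mult_mono Yb assms M D0 mult_nonneg_nonneg norm_ge_zero)
    qed
  qed
  have "(LINT z|?N. of_real (zonal j j ((1 + dot2 z) / 2)) * (cnj (Yf 0 l m (snd z)) * Yf 0 l' m' (fst z))) =
     (LINT z|?N. c * (\<Sum>M\<in>{- int j..int j}. (case z of (y, x) \<Rightarrow> (Yf 0 l' m' y * cnj (Yf 0 j M y)) * (Yf 0 j M x * cnj (Yf 0 l m x)))))"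
    unfolding z by (intro Bochner_Integration.integral_cong refl) (simp add: split_beta sum_distrib_left sum_distrib_right mult_ac)
  also have "\<dots> = c * (\<Sum>M\<in>{- int j..int j}. (LINT z|?N. (case z of (y, x) \<Rightarrow> (Yf 0 l' m' y * cnj (Yf 0 j M y)) * (Yf 0 j M x * cnj (Yf 0 l m x)))))"
    by (subst Bochner_Integration.integral_sum[symmetric]) (auto intro!: int[simplified])
  also have "\<dots> = c * (\<Sum>M\<in>{- int j..int j}. (if l = j \<and> l' = j \<and> m = m' \<and> M = m then 1 else 0))"
  proof (intro arg_cong[of _ _ "\<lambda>x. c * x"] sum.cong refl)
    fix M assume "M \<in> {- int j..int j}"
    then have M: "\<bar>M\<bar> \<le> int j" by auto
    have "(LINT z|?N. (case z of (y, x) \<Rightarrow> (Yf 0 l' m' y * cnj (Yf 0 j M y)) * (Yf 0 j M x * cnj (Yf 0 l m x)))) =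
       (LINT y|sphere_measure. (LINT x|sphere_measure. (Yf 0 l' m' y * cnj (Yf 0 j M y)) * (Yf 0 j M x * cnj (Yf 0 l m x))))"
      using P.integral_fst'[OF int[OF M]] by simp
    also have "\<dots> = (LINT y|sphere_measure. Yf 0 l' m' y * cnj (Yf 0 j M y)) * (LINT x|sphere_measure. Yf 0 j M x * cnj (Yf 0 l m x))"
      by simp
    also have "\<dots> = (if l' = j \<and> m' = M then 1 else 0) * (if j = l \<and> M = m then 1 else 0)"
      using sY_orthonormal[of 0 l' m' j M] sY_orthonormal[of 0 j M l m] assms M by simp
    finally show "(LINT z|?N. (case z of (y, x) \<Rightarrow> (Yf 0 l' m' y * cnj (Yf 0 j M y)) * (Yf 0 j M x * cnj (Yf 0 l m x)))) =
       (if l = j \<and> l' = j \<and> m = m' \<and> M = m then 1 else 0)" by auto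
  qed
  also have "\<dots> = (if l = j \<and> l' = j \<and> m = m' then c else 0)"
    using assms by (auto simp: sum.delta if_distrib[of "\<lambda>x. _ * x"])
  finally show ?thesis by (simp add: c_def)
qed

text \<open>A form of the Funk-Hecke theorem. Off the diagonal all Legendre kernels integrate to
  zero, hence so does \<open>b\<close>. On the diagonal they give the same value for
  \<open>m\<close> and for \<open>0\<close>, so the difference of the two weights can serve as
  \<open>W\<close>, and the eigenvalue belonging to \<open>b\<close> is never computed.\<close>

lemma zonal_kernel_diagonal:
  assumes [measurable]: "b \<in> borel_measurable borel" and b: "\<And>t. \<bar>b t\<bar> \<le> B"
    and "\<bar>m\<bar> \<le> int l" "\<bar>m'\<bar> \<le> int l'"
  shows "(LINT z|(sphere_measure \<Otimes>\<^sub>M sphere_measure). of_real (b (dot2 z)) * (cnj (Yf 0 l m (snd z)) * Yf 0 l' m' (fst z))) =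
    (if l = l' \<and> m = m' then
       (LINT z|(sphere_measure \<Otimes>\<^sub>M sphere_measure). of_real (b (dot2 z)) * (cnj (Yf 0 l 0 (snd z)) * Yf 0 l 0 (fst z))) else 0)"
proof -
  let ?N = "sphere_measure \<Otimes>\<^sub>M sphere_measure"
  interpret N: finite_measure ?N by (rule finite_measure_sphere_pair)
  let ?U = "\<lambda>l m l' m' z. cnj (Yf 0 l m (snd z)) * Yf 0 l' m' (fst z)"
  have sp: "space ?N = sphere_domain \<times> sphere_domain" by (simp add: space_pair_measure)
  note [measurable] = measurable_dot2
  define Cl where "Cl l = sqrt (real (2 * l + 1) / (4 * pi))" for l
  have Cl: "0 \<le> Cl l" for l by (simp add: Cl_def)
  have Um: "?U l m l' m' \<in> borel_measurable ?N" if "\<bar>m\<bar> \<le> int l" "\<bar>m'\<bar> \<le> int l'" for l m l' m'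
  proof -
    have [measurable]: "Yf 0 l m \<in> borel_measurable sphere_measure" "Yf 0 l' m' \<in> borel_measurable sphere_measure"
      using that Yf_measurable[of 0 l m] Yf_measurable[of 0 l' m'] by simp_all
    show ?thesis by measurable
  qed
  have Ub: "cmod (?U l m l' m' z) \<le> Cl l * Cl l'" if "\<bar>m\<bar> \<le> int l" "\<bar>m'\<bar> \<le> int l'" for l m l' m' z
    using Yf_bound[of 0 l m "snd z"] Yf_bound[of 0 l' m' "fst z"] that Cl
    by (auto simp: norm_mult Cl_def intro!: mult_mono)
  have bounded_int: "integrable ?N (\<lambda>z. of_real (f (dot2 z)) * ?U l m l' m' z)"
    if [measurable]: "f \<in> borel_measurable borel" and f: "\<And>t. t \<in> {-1..1} \<Longrightarrow> \<bar>f t\<bar> \<le> C"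
      and "\<bar>m\<bar> \<le> int l" "\<bar>m'\<bar> \<le> int l'" for f :: "real \<Rightarrow> real" and C l m l' m'
  proof (rule N.integrable_const_bound[of _ "C * (Cl l * Cl l')"])
    have "0 \<le> C" using f[of 0] by auto
    then show "AE z in ?N. norm (of_real (f (dot2 z)) * ?U l m l' m' z) \<le> C * (Cl l * Cl l')"
      unfolding norm_mult[of "of_real _"]
      using f[OF sphere_dot_bounds] Ub[OF that(3,4)] by (intro AE_I2 mult_mono) auto
    note [measurable] = Um[OF that(3,4)]
    show "(\<lambda>z. of_real (f (dot2 z)) * ?U l m l' m' z) \<in> borel_measurable ?N" by measurable
  qed
  show ?thesis
  proof (cases "l = l' \<and> m = m'")
    case False
    have "(LINT z|?N. of_real (b (dot2 z)) * ?U l m l' m' z) = 0"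
      by (rule kernel_integral_zero[OF Um[OF assms(3,4)] assms(1) Ub[OF assms(3,4)] b])
        (use zonal_kernel_integral[OF assms(3,4)] False in auto)
    then show ?thesis using False by auto
  next
    case True
    have m0: "\<bar>0\<bar> \<le> int l" by simp
    have ml: "\<bar>m\<bar> \<le> int l" by fact
    have zi: "integrable ?N (\<lambda>z. of_real (zonal j j ((1 + dot2 z) / 2)) * ?U l m l m z)" if "\<bar>m\<bar> \<le> int l" for j m
    proof -
      obtain J where "\<And>T. zonal j j T = poly J T" using zonal_poly[of j] by blast
      then have c: "continuous_on UNIV (\<lambda>t. zonal j j ((1 + t) / 2))" by (auto intro!: continuous_intros)
      have "bounded ((\<lambda>t. zonal j j ((1 + t) / 2)) ` {-1..1})"
        by (intro compact_imp_bounded compact_continuous_image continuous_on_subset[OF c]) auto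
      then obtain C where "\<forall>t\<in>{-1..1}. \<bar>zonal j j ((1 + t) / 2)\<bar> \<le> C" unfolding bounded_iff by auto
      then show ?thesis using that
        by (intro bounded_int[of "\<lambda>t. zonal j j ((1 + t) / 2)" C] borel_measurable_continuous_onI c) auto
    qed
    have "(LINT z|?N. of_real (b (dot2 z)) * (?U l m l m z - ?U l 0 l 0 z)) = 0"
    proof (rule kernel_integral_zero[OF _ assms(1) _ b])
      show "(\<lambda>z. ?U l m l m z - ?U l 0 l 0 z) \<in> borel_measurable ?N"
        using Um[OF ml ml] Um[OF m0 m0] by (rule borel_measurable_diff)
      show "cmod (?U l m l m z - ?U l 0 l 0 z) \<le> Cl l * Cl l + Cl l * Cl l" for z
        using norm_triangle_ineq4[of "?U l m l m z" "?U l 0 l 0 z"] Ub[OF ml ml, of z] Ub[OF m0 m0, of z] by linarith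
      fix j
      have "(LINT z|?N. of_real (zonal j j ((1 + dot2 z) / 2)) * (?U l m l m z - ?U l 0 l 0 z)) =
        (LINT z|?N. of_real (zonal j j ((1 + dot2 z) / 2)) * ?U l m l m z) - (LINT z|?N. of_real (zonal j j ((1 + dot2 z) / 2)) * ?U l 0 l 0 z)"
        unfolding right_diff_distrib by (rule Bochner_Integration.integral_diff[OF zi[OF ml] zi[OF m0]])
      then show "(LINT z|?N. of_real (zonal j j ((1 + dot2 z) / 2)) * (?U l m l m z - ?U l 0 l 0 z)) = 0"
        unfolding zonal_kernel_integral[OF ml ml] zonal_kernel_integral[OF m0 m0] by simp
    qed
    moreover have "(LINT z|?N. of_real (b (dot2 z)) * (?U l m l m z - ?U l 0 l 0 z)) =
        (LINT z|?N. of_real (b (dot2 z)) * ?U l m l m z) - (LINT z|?N. of_real (b (dot2 z)) * ?U l 0 l 0 z)"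
      unfolding right_diff_distrib
      by (rule Bochner_Integration.integral_diff[OF bounded_int[of b B m l m l] bounded_int[of b B 0 l 0 l]]) (use b ml in auto)
    ultimately show ?thesis using True by simp
  qed
qed

section \<open>The lensing potential\<close>

lemma continuous_on_vecI:
  fixes f :: "'a :: topological_space \<Rightarrow> ('b :: topological_space) ^ 'n"
  assumes "\<And>i. continuous_on S (\<lambda>x. f x $ i)"
  shows "continuous_on S f"
  using continuous_on_vec_lambda[of S "\<lambda>i x. f x $ i", OF assms] by simp

lemma vector_4 [simp]:
  "(vector [x, y, z, w] :: ('a::zero)^4) $ 1 = x"
  "(vector [x, y, z, w] :: ('a::zero)^4) $ 2 = y"
  "(vector [x, y, z, w] :: ('a::zero)^4) $ 3 = z"
  "(vector [x, y, z, w] :: ('a::zero)^4) $ 4 = w"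
  unfolding vector_def by simp_all

section \<open>Rotations about the observer as isometries of the slice\<close>

definition embed4 :: "real^3^3 \<Rightarrow> real^4^4" where
  "embed4 g = vector [vector [1, 0, 0, 0], vector [0, g $ 1 $ 1, g $ 1 $ 2, g $ 1 $ 3],
     vector [0, g $ 2 $ 1, g $ 2 $ 2, g $ 2 $ 3], vector [0, g $ 3 $ 1, g $ 3 $ 2, g $ 3 $ 3]]"

lemma embed4_lift4: "embed4 g *v lift4 t x = lift4 t (g *v x)"
  by (simp add: vec_eq_iff forall_4 embed4_def lift4_def matrix_vector_mult_def sum_4 sum_3)

lemma embed4_slice_point: "embed4 g *v slice_point K r n = slice_point K r (g *v n)"
  by (simp add: slice_point_def embed4_lift4 matrix_vector_mult_scaleR)

lemma embed4_mult: "embed4 (g ** h) = embed4 g ** embed4 h"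
  by (simp add: vec_eq_iff forall_4 embed4_def matrix_matrix_mult_def sum_4 sum_3)

lemma embed4_orthogonal: "orthogonal_matrix g \<Longrightarrow> orthogonal_matrix (embed4 g)"
  by (simp add: orthogonal_matrix vec_eq_iff forall_4 forall_3 embed4_def matrix_matrix_mult_def transpose_def sum_4 sum_3 mat_def)

lemma Rz_add: "Rz a ** Rz b = Rz (a + b)" and Ry_add: "Ry a ** Ry b = Ry (a + b)"
  by (simp_all add: vec_eq_iff forall_3 Rz_def Ry_def matrix_matrix_mult_def sum_3 cos_add sin_add)

lemma sin_cos_sq: "sin x * sin x + cos x * cos x = (1::real)" "cos x * cos x + sin x * sin x = (1::real)"
  using sin_cos_squared_add[of x] by (simp_all add: power2_eq_square)

lemma Rz_orthogonal: "orthogonal_matrix (Rz a)" and Ry_orthogonal: "orthogonal_matrix (Ry a)"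
  by (simp_all add: orthogonal_matrix vec_eq_iff forall_3 Rz_def Ry_def matrix_matrix_mult_def transpose_def sum_3 mat_def sin_cos_sq)

text \<open>The determinant is 1 because \<open>g\<close> is a square.\<close>

lemma embed4_isometry:
  assumes g: "g = h ** h" and h: "orthogonal_matrix h"
  shows "embed4 g \<in> isometry_group K"
proof -
  have go: "orthogonal_matrix g" unfolding g by (intro orthogonal_matrix_mul h)
  have "det h = 1 \<or> det h = - 1" using h by (rule det_orthogonal_matrix)
  then have dg: "det g = 1" unfolding g det_mul by auto
  have "det (embed4 h) = 1 \<or> det (embed4 h) = - 1"
    using embed4_orthogonal[OF h] by (rule det_orthogonal_matrix)
  then have d: "det (embed4 g) = 1" unfolding g embed4_mult det_mul by auto
  have "embed4 g \<in> SO4"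
    using embed4_orthogonal[OF go] d by (simp add: SO4_def rotation_matrix_def)
  moreover have "embed4 g \<in> ISO3"
    unfolding ISO3_def mem_Collect_eq using go dg
    by (intro exI[of _ g] exI[of _ "0 :: real^3"]) (simp add: embed4_lift4 rotation_matrix_def)
  moreover have "embed4 g \<in> SO0_1_3"
  proof -
    have "transpose g ** g = mat 1" using go by (simp add: orthogonal_matrix)
    then have "transpose (embed4 g) ** minkowski ** embed4 g = minkowski"
      by (simp add: vec_eq_iff forall_4 forall_3 embed4_def matrix_matrix_mult_def transpose_def sum_4 sum_3 mat_def minkowski_def)
    then show ?thesis using d by (simp add: SO0_1_3_def embed4_def)
  qed
  ultimately show ?thesis by (simp add: isometry_group_def)
qed

lemma embed4_Rz: "embed4 (Rz a) \<in> isometry_group K" and embed4_Ry: "embed4 (Ry a) \<in> isometry_group K"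
  using embed4_isometry[of "Rz a" "Rz (a / 2)"] embed4_isometry[of "Ry a" "Ry (a / 2)"]
  by (simp_all add: Rz_add Ry_add Rz_orthogonal Ry_orthogonal)

lemma rotation_SO3: "Rz a \<in> SO3" "Ry a \<in> SO3"
proof -
  have "det (Rz a) = 1" "det (Ry a) = 1"
    by (simp_all add: det_3 Rz_def Ry_def sin_cos_sq)
  then show "Rz a \<in> SO3" "Ry a \<in> SO3"
    by (simp_all add: SO3_def rotation_matrix_def Rz_orthogonal Ry_orthogonal)
qed

lemma SO3_mult: "g \<in> SO3 \<Longrightarrow> h \<in> SO3 \<Longrightarrow> g ** h \<in> SO3"
  by (auto simp: SO3_def rotation_matrix_def det_mul intro: orthogonal_matrix_mul)

lemma euler_SO3: "euler \<alpha> \<beta> \<gamma> \<in> SO3"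
  unfolding euler_def by (intro SO3_mult rotation_SO3)

lemma Rz_direction: "Rz a *v direction \<theta> \<phi> = direction \<theta> (\<phi> + a)"
  by (simp add: vec_eq_iff forall_3 Rz_def direction_def matrix_vector_mult_def sum_3 cos_add sin_add algebra_simps)

lemma Ry_vector: "Ry b *v v = vector [cos b * v $ 1 + sin b * v $ 3, v $ 2, - sin b * v $ 1 + cos b * v $ 3]"
  by (simp add: vec_eq_iff forall_3 Ry_def matrix_vector_mult_def sum_3)

lemma direction_0: "direction 0 a = direction 0 b"
  by (simp add: direction_def)

lemma direction_north_pole: "direction \<theta> \<phi> = Rz \<phi> *v (Ry \<theta> *v direction 0 0)"
  by (simp add: vec_eq_iff forall_3 Rz_def Ry_def direction_def matrix_vector_mult_def sum_3)

lemma unit_vector_direction: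
  fixes v :: "real^3"
  assumes "(v $ 1)\<^sup>2 + (v $ 2)\<^sup>2 + (v $ 3)\<^sup>2 = 1"
  obtains \<phi> where "v = direction (arccos (v $ 3)) \<phi>"
proof -
  define \<rho> where "\<rho> = sqrt (1 - (v $ 3)\<^sup>2)"
  have le: "(v $ 3)\<^sup>2 \<le> 1" using assms by (smt (verit) zero_le_power2)
  then have v3: "\<bar>v $ 3\<bar> \<le> 1" by (simp add: abs_square_le_1)
  then have sc: "sin (arccos (v $ 3)) = \<rho>" "cos (arccos (v $ 3)) = v $ 3"
    by (auto simp: \<rho>_def sin_arccos_abs)
  have \<rho>2: "\<rho>\<^sup>2 = (v $ 1)\<^sup>2 + (v $ 2)\<^sup>2" using le assms by (simp add: \<rho>_def)
  show thesis
  proof (cases "\<rho> = 0")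
    case True
    then have "v $ 1 = 0" "v $ 2 = 0" using \<rho>2 by (auto simp: sum_power2_eq_zero_iff)
    then have "v = direction (arccos (v $ 3)) 0"
      by (simp add: vec_eq_iff forall_3 direction_def sc True)
    then show ?thesis by (rule that)
  next
    case False
    have "(v $ 1 / \<rho>)\<^sup>2 + (v $ 2 / \<rho>)\<^sup>2 = ((v $ 1)\<^sup>2 + (v $ 2)\<^sup>2) / \<rho>\<^sup>2"
      by (simp add: power_divide add_divide_distrib)
    also have "\<dots> = 1" using False by (simp flip: \<rho>2)
    finally obtain t where "v $ 1 / \<rho> = cos t" "v $ 2 / \<rho> = sin t" by (rule sincos_total_2pi)
    then have "v $ 1 = \<rho> * cos t" "v $ 2 = \<rho> * sin t" using False by (auto simp: field_simps)
    then have "v = direction (arccos (v $ 3)) t"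
      by (simp add: vec_eq_iff forall_3 direction_def sc)
    then show ?thesis by (rule that)
  qed
qed

lemma direction_norm: "(direction \<theta> \<phi> $ 1)\<^sup>2 + (direction \<theta> \<phi> $ 2)\<^sup>2 + (direction \<theta> \<phi> $ 3)\<^sup>2 = 1"
proof -
  have "(sin \<theta>)\<^sup>2 * ((sin \<phi>)\<^sup>2 + (cos \<phi>)\<^sup>2) = (sin \<theta>)\<^sup>2" by simp
  then show ?thesis
    using sin_cos_squared_add[of \<theta>] unfolding direction_def vector_3 power_mult_distrib distrib_left by linarith
qed

lemma direction_sphere: "direction \<theta> \<phi> \<in> sphere 0 1"
  using direction_norm[of \<theta> \<phi>] by (simp add: norm_eq_sqrt_inner inner_vec_def sum_3 power2_eq_square)

lemma continuous_on_slice_point: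
  fixes f g :: "'a :: t2_space \<Rightarrow> real"
  assumes "continuous_on A f" "continuous_on A g"
  shows "continuous_on A (\<lambda>x. slice_point K r (direction (f x) (g x)))"
proof (rule continuous_on_vecI)
  have "\<forall>i. continuous_on A (\<lambda>x. slice_point K r (direction (f x) (g x)) $ i)"
    unfolding forall_4 using assms
    by (auto simp: slice_point_def lift4_def direction_def intro!: continuous_intros)
  then show "continuous_on A (\<lambda>x. slice_point K r (direction (f x) (g x)) $ i)" for i
    by blast
qed

lemma sY_00: "sY 0 0 0 \<theta> \<phi> = of_real (sY_norm 0 0 0)"
  using sY_eq[of 0 0 0 \<theta> \<phi>] by (simp add: wig_def wig_poly_def)

text \<open>The harmonic of degree zero is constant, so this is orthogonality to it. It is what
  removes the mean of the potential, and its value at the centre, from all coefficients with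
  \<open>l \<noteq> 0\<close>.\<close>

lemma integral_Yf_0:
  assumes "\<bar>m\<bar> \<le> int l" "l \<noteq> 0"
  shows "(LINT x|sphere_measure. Yf 0 l m x) = 0"
proof -
  have "(LINT x|sphere_measure. Yf 0 l m x * cnj (Yf 0 0 0 x)) = 0"
    using sY_orthonormal[of 0 l m 0 0] assms by simp
  then show ?thesis using sY_norm_nonzero[of 0 0 0] by (simp add: sY_00)
qed

section \<open>The invariant potential: covariance and harmonic coefficients\<close>

locale invariant_potential = prob_space M for M :: "'w measure" +
  fixes K :: real and \<psi> :: "real^4 \<Rightarrow> 'w \<Rightarrow> real"
  assumes inv: "invariant_random_field M K \<psi>"
begin

definition P :: "real \<Rightarrow> 'w \<Rightarrow> real \<times> real \<Rightarrow> complex" where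
  "P r \<omega> x = of_real (\<psi> (slice_point K r (direction (fst x) (snd x))) \<omega>)"

lemma psi_measurable: "(\<lambda>(\<omega>, x). \<psi> x \<omega>) \<in> borel_measurable (M \<Otimes>\<^sub>M restrict_space borel (slice K))"
  using inv by (simp add: invariant_random_field_def)

lemma slice_point_slice: "r \<in> chi_range K \<Longrightarrow> slice_point K r (direction \<theta> \<phi>) \<in> slice K"
  using direction_sphere by (auto simp: slice_def)

lemma psi_measurable_comp:
  assumes "r \<in> chi_range K" and w: "w \<in> measurable N M" and "f \<in> borel_measurable N" "g \<in> borel_measurable N"
  shows "(\<lambda>x. \<psi> (slice_point K r (direction (f x) (g x))) (w x)) \<in> borel_measurable N"
proof -
  have [measurable]: "f \<in> borel_measurable N" "g \<in> borel_measurable N" by fact+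
  have "(\<lambda>x. slice_point K r (direction (fst x) (snd x))) \<in> borel_measurable borel"
    by (intro borel_measurable_continuous_onI continuous_on_slice_point continuous_intros)
  then have "(\<lambda>x. slice_point K r (direction (fst (f x, g x)) (snd (f x, g x)))) \<in> borel_measurable N"
    by (rule measurable_compose[rotated]) (simp add: borel_prod[symmetric])
  then have "(\<lambda>x. slice_point K r (direction (f x) (g x))) \<in> measurable N (restrict_space borel (slice K))"
    using slice_point_slice[OF assms(1)] by (intro measurable_restrict_space2) auto
  from measurable_compose[OF measurable_Pair[OF w this] psi_measurable] show ?thesis by simp
qed

lemma psi_square:
  assumes "r \<in> chi_range K"
  shows "integrable M (\<lambda>\<omega>. (\<psi> (slice_point K r (direction \<theta> \<phi>)) \<omega>)\<^sup>2)"
  using inv slice_point_slice[OF assms] by (auto simp: invariant_random_field_def)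

lemma psi_invariant:
  assumes "g = Rz a \<or> g = Ry a" "x = slice_point K r1 n1" "x \<in> slice K" "y = slice_point K r2 n2" "y \<in> slice K"
  shows "(LINT \<omega>|M. \<psi> (slice_point K r1 (g *v n1)) \<omega> * \<psi> (slice_point K r2 (g *v n2)) \<omega>) =
      (LINT \<omega>|M. \<psi> x \<omega> * \<psi> y \<omega>)"
    and "(LINT \<omega>|M. \<psi> (slice_point K r1 (g *v n1)) \<omega>) = (LINT \<omega>|M. \<psi> x \<omega>)"
proof -
  have g: "embed4 g \<in> isometry_group K" using assms(1) embed4_Rz embed4_Ry by auto
  have "(LINT \<omega>|M. \<psi> (embed4 g *v x) \<omega> * \<psi> (embed4 g *v y) \<omega>) = (LINT \<omega>|M. \<psi> x \<omega> * \<psi> y \<omega>)"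
    using inv g assms(3,5) unfolding invariant_random_field_def by blast
  then show "(LINT \<omega>|M. \<psi> (slice_point K r1 (g *v n1)) \<omega> * \<psi> (slice_point K r2 (g *v n2)) \<omega>) =
      (LINT \<omega>|M. \<psi> x \<omega> * \<psi> y \<omega>)"
    unfolding assms(2,4) embed4_slice_point .
  have "(LINT \<omega>|M. \<psi> (embed4 g *v x) \<omega>) = (LINT \<omega>|M. \<psi> x \<omega>)"
    using inv g assms(3) unfolding invariant_random_field_def by blast
  then show "(LINT \<omega>|M. \<psi> (slice_point K r1 (g *v n1)) \<omega>) = (LINT \<omega>|M. \<psi> x \<omega>)"
    unfolding assms(2) embed4_slice_point .
qed

definition cov :: "real \<Rightarrow> real \<Rightarrow> real \<Rightarrow> real" where
  "cov r1 r2 \<beta> = (LINT \<omega>|M. \<psi> (slice_point K r1 (direction 0 0)) \<omega> * \<psi> (slice_point K r2 (direction \<beta> 0)) \<omega>)"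

text \<open>Three rotations, each applied to both points, bring the pair into normal form: about the
  axis, so that the first point has \<open>\<phi> = 0\<close>; about the second axis, so that it
  reaches the pole; and about the axis again, which fixes the pole and brings the second point to
  the meridian.\<close>

lemma psi_covariance:
  assumes r: "r1 \<in> chi_range K" "r2 \<in> chi_range K"
  shows "(LINT \<omega>|M. \<psi> (slice_point K r1 (direction \<theta>1 \<phi>1)) \<omega> * \<psi> (slice_point K r2 (direction \<theta>2 \<phi>2)) \<omega>) =
    cov r1 r2 (arccos (sphere_dot \<theta>1 \<phi>1 \<theta>2 \<phi>2))"
proof -
  note sl = slice_point_slice[OF r(1)] slice_point_slice[OF r(2)]
  \<comment> \<open>The second direction after the first two rotations; its third coordinate is the
    cosine of the angle between the original directions.\<close>
  define v where "v = Ry (- \<theta>1) *v direction \<theta>2 (\<phi>2 - \<phi>1)"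
  have v3: "v $ 3 = sphere_dot \<theta>1 \<phi>1 \<theta>2 \<phi>2"
    by (simp add: v_def Ry_vector direction_def sphere_dot_def cos_diff algebra_simps)
  have "(v $ 1)\<^sup>2 + (v $ 2)\<^sup>2 + (v $ 3)\<^sup>2 = 1"
  proof -
    let ?d = "direction \<theta>2 (\<phi>2 - \<phi>1)"
    have rot: "(c * x + s * z)\<^sup>2 + y\<^sup>2 + (- s * x + c * z)\<^sup>2 = x\<^sup>2 + y\<^sup>2 + z\<^sup>2" if "c\<^sup>2 + s\<^sup>2 = 1" for c s x y z :: real
    proof -
      have "(c * x + s * z)\<^sup>2 + y\<^sup>2 + (- s * x + c * z)\<^sup>2 = (c\<^sup>2 + s\<^sup>2) * x\<^sup>2 + y\<^sup>2 + (c\<^sup>2 + s\<^sup>2) * z\<^sup>2"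
        by (simp add: power2_eq_square algebra_simps)
      then show ?thesis by (simp add: that)
    qed
    show ?thesis
      unfolding v_def Ry_vector vector_3
      by (subst rot) (simp_all add: direction_norm)
  qed
  then obtain \<phi>' where v: "v = direction (arccos (v $ 3)) \<phi>'" by (rule unit_vector_direction)
  have "(LINT \<omega>|M. \<psi> (slice_point K r1 (direction \<theta>1 \<phi>1)) \<omega> * \<psi> (slice_point K r2 (direction \<theta>2 \<phi>2)) \<omega>) =
    (LINT \<omega>|M. \<psi> (slice_point K r1 (direction \<theta>1 0)) \<omega> * \<psi> (slice_point K r2 (direction \<theta>2 (\<phi>2 - \<phi>1))) \<omega>)"
    using psi_invariant(1)[OF _ refl sl(1)[of \<theta>1 \<phi>1] refl sl(2)[of \<theta>2 \<phi>2], of "Rz (- \<phi>1)" "- \<phi>1"]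
    by (simp add: Rz_direction)
  also have "\<dots> = (LINT \<omega>|M. \<psi> (slice_point K r1 (direction 0 0)) \<omega> * \<psi> (slice_point K r2 v) \<omega>)"
  proof -
    have "Ry (- \<theta>1) *v direction \<theta>1 0 = direction 0 0"
      by (simp add: vec_eq_iff forall_3 Ry_vector direction_def sin_cos_sq)
    then show ?thesis
      using psi_invariant(1)[OF _ refl sl(1)[of \<theta>1 0] refl sl(2)[of \<theta>2 "\<phi>2 - \<phi>1"], of "Ry (- \<theta>1)" "- \<theta>1"]
      by (simp add: v_def)
  qed
  also have "\<dots> = (LINT \<omega>|M. \<psi> (slice_point K r1 (direction 0 0)) \<omega> * \<psi> (slice_point K r2 (direction (arccos (v $ 3)) 0)) \<omega>)"
  proof -
    have "Rz (- \<phi>') *v direction (arccos (v $ 3)) \<phi>' = direction (arccos (v $ 3)) 0"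
      by (simp add: Rz_direction)
    then have 1: "Rz (- \<phi>') *v v = direction (arccos (v $ 3)) 0"
      unfolding v[symmetric] .
    have 2: "Rz (- \<phi>') *v direction 0 0 = direction 0 0"
      unfolding Rz_direction by (rule direction_0)
    have 3: "slice_point K r2 v \<in> slice K"
      using sl(2)[of "arccos (v $ 3)" \<phi>'] unfolding v[symmetric] .
    show ?thesis
      using psi_invariant(1)[OF _ refl sl(1)[of 0 0] refl 3, of "Rz (- \<phi>')" "- \<phi>'"] unfolding 1 2 by simp
  qed
  finally show ?thesis unfolding v3 cov_def .
qed

lemma psi_variance:
  assumes "r \<in> chi_range K"
  shows "(LINT \<omega>|M. (\<psi> (slice_point K r (direction \<theta> \<phi>)) \<omega>)\<^sup>2) = cov r r 0"
proof -
  have "sphere_dot \<theta> \<phi> \<theta> \<phi> = 1" by (simp add: sphere_dot_def sin_cos_sq)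
  then show ?thesis using psi_covariance[OF assms assms, of \<theta> \<phi> \<theta> \<phi>] by (simp add: power2_eq_square)
qed

lemma psi_mean:
  assumes "r \<in> chi_range K"
  shows "(LINT \<omega>|M. \<psi> (slice_point K r (direction \<theta> \<phi>)) \<omega>) = (LINT \<omega>|M. \<psi> (slice_point K r (direction 0 0)) \<omega>)"
proof -
  note sl = slice_point_slice[OF assms]
  have 1: "Ry \<theta> *v direction 0 0 = direction \<theta> 0" using direction_north_pole[of \<theta> 0] Rz_direction[of 0] 
    by (simp add: vec_eq_iff forall_3 Ry_vector direction_def)
  have 2: "Rz \<phi> *v direction \<theta> 0 = direction \<theta> \<phi>" by (simp add: Rz_direction)
  show ?thesis
    using psi_invariant(2)[OF _ refl sl[of \<theta> 0] refl sl[of \<theta> 0], of "Rz \<phi>" \<phi>]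
      psi_invariant(2)[OF _ refl sl[of 0 0] refl sl[of 0 0], of "Ry \<theta>" \<theta>]
    by (simp add: 1 2)
qed

lemma P_field:
  assumes "r \<in> chi_range K"
  shows "field_on_sphere M (P r) (cov r r 0)"
proof -
  have [measurable]: "fst \<in> borel_measurable sphere_measure" "snd \<in> borel_measurable sphere_measure"
    by (auto intro!: measurable_sphere_continuous continuous_intros)
  have "(\<lambda>z. \<psi> (slice_point K r (direction (fst (snd z)) (snd (snd z)))) (fst z)) \<in> borel_measurable (M \<Otimes>\<^sub>M sphere_measure)"
    by (rule psi_measurable_comp[OF assms]) measurable
  then have "case_prod (P r) \<in> borel_measurable (M \<Otimes>\<^sub>M sphere_measure)"
    unfolding P_def split_beta' by measurable
  then show ?thesis
    unfolding field_on_sphere_def using psi_square[OF assms] psi_variance[OF assms] by (simp add: P_def)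
qed

lemma cov_measurable:
  assumes "r1 \<in> chi_range K" "r2 \<in> chi_range K"
  shows "cov r1 r2 \<in> borel_measurable borel"
proof -
  have [measurable]: "(\<lambda>z. \<psi> (slice_point K r1 (direction 0 0)) (snd z)) \<in> borel_measurable (borel \<Otimes>\<^sub>M M)"
    "(\<lambda>z. \<psi> (slice_point K r2 (direction (fst z) 0)) (snd z)) \<in> borel_measurable (borel \<Otimes>\<^sub>M M)"
    by (rule psi_measurable_comp[OF assms(1)] psi_measurable_comp[OF assms(2)]; measurable)+
  show ?thesis unfolding cov_def[abs_def]
    by (rule borel_measurable_lebesgue_integral) (simp add: split_beta')
qed

lemma cov_bound:
  assumes "r1 \<in> chi_range K" "r2 \<in> chi_range K"
  shows "\<bar>cov r1 r2 \<beta>\<bar> \<le> cov r1 r1 0 + cov r2 r2 0"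
proof -
  let ?f = "\<psi> (slice_point K r1 (direction 0 0))" and ?g = "\<psi> (slice_point K r2 (direction \<beta> 0))"
  have i: "integrable M (\<lambda>\<omega>. (?f \<omega>)\<^sup>2 + (?g \<omega>)\<^sup>2)" using psi_square assms by auto
  have [measurable]: "?f \<in> borel_measurable M" "?g \<in> borel_measurable M"
    using psi_measurable_comp[OF assms(1) measurable_ident_sets[OF refl], of "\<lambda>_. 0" "\<lambda>_. 0"]
      psi_measurable_comp[OF assms(2) measurable_ident_sets[OF refl], of "\<lambda>_. \<beta>" "\<lambda>_. 0"] by auto
  have b: "\<bar>?f \<omega> * ?g \<omega>\<bar> \<le> (?f \<omega>)\<^sup>2 + (?g \<omega>)\<^sup>2" for \<omega>
    using mult_le_sum_squares[of "\<bar>?f \<omega>\<bar>" "\<bar>?g \<omega>\<bar>"] by (simp add: abs_mult)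
  have j: "integrable M (\<lambda>\<omega>. ?f \<omega> * ?g \<omega>)"
    by (rule Bochner_Integration.integrable_bound[OF i]) (auto intro!: AE_I2 order_trans[OF b])
  have "\<bar>cov r1 r2 \<beta>\<bar> \<le> (LINT \<omega>|M. \<bar>?f \<omega> * ?g \<omega>\<bar>)"
    unfolding cov_def using integral_norm_bound[of M "\<lambda>\<omega>. ?f \<omega> * ?g \<omega>"] by simp
  also have "\<dots> \<le> (LINT \<omega>|M. (?f \<omega>)\<^sup>2 + (?g \<omega>)\<^sup>2)"
    by (intro integral_mono i Bochner_Integration.integrable_abs j b)
  also have "\<dots> = cov r1 r1 0 + cov r2 r2 0"
    using psi_square assms by (simp add: psi_variance)
  finally show ?thesis .
qed

definition psi_coeff :: "nat \<Rightarrow> int \<Rightarrow> real \<Rightarrow> 'w \<Rightarrow> complex" where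
  "psi_coeff l m r = sphere_coeff (P r) (Yf 0 l m)"

lemma Yf_0_continuous: "\<bar>m\<bar> \<le> int l \<Longrightarrow> continuous_on sphere_domain (Yf 0 l m)"
  using sY_continuous[of 0 l m] by simp

lemma psi_coeff_square_integrable:
  assumes "r \<in> chi_range K" "\<bar>m\<bar> \<le> int l"
  shows "square_integrable_rv M (psi_coeff l m r)"
  unfolding psi_coeff_def using assms by (intro sphere_coeff_bound(1)[OF P_field] Yf_0_continuous)

text \<open>Exchanging expectation and integration for each of the two coefficients yields the
  covariance kernel integrated against two harmonics. This kernel is a function of the dot product,
  so \<open>zonal_kernel_diagonal\<close> applies.\<close>

lemma psi_coeff_covariance:
  assumes r: "r1 \<in> chi_range K" "r2 \<in> chi_range K" and m: "\<bar>m\<bar> \<le> int l" "\<bar>m'\<bar> \<le> int l'"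
  shows "(LINT \<omega>|M. psi_coeff l m r1 \<omega> * cnj (psi_coeff l' m' r2 \<omega>)) =
    (if l = l' \<and> m = m' then (LINT \<omega>|M. psi_coeff l 0 r1 \<omega> * cnj (psi_coeff l 0 r2 \<omega>)) else 0)"
proof -
  let ?N = "sphere_measure \<Otimes>\<^sub>M sphere_measure"
  interpret Q: pair_sigma_finite sphere_measure sphere_measure by (rule pair_sigma_finite_sphere)
  interpret N: finite_measure ?N by (rule finite_measure_sphere_pair)
  \<comment> \<open>Clamping to \<open>{-1..1}\<close> keeps \<open>arccos\<close> on its domain,
    which makes \<open>b\<close> Borel on the whole line; at the values of \<open>dot2\<close> it
    changes nothing.\<close>
  define b where "b t = cov r1 r2 (arccos (max (- 1) (min 1 t)))" for t
  have bm [measurable]: "b \<in> borel_measurable borel"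
  proof -
    have "(\<lambda>t. arccos (max (- 1) (min 1 t))) \<in> borel_measurable borel"
      by (intro borel_measurable_continuous_onI continuous_intros) auto
    from measurable_compose[OF this cov_measurable[OF r]] show ?thesis by (simp add: b_def[abs_def])
  qed
  have bb: "\<bar>b t\<bar> \<le> cov r1 r1 0 + cov r2 r2 0" for t
    unfolding b_def by (rule cov_bound[OF r])
  have PP: "(LINT \<omega>|M. P r1 \<omega> x * cnj (P r2 \<omega> y)) = of_real (b (dot2 (y, x)))" for x y
  proof -
    have "b (dot2 (y, x)) = cov r1 r2 (arccos (dot2 (y, x)))"
      using sphere_dot_bounds[of "fst x" "snd x" "fst y" "snd y"] by (simp add: b_def)
    then show ?thesis
      using psi_covariance[OF r, of "fst x" "snd x" "fst y" "snd y"] by (simp add: P_def flip: of_real_mult)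
  qed
  have main: "(LINT \<omega>|M. psi_coeff l m r1 \<omega> * cnj (psi_coeff l' m' r2 \<omega>)) =
      (LINT z|?N. of_real (b (dot2 z)) * (cnj (Yf 0 l m (snd z)) * Yf 0 l' m' (fst z)))"
    if m: "\<bar>m\<bar> \<le> int l" "\<bar>m'\<bar> \<le> int l'" for l m l' m'
  proof -
    define D where "D l = sqrt (real (2 * l + 1) / (4 * pi))" for l :: nat
    have int: "integrable ?N (\<lambda>z. of_real (b (dot2 z)) * (cnj (Yf 0 l m (snd z)) * Yf 0 l' m' (fst z)))"
    proof (rule N.integrable_const_bound[of _ "(cov r1 r1 0 + cov r2 r2 0) * (D l * D l')"])
      have [measurable]: "Yf 0 l m \<in> borel_measurable sphere_measure" "Yf 0 l' m' \<in> borel_measurable sphere_measure"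
        using m Yf_measurable[of 0 l m] Yf_measurable[of 0 l' m'] by simp_all
      note [measurable] = measurable_dot2
      show "(\<lambda>z. of_real (b (dot2 z)) * (cnj (Yf 0 l m (snd z)) * Yf 0 l' m' (fst z))) \<in> borel_measurable ?N"
        by measurable
      have Y: "cmod (Yf 0 l m x) \<le> D l" if "\<bar>m\<bar> \<le> int l" for l m x
        using Yf_bound[of 0 l m x] that by (simp add: D_def)
      have D0: "0 \<le> D l" for l by (simp add: D_def)
      have B0: "0 \<le> cov r1 r1 0 + cov r2 r2 0" using bb[of 0] by linarith
      show "AE z in ?N. norm (of_real (b (dot2 z)) * (cnj (Yf 0 l m (snd z)) * Yf 0 l' m' (fst z))) \<le> (cov r1 r1 0 + cov r2 r2 0) * (D l * D l')"
        unfolding norm_mult complex_mod_cnj norm_of_real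
        by (intro AE_I2 mult_mono bb Y m D0 B0 mult_nonneg_nonneg norm_ge_zero)
    qed
    have "(LINT \<omega>|M. psi_coeff l m r1 \<omega> * cnj (psi_coeff l' m' r2 \<omega>)) =
      (LINT y|sphere_measure. (LINT \<omega>|M. psi_coeff l m r1 \<omega> * cnj (P r2 \<omega> y)) * Yf 0 l' m' y)"
      unfolding psi_coeff_def[of l' m' r2]
      by (rule expectation_mult_cnj_sphere_coeff[OF P_field[OF r(2)] Yf_0_continuous[OF m(2)] psi_coeff_square_integrable[OF r(1) m(1)]])
    also have "\<dots> = (LINT y|sphere_measure. (LINT x|sphere_measure. of_real (b (dot2 (y, x))) * (cnj (Yf 0 l m x) * Yf 0 l' m' y)))"
    proof (intro Bochner_Integration.integral_cong refl)
      fix y assume "y \<in> space sphere_measure"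
      then have "square_integrable_rv M (\<lambda>\<omega>. P r2 \<omega> y)"
        by (intro field_on_sphere_section[OF P_field[OF r(2)]]) simp
      then have "(LINT \<omega>|M. psi_coeff l m r1 \<omega> * cnj (P r2 \<omega> y)) =
          (LINT x|sphere_measure. (LINT \<omega>|M. P r1 \<omega> x * cnj (P r2 \<omega> y)) * cnj (Yf 0 l m x))"
        unfolding psi_coeff_def by (rule expectation_sphere_coeff_mult_cnj[OF P_field[OF r(1)] Yf_0_continuous[OF m(1)]])
      then show "(LINT \<omega>|M. psi_coeff l m r1 \<omega> * cnj (P r2 \<omega> y)) * Yf 0 l' m' y =
          (LINT x|sphere_measure. of_real (b (dot2 (y, x))) * (cnj (Yf 0 l m x) * Yf 0 l' m' y))"
        unfolding PP by (simp add: mult.assoc[symmetric])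
    qed
    also have "\<dots> = (LINT z|?N. of_real (b (dot2 z)) * (cnj (Yf 0 l m (snd z)) * Yf 0 l' m' (fst z)))"
      using Q.integral_fst'[OF int] by simp
    finally show ?thesis .
  qed
  have m0: "\<bar>0\<bar> \<le> int l" by simp
  show ?thesis
    unfolding main[OF m] main[OF m0 m0] by (rule zonal_kernel_diagonal[OF bm bb m])
qed

text \<open>By invariance the mean of the potential is constant on the sphere, and a constant has no
  component of degree \<open>l \<noteq> 0\<close>.\<close>

lemma psi_coeff_mean:
  assumes "r \<in> chi_range K" "\<bar>m\<bar> \<le> int l" "l \<noteq> 0"
  shows "(LINT \<omega>|M. psi_coeff l m r \<omega>) = 0"
proof -
  have "(LINT \<omega>|M. 1 * cnj (psi_coeff l m r \<omega>)) = (LINT x|sphere_measure. (LINT \<omega>|M. 1 * cnj (P r \<omega> x)) * Yf 0 l m x)"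
    unfolding psi_coeff_def
    by (rule expectation_mult_cnj_sphere_coeff[OF P_field[OF assms(1)] Yf_0_continuous[OF assms(2)]])
      (simp add: square_integrable_rv_def)
  also have "\<dots> = (LINT x|sphere_measure. of_real (LINT \<omega>|M. \<psi> (slice_point K r (direction 0 0)) \<omega>) * Yf 0 l m x)"
  proof -
    have "(LINT \<omega>|M. 1 * cnj (P r \<omega> x)) = of_real (LINT \<omega>|M. \<psi> (slice_point K r (direction 0 0)) \<omega>)" for x
      using psi_mean[OF assms(1), of "fst x" "snd x"] by (simp add: P_def)
    then show ?thesis by (simp only:)
  qed
  also have "\<dots> = 0" using integral_Yf_0[OF assms(2,3)] by simp
  finally show ?thesis by simp
qed

text \<open>As \<open>f_K K 0 = 0\<close>, all directions give the same point at radius zero, so the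
  potential is constant there as a function of the direction.\<close>

lemma psi_coeff_origin:
  assumes "\<bar>m\<bar> \<le> int l" "l \<noteq> 0"
  shows "psi_coeff l m 0 \<omega> = 0"
proof -
  have "slice_point K 0 n = lift4 (height K 0) 0" for n
    by (simp add: slice_point_def f_K_def)
  then have "psi_coeff l m 0 \<omega> = of_real (\<psi> (lift4 (height K 0) 0) \<omega>) * cnj (LINT x|sphere_measure. Yf 0 l m x)"
    by (simp add: psi_coeff_def sphere_coeff_def P_def)
  then show ?thesis using integral_Yf_0[OF assms] by simp
qed

end

section \<open>Spin fields\<close>

text \<open>The inverse rotation in \<open>rotated_section\<close> is compensated by multiplying the
  frame by \<open>g\<close>. Isotropy thereby becomes a statement on frame values alone, in which
  equivalence classes no longer occur.\<close>

lemma frame_value_rotated: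
  assumes "g \<in> SO3"
  shows "frame_value (rotated_section g Z) g1 \<omega> = frame_value Z (g ** g1) \<omega>"
proof -
  have o: "transpose g ** g = mat 1" "g ** transpose g = mat 1"
    using assms by (auto simp: SO3_def rotation_matrix_def orthogonal_matrix_def)
  have "transpose g ** g0 = g1 \<longleftrightarrow> g0 = g ** g1" for g0
    by (metis o matrix_mul_assoc matrix_mul_lid)
  then have "(g1, z) \<in> bundle_act (transpose g) p \<longleftrightarrow> (g ** g1, z) \<in> p" for z p
    unfolding bundle_act_def by (force simp: image_iff)
  then show ?thesis
    by (simp add: frame_value_def rotated_section_def fibre_coord_def matrix_vector_mul_assoc)
qed

lemma continuous_on_euler:
  fixes f g :: "'a :: t2_space \<Rightarrow> real"
  assumes "continuous_on A f" "continuous_on A g"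
  shows "continuous_on A (\<lambda>x. euler (f x) (g x) 0)"
proof (rule continuous_on_vecI, rule continuous_on_vecI)
  have "\<forall>i j. continuous_on A (\<lambda>x. euler (f x) (g x) 0 $ i $ j)"
    unfolding forall_3 euler_entries using assms by (auto intro!: continuous_intros)
  then show "continuous_on A (\<lambda>x. euler (f x) (g x) 0 $ i $ j)" for i j by blast
qed

lemma mat_1_SO3: "mat 1 \<in> SO3"
  by (simp add: SO3_def rotation_matrix_def orthogonal_matrix_def)

lemma ms_continuous_sequentially:
  fixes A :: "'b :: t2_space set"
  assumes "ms_continuous_on M A Z" "\<And>n. z n \<in> A" "z \<longlonglongrightarrow> a" "a \<in> A"
  shows "(\<lambda>n. LINT \<omega>|M. (cmod (Z a \<omega> - Z (z n) \<omega>))\<^sup>2) \<longlonglongrightarrow> 0"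
proof -
  define f where "f y = (LINT \<omega>|M. (cmod (Z y \<omega> - Z a \<omega>))\<^sup>2)" for y
  have "f a = 0" by (simp add: f_def)
  then have "continuous (at a within A) f"
    using assms(1,4) by (simp add: continuous_within ms_continuous_on_def f_def[abs_def])
  then have "(\<lambda>n. f (z n)) \<longlonglongrightarrow> f a"
    by (rule continuous_within_tendsto_compose') (use assms in auto)
  then show ?thesis unfolding \<open>f a = 0\<close> by (simp add: f_def norm_minus_commute)
qed

text \<open>Each spin operator multiplies a coefficient by a number that depends only on
  \<open>l\<close>, and so do compositions. The clause \<open>c 0 = 0\<close> matters for the
  convergence, where lowering from spin \<open>1\<close> has the factor zero at
  \<open>l = 0\<close>; for positive spin \<open>l = 0\<close> is outside the range.\<close>

lemma derived_from_potential_coeffs: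
  "\<exists>c :: nat \<Rightarrow> real. c 0 = 0 \<and> (\<forall>p f. derived_from_potential k p f \<longrightarrow>
    (\<forall>l m. spin k \<le> l \<and> \<bar>m\<bar> \<le> int l \<longrightarrow>
      sY_coeff (int (spin k)) f l m = of_real (c l) * sY_coeff 0 p l m))"
proof -
  have half: "sY_coeff s (\<lambda>\<theta> \<phi>. f \<theta> \<phi> / 2) l m = sY_coeff s f l m / 2" for s f l m
  proof -
    have "sY_coeff s (\<lambda>\<theta> \<phi>. f \<theta> \<phi> / 2) l m = (LINT x|lborel. (indicator sphere_domain x *\<^sub>R
        (case x of (\<theta>, \<phi>) \<Rightarrow> f \<theta> \<phi> * cnj (sY s l m \<theta> \<phi>) * of_real (sin \<theta>))) / 2)"
      unfolding sY_coeff_def set_lebesgue_integral_def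
      by (intro Bochner_Integration.integral_cong refl) (simp add: split_beta scaleR_conv_of_real)
    then show ?thesis by (simp add: sY_coeff_def set_lebesgue_integral_def)
  qed
  define r where "r s l = sqrt (of_int ((int l - s) * (int l + s + 1)))" for s :: int and l :: nat
  define w where "w s l = sqrt (of_int ((int l + s) * (int l - s + 1)))" for s :: int and l :: nat
  have raise: "sY_coeff (s + 1) h l m = of_real (r s l) * sY_coeff s f l m"
    if "spin_raise s f h" "\<bar>s + 1\<bar> \<le> int l" "\<bar>m\<bar> \<le> int l" for s f h l m
    using that by (simp add: spin_raise_def r_def)
  have lower: "sY_coeff (s - 1) h l m = - of_real (w s l) * sY_coeff s f l m"
    if "spin_lower s f h" "\<bar>s - 1\<bar> \<le> int l" "\<bar>m\<bar> \<le> int l" for s f h l m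
    using that by (simp add: spin_lower_def w_def)
  have w0: "w 1 0 = 0" by (simp add: w_def)
  show ?thesis
  proof (cases k)
    case Convergence
    have "sY_coeff 0 f l m = of_real (- (w 1 l * r 0 l) / 2) * sY_coeff 0 p l m"
      if dp: "derived_from_potential Convergence p f" and lm: "\<bar>m\<bar> \<le> int l" for p f l m
    proof -
      obtain f1 f2 where f: "spin_raise 0 p f1" "spin_lower 1 f1 f2" "f = (\<lambda>\<theta> \<phi>. f2 \<theta> \<phi> / 2)"
        using dp by auto
      have 1: "sY_coeff 0 f2 l m = - of_real (w 1 l) * sY_coeff 1 f1 l m"
        using lower[OF f(2), of l m] lm by simp
      show ?thesis
      \<comment> \<open>Spin \<open>1\<close> has no harmonic with \<open>l = 0\<close>, so
        \<open>spin_raise\<close> gives no information there; the factor \<open>w 1 0 = 0\<close>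
        settles this case.\<close>
      proof (cases "l = 0")
        case True
        then show ?thesis unfolding f(3) half 1 by (simp add: w0)
      next
        case False
        then show ?thesis unfolding f(3) half 1 using raise[OF f(1), of l m] lm by simp
      qed
    qed
    then show ?thesis unfolding Convergence
      by (intro exI[of _ "\<lambda>l. - (w 1 l * r 0 l) / 2"]) (simp add: w0 del: derived_from_potential.simps)
  next
    case First_Flexion
    have "sY_coeff 1 f l m = of_real (- (r 0 l * w 1 l * r 0 l) / 2) * sY_coeff 0 p l m"
      if dp: "derived_from_potential First_Flexion p f" and lm: "\<bar>m\<bar> \<le> int l" "1 \<le> l" for p f l m
    proof -
      obtain f1 f2 f3 where f: "spin_raise 0 p f1" "spin_lower 1 f1 f2" "spin_raise 0 f2 f3" "f = (\<lambda>\<theta> \<phi>. f3 \<theta> \<phi> / 2)"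
        using dp by auto
      show ?thesis unfolding f(4) half
        using raise[OF f(1), of l m] lower[OF f(2), of l m] raise[OF f(3), of l m] lm by simp
    qed
    then show ?thesis unfolding First_Flexion
      by (intro exI[of _ "\<lambda>l. - (r 0 l * w 1 l * r 0 l) / 2"]) (simp add: w0 del: derived_from_potential.simps)
  next
    case Shear
    have "sY_coeff 2 f l m = of_real (r 1 l * r 0 l / 2) * sY_coeff 0 p l m"
      if dp: "derived_from_potential Shear p f" and lm: "\<bar>m\<bar> \<le> int l" "2 \<le> l" for p f l m
    proof -
      obtain f1 f2 where f: "spin_raise 0 p f1" "spin_raise 1 f1 f2" "f = (\<lambda>\<theta> \<phi>. f2 \<theta> \<phi> / 2)"
        using dp by auto
      show ?thesis unfolding f(3) half
        using raise[OF f(1), of l m] raise[OF f(2), of l m] lm by simp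
    qed
    then show ?thesis unfolding Shear
      by (intro exI[of _ "\<lambda>l. if l = 0 then 0 else r 1 l * r 0 l / 2"]) (simp del: derived_from_potential.simps)
  next
    case Second_Flexion
    have "sY_coeff 3 f l m = of_real (r 2 l * r 1 l * r 0 l / 2) * sY_coeff 0 p l m"
      if dp: "derived_from_potential Second_Flexion p f" and lm: "\<bar>m\<bar> \<le> int l" "3 \<le> l" for p f l m
    proof -
      obtain f1 f2 f3 where f: "spin_raise 0 p f1" "spin_raise 1 f1 f2" "spin_raise 2 f2 f3" "f = (\<lambda>\<theta> \<phi>. f3 \<theta> \<phi> / 2)"
        using dp by auto
      show ?thesis unfolding f(4) half
        using raise[OF f(1), of l m] raise[OF f(2), of l m] raise[OF f(3), of l m] lm by simp
    qed
    then show ?thesis unfolding Second_Flexion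
      by (intro exI[of _ "\<lambda>l. if l = 0 then 0 else r 2 l * r 1 l * r 0 l / 2"]) (simp del: derived_from_potential.simps)
  qed
qed

lemma sY_coeff_eq_sphere_coeff:
  assumes "(\<lambda>x. f (fst x) (snd x)) \<in> borel_measurable sphere_measure" "s \<le> l" "\<bar>m\<bar> \<le> int l"
  shows "sY_coeff (int s) f l m = (LINT x|sphere_measure. f (fst x) (snd x) * cnj (Yf s l m x))"
proof -
  have [measurable]: "(\<lambda>x. f (fst x) (snd x)) \<in> borel_measurable sphere_measure" "Yf s l m \<in> borel_measurable sphere_measure"
    using assms Yf_measurable by auto
  have "(LINT x|sphere_measure. f (fst x) (snd x) * cnj (Yf s l m x)) =
      (LINT x:sphere_domain|lborel. sin (fst x) *\<^sub>R (f (fst x) (snd x) * cnj (Yf s l m x)))"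
    by (intro integral_sphere_measure) measurable
  then show ?thesis
    unfolding sY_coeff_def set_lebesgue_integral_def
    by (simp add: split_beta scaleR_conv_of_real mult_ac)
qed

lemma sum_from_eq_sum_lessThan:
  "(\<Sum>l\<in>{s..N}. f l) = (\<Sum>l<Suc N. if s \<le> l then f l else 0)" for f :: "nat \<Rightarrow> 'a :: comm_monoid_add"
  by (rule sum.mono_neutral_cong_left) auto

text \<open>The inequality of arithmetic and geometric means, applied term by term, bounds the
  kernel by the average of its two diagonal values, which are equal.\<close>

lemma norm_sY_kernel_le:
  assumes "s \<le> l"
  shows "cmod (\<Sum>m\<in>{- int l..int l}. Yf s l m x * cnj (Yf s l m y)) \<le> real (2 * l + 1) / (4 * pi)"
proof -
  have N: "(\<Sum>m\<in>{- int l..int l}. (cmod (Yf s l m x))\<^sup>2) = real (2 * l + 1) / (4 * pi)" for x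
  proof -
    have "complex_of_real (\<Sum>m\<in>{- int l..int l}. (cmod (Yf s l m x))\<^sup>2) = of_real (real (2 * l + 1) / (4 * pi))"
      unfolding sY_square_sum[OF assms, of "fst x" "snd x", symmetric] by (simp only: of_real_sum complex_norm_square)
    then show ?thesis by (simp only: of_real_eq_iff)
  qed
  have "cmod (\<Sum>m\<in>{- int l..int l}. Yf s l m x * cnj (Yf s l m y)) \<le> (\<Sum>m\<in>{- int l..int l}. cmod (Yf s l m x) * cmod (Yf s l m y))"
    by (rule order_trans[OF norm_sum]) (simp add: norm_mult)
  also have "\<dots> \<le> (\<Sum>m\<in>{- int l..int l}. ((cmod (Yf s l m x))\<^sup>2 + (cmod (Yf s l m y))\<^sup>2) / 2)"
  proof (intro sum_mono)
    fix m
    show "cmod (Yf s l m x) * cmod (Yf s l m y) \<le> ((cmod (Yf s l m x))\<^sup>2 + (cmod (Yf s l m y))\<^sup>2) / 2"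
      using sum_squares_bound[of "cmod (Yf s l m x)" "cmod (Yf s l m y)"] by simp
  qed
  also have "\<dots> = ((\<Sum>m\<in>{- int l..int l}. (cmod (Yf s l m x))\<^sup>2) + (\<Sum>m\<in>{- int l..int l}. (cmod (Yf s l m y))\<^sup>2)) / 2"
    by (simp add: sum.distrib flip: sum_divide_distrib)
  also have "\<dots> = real (2 * l + 1) / (4 * pi)" unfolding N by simp
  finally show ?thesis .
qed

text \<open>The chart contains only \<phi> between \<open>0\<close> and \<open>2 pi\<close>, while
  the expansion and the correlation formula are asserted for all real \<phi>; the frame and the
  harmonics both have period \<open>2 pi\<close>.\<close>

lemma field_value_wrap:
  "\<exists>\<phi>'\<in>{0..2 * pi}. (\<forall>X r \<theta> \<omega>. field_value X r \<theta> \<phi> \<omega> = field_value X r \<theta> \<phi>' \<omega>) \<and>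
    (\<forall>s l m \<theta>. sY s l m \<theta> \<phi> = sY s l m \<theta> \<phi>')"
proof -
  define k where "k = \<lfloor>\<phi> / (2 * pi)\<rfloor>"
  define \<phi>' where "\<phi>' = \<phi> - 2 * pi * of_int k"
  have "of_int k \<le> \<phi> / (2 * pi)" "\<phi> / (2 * pi) < of_int k + 1" unfolding k_def by linarith+
  then have "\<phi>' \<in> {0..2 * pi}" by (auto simp: \<phi>'_def field_simps)
  moreover have eq: "\<phi> = \<phi>' + 2 * pi * of_int k" by (simp add: \<phi>'_def)
  have sc: "cos \<phi> = cos \<phi>'" "sin \<phi> = sin \<phi>'"
    unfolding eq by (simp_all add: cos_add sin_add)
  then have "Rz \<phi> = Rz \<phi>'" by (simp add: Rz_def)
  then have "field_value X r \<theta> \<phi> \<omega> = field_value X r \<theta> \<phi>' \<omega>" for X :: "real \<Rightarrow> real ^ 3 \<Rightarrow> 'b \<Rightarrow> bundle_point set" and r \<theta> \<omega>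
    by (simp add: field_value_def euler_def)
  moreover have "cis (of_int m * \<phi>) = cis (of_int m * \<phi>')" for m :: int
  proof -
    have "cis (of_int m * \<phi>) = cis (of_int m * \<phi>') * cis (2 * pi * of_int (m * k))"
      unfolding eq by (simp add: cis_mult algebra_simps)
    also have "cis (2 * pi * of_int (m * k)) = 1"
      by (rule cis_multiple_2pi) simp
    finally show ?thesis by simp
  qed
  then have "sY s l m \<theta> \<phi> = sY s l m \<theta> \<phi>'" for s l m \<theta>
    by (simp add: sY_def)
  ultimately show ?thesis by blast
qed

section \<open>The spin field and its coefficient processes\<close>

locale spin_field = invariant_potential M K \<psi>
  for M :: "'w measure" and K \<psi> +
  fixes k :: field_kind and X :: "real \<Rightarrow> real^3 \<Rightarrow> 'w \<Rightarrow> bundle_point set"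
  assumes field: "spin_cosmological_field M K k \<psi> X"
begin

abbreviation "s \<equiv> spin k"

definition F :: "real \<Rightarrow> 'w \<Rightarrow> real \<times> real \<Rightarrow> complex" where
  "F r \<omega> x = field_value X r (fst x) (snd x) \<omega>"

lemma F_frame: "F r \<omega> x = frame_value (X r) (euler (snd x) (fst x) 0) \<omega>"
  by (simp add: F_def field_value_def)

lemma frame_ms: "ms_continuous_on M (chi_range K \<times> SO3) (\<lambda>(r, g). frame_value (X r) g)"
  using field by (simp add: spin_cosmological_field_def)

lemma frame_square_integrable:
  "r \<in> chi_range K \<Longrightarrow> g \<in> SO3 \<Longrightarrow> square_integrable_rv M (frame_value (X r) g)"
  using frame_ms by (force simp: ms_continuous_on_def)

lemma frame_seq:
  assumes "\<And>n. r n \<in> chi_range K" "\<And>n. g n \<in> SO3" "r \<longlonglongrightarrow> r'" "g \<longlonglongrightarrow> g'" "r' \<in> chi_range K" "g' \<in> SO3"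
  shows "(\<lambda>n. LINT \<omega>|M. (cmod (frame_value (X r') g' \<omega> - frame_value (X (r n)) (g n) \<omega>))\<^sup>2) \<longlonglongrightarrow> 0"
  using ms_continuous_sequentially[OF frame_ms, of "\<lambda>n. (r n, g n)" "(r', g')"] assms
  by (simp add: tendsto_Pair)

definition V :: "real \<Rightarrow> real" where
  "V r = (LINT \<omega>|M. (cmod (frame_value (X r) (mat 1) \<omega>))\<^sup>2)"

text \<open>Isotropy is applied at the frame \<open>mat 1\<close> in both arguments; the rotation
  \<open>g\<close> carries this frame to the frame \<open>g\<close>.\<close>

lemma frame_variance:
  assumes "r \<in> chi_range K" "g \<in> SO3"
  shows "(LINT \<omega>|M. (cmod (frame_value (X r) g \<omega>))\<^sup>2) = V r"
proof -
  have "(LINT \<omega>|M. frame_value (rotated_section g (X r)) (mat 1) \<omega> * cnj (frame_value (rotated_section g (X r)) (mat 1) \<omega>)) =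
        (LINT \<omega>|M. frame_value (X r) (mat 1) \<omega> * cnj (frame_value (X r) (mat 1) \<omega>))"
    using field assms mat_1_SO3 unfolding spin_cosmological_field_def isotropic_section_def by blast
  then have "complex_of_real (LINT \<omega>|M. (cmod (frame_value (X r) g \<omega>))\<^sup>2) = of_real (V r)"
    unfolding frame_value_rotated[OF assms(2)] matrix_mul_rid integral_cmod_square V_def .
  then show ?thesis by (simp only: of_real_eq_iff)
qed

lemma F_variance: "r \<in> chi_range K \<Longrightarrow> (LINT \<omega>|M. (cmod (F r \<omega> x))\<^sup>2) = V r"
  unfolding F_frame by (intro frame_variance euler_SO3)

lemma F_square_integrable: "r \<in> chi_range K \<Longrightarrow> square_integrable_rv M (\<lambda>\<omega>. F r \<omega> x)"
  unfolding F_frame by (intro frame_square_integrable euler_SO3)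

lemma F_field:
  assumes "r \<in> chi_range K"
  shows "field_on_sphere M (F r) (V r)"
proof -
  have [measurable]: "fst \<in> borel_measurable sphere_measure" "snd \<in> borel_measurable sphere_measure"
    by (auto intro!: measurable_sphere_continuous continuous_intros)
  have m: "(\<lambda>(\<omega>, r, \<theta>, \<phi>). field_value X r \<theta> \<phi> \<omega>) \<in> borel_measurable
        (M \<Otimes>\<^sub>M restrict_space borel (chi_range K \<times> {0..pi} \<times> {0..2 * pi}))"
    using field by (simp add: spin_cosmological_field_def random_section_field_def)
  have "(\<lambda>z. (r, fst (snd z), snd (snd z))) \<in> borel_measurable (M \<Otimes>\<^sub>M sphere_measure)"
    unfolding borel_prod[symmetric] by measurable
  then have "(\<lambda>z. (r, fst (snd z), snd (snd z))) \<in> measurable (M \<Otimes>\<^sub>M sphere_measure) (restrict_space borel (chi_range K \<times> {0..pi} \<times> {0..2 * pi}))"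
    using assms by (intro measurable_restrict_space2) (auto simp: space_pair_measure sphere_domain_def)
  from measurable_compose[OF measurable_Pair[OF measurable_fst this] m]
  have "case_prod (F r) \<in> borel_measurable (M \<Otimes>\<^sub>M sphere_measure)"
    by (simp add: F_def split_beta')
  then show ?thesis
    unfolding field_on_sphere_def using F_variance[OF assms] F_square_integrable[OF assms]
    by (simp add: square_integrable_rv_def)
qed

definition a :: "nat \<Rightarrow> int \<Rightarrow> real \<Rightarrow> 'w \<Rightarrow> complex" where
  "a l m r = sphere_coeff (F r) (Yf s l m)"

lemma Yf_continuous: "s \<le> l \<Longrightarrow> \<bar>m\<bar> \<le> int l \<Longrightarrow> continuous_on sphere_domain (Yf s l m)"
  by (rule sY_continuous)

lemma a_square_integrable:
  "r \<in> chi_range K \<Longrightarrow> s \<le> l \<Longrightarrow> \<bar>m\<bar> \<le> int l \<Longrightarrow> square_integrable_rv M (a l m r)"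
  unfolding a_def by (intro sphere_coeff_bound(1)[OF F_field] Yf_continuous)

lemma measurable_section:
  assumes "field_on_sphere M Z B" "\<omega> \<in> space M"
  shows "Z \<omega> \<in> borel_measurable sphere_measure"
  using assms measurable_compose[OF measurable_Pair1'[OF assms(2)], of "case_prod Z" sphere_measure borel]
  by (simp add: field_on_sphere_def)

text \<open>Chosen from the kind of the field alone, so the same factors serve all radii and almost
  all \<omega>.\<close>

definition coupling :: "nat \<Rightarrow> real" where
  "coupling = (SOME c. c 0 = 0 \<and> (\<forall>p f. derived_from_potential k p f \<longrightarrow>
    (\<forall>l m. s \<le> l \<and> \<bar>m\<bar> \<le> int l \<longrightarrow> sY_coeff (int s) f l m = of_real (c l) * sY_coeff 0 p l m)))"

lemma coupling:
  "coupling 0 = 0"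
  "derived_from_potential k p f \<Longrightarrow> s \<le> l \<Longrightarrow> \<bar>m\<bar> \<le> int l \<Longrightarrow>
    sY_coeff (int s) f l m = of_real (coupling l) * sY_coeff 0 p l m"
  using someI_ex[OF derived_from_potential_coeffs[of k]] unfolding coupling_def[symmetric] by blast+

text \<open>The exceptional null set may depend on \<open>r\<close>. This suffices, because
  expectations below involve only one or two radii at a time.\<close>

lemma a_eq_psi_coeff:
  assumes r: "r \<in> chi_range K" and lm: "s \<le> l" "\<bar>m\<bar> \<le> int l"
  shows "AE \<omega> in M. a l m r \<omega> = of_real (coupling l) * psi_coeff l m r \<omega>"
proof -
  have "AE \<omega> in M. derived_from_potential k
      (\<lambda>\<theta> \<phi>. of_real (\<psi> (slice_point K r (direction \<theta> \<phi>)) \<omega>)) (\<lambda>\<theta> \<phi>. field_value X r \<theta> \<phi> \<omega>)"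
    using field r by (simp add: spin_cosmological_field_def)
  then show ?thesis
    using AE_space
  proof eventually_elim
    case (elim \<omega>)
    have "sY_coeff (int s) (\<lambda>\<theta> \<phi>. field_value X r \<theta> \<phi> \<omega>) l m = a l m r \<omega>"
      using sY_coeff_eq_sphere_coeff[of "\<lambda>\<theta> \<phi>. field_value X r \<theta> \<phi> \<omega>" s l m] measurable_section[OF F_field[OF r] elim(2)] lm
      by (simp add: a_def sphere_coeff_def F_def[abs_def])
    moreover have "sY_coeff (int 0) (\<lambda>\<theta> \<phi>. of_real (\<psi> (slice_point K r (direction \<theta> \<phi>)) \<omega>)) l m = psi_coeff l m r \<omega>"
      using sY_coeff_eq_sphere_coeff[of "\<lambda>\<theta> \<phi>. of_real (\<psi> (slice_point K r (direction \<theta> \<phi>)) \<omega>)" 0 l m] measurable_section[OF P_field[OF r] elim(2)] lm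
      by (simp add: psi_coeff_def sphere_coeff_def P_def[abs_def])
    ultimately show ?case using coupling(2)[OF elim(1) lm] by simp
  qed
qed

lemma a_measurable: "r \<in> chi_range K \<Longrightarrow> s \<le> l \<Longrightarrow> \<bar>m\<bar> \<le> int l \<Longrightarrow> a l m r \<in> borel_measurable M"
  using a_square_integrable by (auto simp: square_integrable_rv_def)

lemma psi_coeff_measurable: "r \<in> chi_range K \<Longrightarrow> \<bar>m\<bar> \<le> int l \<Longrightarrow> psi_coeff l m r \<in> borel_measurable M"
  using psi_coeff_square_integrable by (auto simp: square_integrable_rv_def)

text \<open>The index \<open>m = 0\<close> occurs for every \<open>l\<close>;
  \<open>a_covariance\<close> shows that all other \<open>m\<close> give the same kernel.\<close>

definition C :: "nat \<Rightarrow> real \<Rightarrow> real \<Rightarrow> complex" where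
  "C l r1 r2 = (LINT \<omega>|M. a l 0 r1 \<omega> * cnj (a l 0 r2 \<omega>))"

lemma a_covariance_psi:
  assumes r: "r1 \<in> chi_range K" "r2 \<in> chi_range K" and lm: "s \<le> l" "\<bar>m\<bar> \<le> int l" "s \<le> l'" "\<bar>m'\<bar> \<le> int l'"
  shows "(LINT \<omega>|M. a l m r1 \<omega> * cnj (a l' m' r2 \<omega>)) =
    of_real (coupling l * coupling l') * (LINT \<omega>|M. psi_coeff l m r1 \<omega> * cnj (psi_coeff l' m' r2 \<omega>))"
proof -
  note [measurable] = a_measurable[OF r(1) lm(1,2)] a_measurable[OF r(2) lm(3,4)]
    psi_coeff_measurable[OF r(1) lm(2)] psi_coeff_measurable[OF r(2) lm(4)]
  have "(LINT \<omega>|M. a l m r1 \<omega> * cnj (a l' m' r2 \<omega>)) =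
      (LINT \<omega>|M. of_real (coupling l * coupling l') * (psi_coeff l m r1 \<omega> * cnj (psi_coeff l' m' r2 \<omega>)))"
  proof (rule integral_cong_AE)
    show "AE \<omega> in M. a l m r1 \<omega> * cnj (a l' m' r2 \<omega>) = of_real (coupling l * coupling l') * (psi_coeff l m r1 \<omega> * cnj (psi_coeff l' m' r2 \<omega>))"
      using a_eq_psi_coeff[OF r(1) lm(1,2)] a_eq_psi_coeff[OF r(2) lm(3,4)] by eventually_elim simp
  qed measurable
  then show ?thesis by simp
qed

text \<open>The diagonal form is inherited from the potential, since the factors
  \<open>coupling l\<close> depend neither on \<open>m\<close> nor on the radius.\<close>

lemma a_covariance:
  assumes "r1 \<in> chi_range K" "r2 \<in> chi_range K" "s \<le> l" "\<bar>m\<bar> \<le> int l" "s \<le> l'" "\<bar>m'\<bar> \<le> int l'"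
  shows "(LINT \<omega>|M. a l m r1 \<omega> * cnj (a l' m' r2 \<omega>)) = (if l = l' \<and> m = m' then C l r1 r2 else 0)"
proof -
  have "C l r1 r2 = of_real (coupling l * coupling l) * (LINT \<omega>|M. psi_coeff l 0 r1 \<omega> * cnj (psi_coeff l 0 r2 \<omega>))"
    unfolding C_def using assms by (intro a_covariance_psi) auto
  then show ?thesis
    unfolding a_covariance_psi[OF assms] psi_coeff_covariance[OF assms(1,2,4,6)] by auto
qed

text \<open>For \<open>l \<noteq> 0\<close> the potential coefficient has mean zero, and for
  \<open>l = 0\<close> the coupling vanishes. Centred coefficients turn vanishing second moments
  into absence of correlation.\<close>

lemma a_mean:
  assumes "r \<in> chi_range K" "s \<le> l" "\<bar>m\<bar> \<le> int l"
  shows "(LINT \<omega>|M. a l m r \<omega>) = 0"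
proof -
  note [measurable] = a_measurable[OF assms] psi_coeff_measurable[OF assms(1,3)]
  have "(LINT \<omega>|M. a l m r \<omega>) = (LINT \<omega>|M. of_real (coupling l) * psi_coeff l m r \<omega>)"
    by (rule integral_cong_AE[OF _ _ a_eq_psi_coeff[OF assms]]) measurable
  then show ?thesis
    using coupling(1) psi_coeff_mean[OF assms(1,3)] by (cases "l = 0") auto
qed

lemma C_origin:
  assumes "r \<in> chi_range K" "s \<le> l" "l \<noteq> 0"
  shows "C l 0 r = 0"
proof -
  have "0 \<in> chi_range K" by (simp add: chi_range_def)
  then show ?thesis
    unfolding C_def using assms by (subst a_covariance_psi) (auto simp: psi_coeff_origin)
qed

lemma C_diagonal: "C l r r = of_real (LINT \<omega>|M. (cmod (a l 0 r \<omega>))\<^sup>2)"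
  unfolding C_def by (rule integral_cmod_square)

definition Cr :: "nat \<Rightarrow> real \<Rightarrow> real" where
  "Cr l r = (LINT \<omega>|M. (cmod (a l 0 r \<omega>))\<^sup>2)"

lemma C_Cr: "C l r r = of_real (Cr l r)"
  by (simp add: C_diagonal Cr_def)

lemma Cr_nonneg: "0 \<le> Cr l r"
  by (simp add: Cr_def)

lemma C_bound:
  assumes "r1 \<in> chi_range K" "r2 \<in> chi_range K" "s \<le> l"
  shows "cmod (C l r1 r2) \<le> Cr l r1 + Cr l r2"
proof -
  have "square_integrable_rv M (a l 0 r1)" "square_integrable_rv M (a l 0 r2)"
    using assms by (auto intro: a_square_integrable)
  then have "(cmod (C l r1 r2))\<^sup>2 \<le> Cr l r1 * Cr l r2"
    unfolding C_def Cr_def by (rule Cauchy_Schwarz_complex)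
  also have "\<dots> \<le> (Cr l r1 + Cr l r2)\<^sup>2"
    using Cr_nonneg[of l r1] Cr_nonneg[of l r2] mult_le_sum_squares[of "Cr l r1" "Cr l r2"]
    by (simp add: power2_sum)
  finally show ?thesis
    using Cr_nonneg by (intro power2_le_imp_le[of "cmod (C l r1 r2)"]) auto
qed

text \<open>The quadratic form is the second moment of the linear combination of the variables
  \<open>a l 0 (x i)\<close> with coefficients \<open>c i\<close>.\<close>

lemma a_nonnegative_definite:
  assumes "s \<le> l"
  shows "nonnegative_definite (chi_range K) (C l)"
  unfolding nonnegative_definite_def
proof (intro allI impI)
  fix N :: nat and x :: "nat \<Rightarrow> real" and c :: "nat \<Rightarrow> complex"
  assume x: "\<forall>i<N. x i \<in> chi_range K"
  have sq: "square_integrable_rv M (a l 0 (x i))" if "i < N" for i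
    using assms x that by (intro a_square_integrable) auto
  have int: "integrable M (\<lambda>\<omega>. c i * cnj (c j) * (a l 0 (x i) \<omega> * cnj (a l 0 (x j) \<omega>)))" if "i < N" "j < N" for i j
    using integrable_mult_cnj[OF sq[OF that(1)] sq[OF that(2)]] by simp
  have "(\<Sum>i<N. \<Sum>j<N. c i * cnj (c j) * C l (x i) (x j)) =
      (\<Sum>i<N. \<Sum>j<N. (LINT \<omega>|M. c i * cnj (c j) * (a l 0 (x i) \<omega> * cnj (a l 0 (x j) \<omega>))))"
    by (simp add: C_def)
  also have "\<dots> = (LINT \<omega>|M. (\<Sum>i<N. \<Sum>j<N. c i * cnj (c j) * (a l 0 (x i) \<omega> * cnj (a l 0 (x j) \<omega>))))"
  proof -
    have "(\<Sum>j<N. (LINT \<omega>|M. c i * cnj (c j) * (a l 0 (x i) \<omega> * cnj (a l 0 (x j) \<omega>)))) =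
        (LINT \<omega>|M. (\<Sum>j<N. c i * cnj (c j) * (a l 0 (x i) \<omega> * cnj (a l 0 (x j) \<omega>))))" if "i < N" for i
      by (rule Bochner_Integration.integral_sum[symmetric]) (use int that in auto)
    moreover have "(LINT \<omega>|M. (\<Sum>i<N. \<Sum>j<N. c i * cnj (c j) * (a l 0 (x i) \<omega> * cnj (a l 0 (x j) \<omega>)))) =
        (\<Sum>i<N. (LINT \<omega>|M. (\<Sum>j<N. c i * cnj (c j) * (a l 0 (x i) \<omega> * cnj (a l 0 (x j) \<omega>)))))"
      by (rule Bochner_Integration.integral_sum) (use int in \<open>auto intro!: Bochner_Integration.integrable_sum\<close>)
    ultimately show ?thesis by simp
  qed
  also have "\<dots> = (LINT \<omega>|M. (\<Sum>i<N. c i * a l 0 (x i) \<omega>) * cnj (\<Sum>i<N. c i * a l 0 (x i) \<omega>))"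
    by (simp add: cnj_sum sum_product mult_ac)
  also have "\<dots> = of_real (LINT \<omega>|M. (cmod (\<Sum>i<N. c i * a l 0 (x i) \<omega>))\<^sup>2)"
    by (rule integral_cmod_square)
  finally show "(\<Sum>i<N. \<Sum>j<N. c i * cnj (c j) * C l (x i) (x j)) \<in> \<real>\<^sub>\<ge>\<^sub>0"
    by (simp add: nonneg_Reals_of_real_iff)
qed

lemma F_diff_bound:
  assumes "r \<in> chi_range K" "r' \<in> chi_range K"
  shows "(LINT \<omega>|M. (cmod (F r' \<omega> x - F r \<omega> x))\<^sup>2) \<le> 2 * V r' + 2 * V r"
proof -
  have "(LINT \<omega>|M. (cmod (F r' \<omega> x - F r \<omega> x))\<^sup>2) \<le> (LINT \<omega>|M. 2 * (cmod (F r' \<omega> x))\<^sup>2 + 2 * (cmod (F r \<omega> x))\<^sup>2)"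
  proof (rule integral_mono)
    show "integrable M (\<lambda>\<omega>. (cmod (F r' \<omega> x - F r \<omega> x))\<^sup>2)"
      using square_integrable_diff[OF F_square_integrable[OF assms(2)] F_square_integrable[OF assms(1)]]
      by (simp add: square_integrable_rv_def)
    show "integrable M (\<lambda>\<omega>. 2 * (cmod (F r' \<omega> x))\<^sup>2 + 2 * (cmod (F r \<omega> x))\<^sup>2)"
      using F_square_integrable[OF assms(1), of x] F_square_integrable[OF assms(2), of x] by (simp add: square_integrable_rv_def)
    fix \<omega>
    have "(cmod (F r' \<omega> x - F r \<omega> x))\<^sup>2 \<le> (cmod (F r' \<omega> x) + cmod (F r \<omega> x))\<^sup>2"
      by (intro power_mono norm_triangle_ineq4) auto
    also have "\<dots> \<le> 2 * (cmod (F r' \<omega> x))\<^sup>2 + 2 * (cmod (F r \<omega> x))\<^sup>2"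
      using sum_squares_bound[of "cmod (F r' \<omega> x)" "cmod (F r \<omega> x)"] by (simp add: power2_sum)
    finally show "(cmod (F r' \<omega> x - F r \<omega> x))\<^sup>2 \<le> 2 * (cmod (F r' \<omega> x))\<^sup>2 + 2 * (cmod (F r \<omega> x))\<^sup>2" .
  qed
  also have "\<dots> = 2 * V r' + 2 * V r"
    using F_square_integrable[OF assms(1), of x] F_square_integrable[OF assms(2), of x]
    by (simp add: square_integrable_rv_def F_variance assms)
  finally show ?thesis .
qed

text \<open>On almost every path both coefficient integrals exist, and there linearity makes the
  difference the coefficient of the difference field, to which \<open>sphere_coeff_bound\<close>
  applies.\<close>

lemma a_diff:
  assumes "r \<in> chi_range K" "r' \<in> chi_range K" "s \<le> l" "\<bar>m\<bar> \<le> int l"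
  shows "(LINT \<omega>|M. (cmod (a l m r' \<omega> - a l m r \<omega>))\<^sup>2) \<le>
    (LINT x|sphere_measure. (LINT \<omega>|M. (cmod (F r' \<omega> x - F r \<omega> x))\<^sup>2)) * (LINT x|sphere_measure. (cmod (Yf s l m x))\<^sup>2)"
proof -
  interpret Q: pair_sigma_finite M sphere_measure by (rule pair_sphere)
  note e = Yf_continuous[OF assms(3,4)]
  have e2: "square_integrable_rv sphere_measure (Yf s l m)"
    unfolding square_integrable_rv_def
    by (intro conjI measurable_sphere_continuous integrable_sphere_continuous continuous_intros e)
  define G where "G \<omega> x = F r' \<omega> x - F r \<omega> x" for \<omega> x
  have Fm [measurable]: "case_prod (F r) \<in> borel_measurable (M \<Otimes>\<^sub>M sphere_measure)" "case_prod (F r') \<in> borel_measurable (M \<Otimes>\<^sub>M sphere_measure)"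
    using F_field assms by (auto simp: field_on_sphere_def)
  have Gm: "case_prod G \<in> borel_measurable (M \<Otimes>\<^sub>M sphere_measure)"
    using borel_measurable_diff[OF Fm(2) Fm(1)] by (simp add: G_def[abs_def] split_beta')
  have sq: "square_integrable_rv M (\<lambda>\<omega>. G \<omega> x)" for x
    unfolding G_def by (intro square_integrable_diff F_square_integrable assms)
  have "(LINT \<omega>|M. (cmod (G \<omega> x))\<^sup>2) \<le> 2 * V r' + 2 * V r" for x
    unfolding G_def by (rule F_diff_bound[OF assms(1,2)])
  then have Gf: "field_on_sphere M G (2 * V r' + 2 * V r)"
    unfolding field_on_sphere_def using Gm sq by (auto simp: square_integrable_rv_def)
  have AEi: "AE \<omega> in M. integrable sphere_measure (\<lambda>x. F r \<omega> x * cnj (Yf s l m x))" if r: "r \<in> chi_range K" for r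
  proof -
    have "AE \<omega> in M. integrable sphere_measure (\<lambda>x. (cmod (F r \<omega> x))\<^sup>2)"
      using Q.AE_integrable_fst'[OF field_on_sphere_integrable[OF F_field[OF r]]] by simp
    then show ?thesis
      using AE_space
    proof eventually_elim
      case (elim \<omega>)
      then have "square_integrable_rv sphere_measure (F r \<omega>)"
        using measurable_section[OF F_field[OF r] elim(2)] by (simp add: square_integrable_rv_def)
      then show ?case by (rule integrable_mult_cnj[OF _ e2])
    qed
  qed
  have "AE \<omega> in M. (cmod (a l m r' \<omega> - a l m r \<omega>))\<^sup>2 = (cmod (sphere_coeff G (Yf s l m) \<omega>))\<^sup>2"
    using AEi[OF assms(1)] AEi[OF assms(2)]
    by eventually_elim (simp add: a_def sphere_coeff_def G_def left_diff_distrib)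
  then have "(LINT \<omega>|M. (cmod (a l m r' \<omega> - a l m r \<omega>))\<^sup>2) = (LINT \<omega>|M. (cmod (sphere_coeff G (Yf s l m) \<omega>))\<^sup>2)"
  proof (rule integral_cong_AE[rotated 2])
    have [measurable]: "a l m r \<in> borel_measurable M" "a l m r' \<in> borel_measurable M" "sphere_coeff G (Yf s l m) \<in> borel_measurable M"
      using a_square_integrable[OF assms(1,3,4)] a_square_integrable[OF assms(2-4)] sphere_coeff_bound(1)[OF Gf e]
      by (auto simp: square_integrable_rv_def)
    show "(\<lambda>\<omega>. (cmod (a l m r' \<omega> - a l m r \<omega>))\<^sup>2) \<in> borel_measurable M"
      "(\<lambda>\<omega>. (cmod (sphere_coeff G (Yf s l m) \<omega>))\<^sup>2) \<in> borel_measurable M" by measurable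
  qed
  also have "\<dots> \<le> (LINT x|sphere_measure. (LINT \<omega>|M. (cmod (G \<omega> x))\<^sup>2)) * (LINT x|sphere_measure. (cmod (Yf s l m x))\<^sup>2)"
    by (rule sphere_coeff_bound(2)[OF Gf e])
  finally show ?thesis unfolding G_def .
qed


lemma V_continuous:
  assumes "\<And>n. \<rho> n \<in> chi_range K" "\<rho> \<longlonglongrightarrow> r" "r \<in> chi_range K"
  shows "(\<lambda>n. V (\<rho> n)) \<longlonglongrightarrow> V r"
proof -
  let ?f = "\<lambda>r. frame_value (X r) (mat 1)"
  have 0: "(\<lambda>n. LINT \<omega>|M. (cmod (?f r \<omega> - ?f (\<rho> n) \<omega>))\<^sup>2) \<longlonglongrightarrow> 0"
    using frame_seq[of \<rho> "\<lambda>n. mat 1" r "mat 1"] assms mat_1_SO3 by simp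
  have sq: "square_integrable_rv M (?f r)" if "r \<in> chi_range K" for r
    using that mat_1_SO3 by (rule frame_square_integrable)
  have "(\<lambda>n. LINT \<omega>|M. ?f (\<rho> n) \<omega> * cnj (?f (\<rho> n) \<omega>)) \<longlonglongrightarrow> (LINT \<omega>|M. ?f r \<omega> * cnj (?f r \<omega>))"
    by (rule tendsto_inner_L2[OF sq sq sq sq 0 0]) (use assms in auto)
  then have "(\<lambda>n. complex_of_real (V (\<rho> n))) \<longlonglongrightarrow> of_real (V r)"
    unfolding integral_cmod_square V_def .
  then show ?thesis by (simp only: tendsto_of_real_iff)
qed

text \<open>By \<open>a_diff\<close> it suffices that the mean square difference of the fields,
  integrated over the sphere, tends to zero. It tends to zero at every point, and the variances
  along a convergent sequence of radii are bounded, which provides a constant majorant.\<close>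

lemma a_ms_continuous:
  assumes lm: "s \<le> l" "\<bar>m\<bar> \<le> int l"
  shows "ms_continuous_on M (chi_range K) (a l m)"
  unfolding ms_continuous_on_def
proof (intro conjI ballI)
  show "square_integrable_rv M (a l m r)" if "r \<in> chi_range K" for r
    using that lm by (rule a_square_integrable)
  fix r assume r: "r \<in> chi_range K"
  show "((\<lambda>r'. LINT \<omega>|M. (cmod (a l m r' \<omega> - a l m r \<omega>))\<^sup>2) \<longlongrightarrow> 0) (at r within chi_range K)"
    unfolding tendsto_at_iff_sequentially o_def
  proof (intro allI impI)
    fix \<rho> :: "nat \<Rightarrow> real" assume "\<forall>i. \<rho> i \<in> chi_range K - {r}" and lim: "\<rho> \<longlonglongrightarrow> r"
    then have \<rho>: "\<And>n. \<rho> n \<in> chi_range K" by blast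
    define D where "D n x = (LINT \<omega>|M. (cmod (F (\<rho> n) \<omega> x - F r \<omega> x))\<^sup>2)" for n x
    obtain B where B: "\<And>n. V (\<rho> n) \<le> B"
    proof -
      have "Bseq (\<lambda>n. V (\<rho> n))"
        using V_continuous[OF \<rho> lim r] by (intro convergent_imp_Bseq convergentI)
      then show ?thesis using that by (metis Bseq_def abs_le_iff real_norm_def)
    qed
    have Dm: "D n \<in> borel_measurable sphere_measure" for n
    proof -
      have [measurable]: "case_prod (F r) \<in> borel_measurable (M \<Otimes>\<^sub>M sphere_measure)" if "r \<in> chi_range K" for r
        using F_field[OF that] by (simp add: field_on_sphere_def)
      have "(\<lambda>z. (cmod (F (\<rho> n) (snd z) (fst z) - F r (snd z) (fst z)))\<^sup>2) \<in> borel_measurable (sphere_measure \<Otimes>\<^sub>M M)"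
      proof -
        have sw: "(\<lambda>z. case_prod (F r) (snd z, fst z)) \<in> borel_measurable (sphere_measure \<Otimes>\<^sub>M M)" if "r \<in> chi_range K" for r
          by (rule measurable_compose[OF _ F_field[OF that, unfolded field_on_sphere_def, THEN conjunct1]]) measurable
        note [measurable] = sw[OF \<rho>, simplified] sw[OF r, simplified]
        show ?thesis by measurable
      qed
      then show ?thesis unfolding D_def
        by (intro borel_measurable_lebesgue_integral) (simp add: split_beta')
    qed
    have "(\<lambda>n. LINT x|sphere_measure. D n x) \<longlonglongrightarrow> (LINT x|sphere_measure. 0)"
    proof (rule integral_dominated_convergence[where w = "\<lambda>_. 2 * B + 2 * V r"])
      show "AE x in sphere_measure. (\<lambda>n. D n x) \<longlonglongrightarrow> 0"
        unfolding D_def F_frame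
        using frame_seq[of \<rho> "\<lambda>_. euler _ _ 0" r "euler _ _ 0"] \<rho> lim r euler_SO3
        by (intro AE_I2) (simp add: norm_minus_commute)
      show "AE x in sphere_measure. norm (D n x) \<le> 2 * B + 2 * V r" for n
      proof (rule AE_I2)
        fix x
        have "0 \<le> D n x" by (simp add: D_def)
        then show "norm (D n x) \<le> 2 * B + 2 * V r"
          using F_diff_bound[OF r \<rho>[of n], of x] B[of n] by (simp add: D_def)
      qed
    qed (use Dm in auto)
    then have "(\<lambda>n. (LINT x|sphere_measure. D n x) * (LINT x|sphere_measure. (cmod (Yf s l m x))\<^sup>2)) \<longlonglongrightarrow> 0"
      by (intro tendsto_mult_left_zero) simp
    then show "(\<lambda>n. LINT \<omega>|M. (cmod (a l m (\<rho> n) \<omega> - a l m r \<omega>))\<^sup>2) \<longlonglongrightarrow> 0"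
      by (rule tendsto_sandwich[OF _ _ tendsto_const, rotated 2])
        (intro always_eventually allI, use a_diff[OF r \<rho> lm] in \<open>auto simp: D_def\<close>)
  qed
qed

text \<open>The frame \<open>euler \<phi> \<theta> 0\<close> depends continuously on the
  coordinates, also where \<theta> is \<open>0\<close> or \<open>pi\<close> and the point itself no
  longer depends on \<phi>. So mean-square continuity on \<open>SO3\<close> passes to the coordinate
  rectangle.\<close>

lemma F_inner_continuous:
  assumes r: "r \<in> chi_range K" and Y: "square_integrable_rv M Y"
  shows "continuous_on A (\<lambda>x. LINT \<omega>|M. F r \<omega> x * cnj (Y \<omega>))"
  unfolding continuous_on_sequentially o_def
proof (intro allI ballI impI)
  fix u :: "nat \<Rightarrow> real \<times> real" and x assume "(\<forall>n. u n \<in> A) \<and> u \<longlonglongrightarrow> x"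
  then have u: "u \<longlonglongrightarrow> x" by simp
  have "continuous_on UNIV (\<lambda>x :: real \<times> real. euler (snd x) (fst x) 0)"
    by (intro continuous_on_euler continuous_intros)
  then have "(\<lambda>n. euler (snd (u n)) (fst (u n)) 0) \<longlonglongrightarrow> euler (snd x) (fst x) 0"
    by (rule continuous_on_tendsto_compose[OF _ u]) auto
  then have 0: "(\<lambda>n. LINT \<omega>|M. (cmod (F r \<omega> x - F r \<omega> (u n)))\<^sup>2) \<longlonglongrightarrow> 0"
    unfolding F_frame using r euler_SO3 by (intro frame_seq) auto
  show "(\<lambda>n. LINT \<omega>|M. F r \<omega> (u n) * cnj (Y \<omega>)) \<longlonglongrightarrow> (LINT \<omega>|M. F r \<omega> x * cnj (Y \<omega>))"
    by (rule tendsto_inner_L2[OF F_square_integrable[OF r] F_square_integrable[OF r] Y Y 0]) simp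
qed

lemma F_a_covariance:
  assumes r: "r \<in> chi_range K" and lm: "s \<le> l" "\<bar>m\<bar> \<le> int l" and x: "x \<in> sphere_domain"
  shows "(LINT \<omega>|M. F r \<omega> x * cnj (a l m r \<omega>)) = C l r r * Yf s l m x"
proof -
  define h where "h x = (LINT \<omega>|M. F r \<omega> x * cnj (a l m r \<omega>))" for x
  note sq = a_square_integrable[OF r lm]
  have h: "continuous_on sphere_domain h"
    unfolding h_def by (rule F_inner_continuous[OF r sq])
  note Yc = Yf_continuous[OF lm]
  have "h x - C l r r * Yf s l m x = 0"
  proof (rule sphere_unique[of _ s, OF _ _ x])
    show "continuous_on sphere_domain (\<lambda>x. h x - C l r r * Yf s l m x)"
      by (intro continuous_intros h Yc)
    fix l' m' assume lm': "s \<le> l'" "\<bar>m'\<bar> \<le> int l'"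
    note Yc' = Yf_continuous[OF lm']
    have "(LINT x|sphere_measure. (h x - C l r r * Yf s l m x) * cnj (Yf s l' m' x)) =
        (LINT x|sphere_measure. h x * cnj (Yf s l' m' x)) - (LINT x|sphere_measure. C l r r * (Yf s l m x * cnj (Yf s l' m' x)))"
      unfolding left_diff_distrib mult.assoc
      by (rule Bochner_Integration.integral_diff) (intro integrable_sphere_continuous continuous_intros h Yc Yc')+
    also have "(LINT x|sphere_measure. h x * cnj (Yf s l' m' x)) = (LINT \<omega>|M. a l' m' r \<omega> * cnj (a l m r \<omega>))"
      unfolding h_def a_def[of l' m'] by (rule expectation_sphere_coeff_mult_cnj[OF F_field[OF r] Yc' sq, symmetric])
    also have "(LINT x|sphere_measure. C l r r * (Yf s l m x * cnj (Yf s l' m' x))) = (if l = l' \<and> m = m' then C l r r else 0)"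
      using sY_orthonormal[OF lm lm'] by simp
    finally show "(LINT x|sphere_measure. (h x - C l r r * Yf s l m x) * cnj (Yf s l' m' x)) = 0"
      unfolding a_covariance[OF r r lm' lm] by auto
  qed
  then show ?thesis by (simp add: h_def)
qed

section \<open>Partial sums and their covariances\<close>

definition S :: "nat \<Rightarrow> real \<Rightarrow> 'w \<Rightarrow> real \<times> real \<Rightarrow> complex" where
  "S N r \<omega> x = (\<Sum>l\<in>{s..N}. \<Sum>m\<in>{- int l..int l}. a l m r \<omega> * Yf s l m x)"

text \<open>The reproducing kernel of the harmonics of degree \<open>l\<close>: integration against
  it is the orthogonal projection onto their span.\<close>

definition kernel :: "nat \<Rightarrow> real \<times> real \<Rightarrow> real \<times> real \<Rightarrow> complex" where
  "kernel l x y = (\<Sum>m\<in>{- int l..int l}. Yf s l m x * cnj (Yf s l m y))"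

lemma S_square_integrable:
  assumes "r \<in> chi_range K"
  shows "square_integrable_rv M (\<lambda>\<omega>. S N r \<omega> x)"
  unfolding S_def mult.commute[of "a _ _ _ _"]
  by (intro square_integrable_sum square_integrable_cmult a_square_integrable) (use assms in auto)

lemma inner_S:
  assumes r: "r \<in> chi_range K" and Y: "square_integrable_rv M Y"
  shows "(LINT \<omega>|M. Y \<omega> * cnj (S N r \<omega> x)) =
    (\<Sum>l\<in>{s..N}. \<Sum>m\<in>{- int l..int l}. cnj (Yf s l m x) * (LINT \<omega>|M. Y \<omega> * cnj (a l m r \<omega>)))"
proof -
  have int: "integrable M (\<lambda>\<omega>. cnj (Yf s l m x) * (Y \<omega> * cnj (a l m r \<omega>)))" if "s \<le> l" "\<bar>m\<bar> \<le> int l" for l m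
    using integrable_mult_cnj[OF Y a_square_integrable[OF r that]] by simp
  have "(LINT \<omega>|M. Y \<omega> * cnj (S N r \<omega> x)) =
     (LINT \<omega>|M. (\<Sum>l\<in>{s..N}. \<Sum>m\<in>{- int l..int l}. cnj (Yf s l m x) * (Y \<omega> * cnj (a l m r \<omega>))))"
    unfolding S_def by (simp add: cnj_sum sum_distrib_left mult_ac)
  also have "\<dots> = (\<Sum>l\<in>{s..N}. (LINT \<omega>|M. (\<Sum>m\<in>{- int l..int l}. cnj (Yf s l m x) * (Y \<omega> * cnj (a l m r \<omega>)))))"
    by (rule Bochner_Integration.integral_sum) (intro Bochner_Integration.integrable_sum int; auto)
  also have "\<dots> = (\<Sum>l\<in>{s..N}. \<Sum>m\<in>{- int l..int l}. (LINT \<omega>|M. cnj (Yf s l m x) * (Y \<omega> * cnj (a l m r \<omega>))))"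
    by (intro sum.cong refl Bochner_Integration.integral_sum int) auto
  also have "\<dots> = (\<Sum>l\<in>{s..N}. \<Sum>m\<in>{- int l..int l}. cnj (Yf s l m x) * (LINT \<omega>|M. Y \<omega> * cnj (a l m r \<omega>)))"
    by simp
  finally show ?thesis .
qed

lemma a_S_covariance:
  assumes r: "r1 \<in> chi_range K" "r2 \<in> chi_range K" and lm: "s \<le> l" "\<bar>m\<bar> \<le> int l" "l \<le> N"
  shows "(LINT \<omega>|M. a l m r1 \<omega> * cnj (S N r2 \<omega> x)) = C l r1 r2 * cnj (Yf s l m x)"
proof -
  have "(LINT \<omega>|M. a l m r1 \<omega> * cnj (S N r2 \<omega> x)) =
      (\<Sum>l'\<in>{s..N}. \<Sum>m'\<in>{- int l'..int l'}. cnj (Yf s l' m' x) * (if l = l' \<and> m = m' then C l r1 r2 else 0))"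
    unfolding inner_S[OF r(2) a_square_integrable[OF r(1) lm(1,2)]]
    by (intro sum.cong refl arg_cong[of _ _ "\<lambda>x. _ * x"] a_covariance r lm) auto
  also have "\<dots> = (\<Sum>l'\<in>{s..N}. if l' = l then cnj (Yf s l m x) * C l r1 r2 else 0)"
  proof (intro sum.cong refl)
    fix l'
    have "(\<Sum>m'\<in>{- int l..int l}. cnj (Yf s l m' x) * (if m = m' then C l r1 r2 else 0)) =
        (\<Sum>m'\<in>{- int l..int l}. if m' = m then cnj (Yf s l m x) * C l r1 r2 else 0)"
      by (intro sum.cong) auto
    also have "\<dots> = cnj (Yf s l m x) * C l r1 r2" using lm by (simp add: sum.delta abs_le_iff)
    finally show "(\<Sum>m'\<in>{- int l'..int l'}. cnj (Yf s l' m' x) * (if l = l' \<and> m = m' then C l r1 r2 else 0)) =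
        (if l' = l then cnj (Yf s l m x) * C l r1 r2 else 0)"
      by (cases "l' = l") auto
  qed
  also have "\<dots> = cnj (Yf s l m x) * C l r1 r2"
    using lm by (simp add: sum.delta)
  finally show ?thesis by (simp add: mult.commute)
qed

lemma S_covariance:
  assumes r: "r1 \<in> chi_range K" "r2 \<in> chi_range K"
  shows "(LINT \<omega>|M. S N r1 \<omega> x * cnj (S N r2 \<omega> y)) = (\<Sum>l\<in>{s..N}. C l r1 r2 * kernel l x y)"
proof -
  \<comment> \<open>\<open>inner_S\<close> expands the second argument of an inner product; after
    conjugation it applies to the first one as well.\<close>
  have "cnj (LINT \<omega>|M. S N r1 \<omega> x * cnj (S N r2 \<omega> y)) = (LINT \<omega>|M. S N r2 \<omega> y * cnj (S N r1 \<omega> x))"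
    by (rule cnj_integral_mult_cnj[OF S_square_integrable[OF r(1)] S_square_integrable[OF r(2)]])
  also have "\<dots> = (\<Sum>l\<in>{s..N}. \<Sum>m\<in>{- int l..int l}. cnj (Yf s l m x) * (LINT \<omega>|M. S N r2 \<omega> y * cnj (a l m r1 \<omega>)))"
    by (rule inner_S[OF r(1) S_square_integrable[OF r(2)]])
  also have "\<dots> = (\<Sum>l\<in>{s..N}. \<Sum>m\<in>{- int l..int l}. cnj (Yf s l m x) * cnj (C l r1 r2 * cnj (Yf s l m y)))"
  proof (intro sum.cong refl arg_cong[of _ _ "\<lambda>x. _ * x"])
    fix l m assume "l \<in> {s..N}" "m \<in> {- int l..int l}"
    then have lm: "s \<le> l" "\<bar>m\<bar> \<le> int l" "l \<le> N" by auto
    show "(LINT \<omega>|M. S N r2 \<omega> y * cnj (a l m r1 \<omega>)) = cnj (C l r1 r2 * cnj (Yf s l m y))"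
      unfolding a_S_covariance[OF r lm, symmetric]
      by (rule cnj_integral_mult_cnj[symmetric, OF a_square_integrable[OF r(1) lm(1,2)] S_square_integrable[OF r(2)]])
  qed
  finally have "cnj (cnj (LINT \<omega>|M. S N r1 \<omega> x * cnj (S N r2 \<omega> y))) =
      cnj (\<Sum>l\<in>{s..N}. \<Sum>m\<in>{- int l..int l}. cnj (Yf s l m x) * cnj (C l r1 r2 * cnj (Yf s l m y)))"
    by (rule arg_cong)
  then show ?thesis
    by (simp add: cnj_sum kernel_def sum_distrib_left mult_ac)
qed

lemma F_S_covariance:
  assumes r: "r \<in> chi_range K" and x: "x \<in> sphere_domain"
  shows "(LINT \<omega>|M. F r \<omega> x * cnj (S N r \<omega> y)) = (\<Sum>l\<in>{s..N}. C l r r * kernel l x y)"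
proof -
  have "(LINT \<omega>|M. F r \<omega> x * cnj (S N r \<omega> y)) =
      (\<Sum>l\<in>{s..N}. \<Sum>m\<in>{- int l..int l}. cnj (Yf s l m y) * (C l r r * Yf s l m x))"
    unfolding inner_S[OF r F_square_integrable[OF r]]
    by (intro sum.cong refl arg_cong[of _ _ "\<lambda>x. _ * x"] F_a_covariance r x) auto
  then show ?thesis by (simp add: kernel_def sum_distrib_left mult_ac)
qed

lemma kernel_diagonal: "s \<le> l \<Longrightarrow> kernel l x x = of_real (real (2 * l + 1) / (4 * pi))"
  unfolding kernel_def by (rule sY_square_sum)

lemma kernel_bound: "s \<le> l \<Longrightarrow> cmod (kernel l x y) \<le> real (2 * l + 1) / (4 * pi)"
  unfolding kernel_def by (rule norm_sY_kernel_le)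

definition T :: "nat \<Rightarrow> real \<Rightarrow> real" where
  "T N r = (\<Sum>l\<in>{s..N}. Cr l r * (real (2 * l + 1) / (4 * pi)))"

lemma T_complex: "(\<Sum>l\<in>{s..N}. C l r r * kernel l x x) = of_real (T N r)"
  unfolding T_def of_real_sum by (intro sum.cong refl) (simp add: kernel_diagonal C_Cr)

text \<open>All products involving the partial sum have the value \<open>T N r\<close>, because by
  \<open>F_a_covariance\<close> the field has the same covariances with the coefficients as its
  partial sum; the partial sum behaves like an orthogonal projection.\<close>

lemma F_minus_S:
  assumes r: "r \<in> chi_range K" and x: "x \<in> sphere_domain"
  shows "(LINT \<omega>|M. (cmod (F r \<omega> x - S N r \<omega> x))\<^sup>2) = V r - T N r"
proof -
  let ?f = "\<lambda>\<omega>. F r \<omega> x" and ?g = "\<lambda>\<omega>. S N r \<omega> x"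
  have f: "square_integrable_rv M ?f" and g: "square_integrable_rv M ?g"
    using r by (rule F_square_integrable, rule S_square_integrable)
  have fg: "(LINT \<omega>|M. ?f \<omega> * cnj (?g \<omega>)) = of_real (T N r)"
    unfolding F_S_covariance[OF r x] T_complex ..
  have gf: "(LINT \<omega>|M. ?g \<omega> * cnj (?f \<omega>)) = of_real (T N r)"
    unfolding cnj_integral_mult_cnj[OF f g, symmetric] fg by simp
  have gg: "(LINT \<omega>|M. ?g \<omega> * cnj (?g \<omega>)) = of_real (T N r)"
    unfolding S_covariance[OF r r] T_complex ..
  have ff: "(LINT \<omega>|M. ?f \<omega> * cnj (?f \<omega>)) = of_real (V r)"
    unfolding integral_cmod_square F_variance[OF r] ..
  have "complex_of_real (LINT \<omega>|M. (cmod (F r \<omega> x - S N r \<omega> x))\<^sup>2) = (LINT \<omega>|M. (?f \<omega> - ?g \<omega>) * cnj (?f \<omega> - ?g \<omega>))"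
    by (rule integral_cmod_square[symmetric])
  also have "\<dots> = (LINT \<omega>|M. (?f \<omega> * cnj (?f \<omega>) - ?f \<omega> * cnj (?g \<omega>)) - (?g \<omega> * cnj (?f \<omega>) - ?g \<omega> * cnj (?g \<omega>)))"
    by (simp add: algebra_simps)
  also have "\<dots> = of_real (V r - T N r)"
    using integrable_mult_cnj[OF f f] integrable_mult_cnj[OF f g] integrable_mult_cnj[OF g f] integrable_mult_cnj[OF g g]
    by (simp add: ff fg gf gg)
  finally show ?thesis by (simp only: of_real_eq_iff)
qed

text \<open>The extension by zero below the spin lets the series run over all natural numbers, so
  that the tests for ordinary series apply.\<close>

definition majorant :: "nat \<Rightarrow> real \<Rightarrow> real" where
  "majorant l r = (if s \<le> l then Cr l r * (real (2 * l + 1) / (4 * pi)) else 0)"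

lemma majorant_nonneg: "0 \<le> majorant l r"
  by (simp add: majorant_def Cr_nonneg)

lemma T_eq: "T N r = (\<Sum>l<Suc N. majorant l r)"
  unfolding T_def majorant_def by (rule sum_from_eq_sum_lessThan)

text \<open>Bessel's inequality: the mean square error \<open>V r - T n r\<close> is
  nonnegative.\<close>

lemma majorant_summable:
  assumes "r \<in> chi_range K"
  shows "summable (\<lambda>l. majorant l r)"
proof (rule bounded_imp_summable[of _ "V r"])
  have x: "(0, 0) \<in> sphere_domain" by (simp add: sphere_domain_def)
  show "(\<Sum>l\<le>n. majorant l r) \<le> V r" for n
  proof -
    have "0 \<le> (LINT \<omega>|M. (cmod (F r \<omega> (0, 0) - S n r \<omega> (0, 0)))\<^sup>2)" by simp
    then show ?thesis unfolding F_minus_S[OF assms x] T_eq lessThan_Suc_atMost by simp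
  qed
qed (rule majorant_nonneg)

end

section \<open>Convergence of the expansion\<close>

lemma sY_phase_invariant:
  "sY s l m \<theta> \<phi> * cnj (sY s l' m \<theta> \<phi>) = sY s l m \<theta> 0 * cnj (sY s l' m \<theta> 0)"
proof -
  have "cis (of_int m * \<phi>) * cnj (cis (of_int m * \<phi>)) = 1"
    by (simp add: cis_cnj cis_mult)
  then have "(cis (of_int m * \<phi>) * A) * cnj (cis (of_int m * \<phi>) * B) = A * cnj B" for A B
    by (metis (no_types, lifting) complex_cnj_mult mult.assoc mult.left_commute mult.left_neutral)
  then show ?thesis unfolding sY_def by (simp only: cis_zero mult_zero_right mult_1_left)
qed

text \<open>For equal \<open>m\<close> the phases cancel and the integral over \<phi> contributes
  the factor \<open>2 pi\<close>; this is where \<open>1 / (2 pi)\<close> in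
  \<open>inversion\<close> comes from.\<close>

lemma sY_polar_orthonormal:
  assumes "s \<le> l" "s \<le> l'" "\<bar>m\<bar> \<le> int l" "\<bar>m\<bar> \<le> int l'"
  shows "integral {0..pi} (\<lambda>\<beta>. sY (int s) l m \<beta> 0 * cnj (sY (int s) l' m \<beta> 0) * of_real (sin \<beta>)) =
    (if l = l' then of_real (1 / (2 * pi)) else 0)"
proof -
  have "(if l = l' then 1 else 0) = (LINT x|sphere_measure. Yf s l m x * cnj (Yf s l' m x))"
    using sY_orthonormal[of s l m l' m] assms by simp
  also have "\<dots> = integral {0..pi} (\<lambda>\<theta>. sin \<theta> *\<^sub>R integral {0..2 * pi} (\<lambda>\<phi>. sY (int s) l m \<theta> \<phi> * cnj (sY (int s) l' m \<theta> \<phi>)))"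
    by (subst integral_sphere_continuous) (auto intro!: continuous_intros sY_continuous assms)
  also have "\<dots> = integral {0..pi} (\<lambda>\<beta>. of_real (2 * pi) * (sY (int s) l m \<beta> 0 * cnj (sY (int s) l' m \<beta> 0) * of_real (sin \<beta>)))"
  proof (intro integral_cong)
    fix \<theta>
    have "integral {0..2 * pi} (\<lambda>\<phi>. sY (int s) l m \<theta> \<phi> * cnj (sY (int s) l' m \<theta> \<phi>)) =
        integral {0..2 * pi} (\<lambda>\<phi>. sY (int s) l m \<theta> 0 * cnj (sY (int s) l' m \<theta> 0))"
      by (intro integral_cong sY_phase_invariant)
    then show "sin \<theta> *\<^sub>R integral {0..2 * pi} (\<lambda>\<phi>. sY (int s) l m \<theta> \<phi> * cnj (sY (int s) l' m \<theta> \<phi>)) =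
        of_real (2 * pi) * (sY (int s) l m \<theta> 0 * cnj (sY (int s) l' m \<theta> 0) * of_real (sin \<theta>))"
      by (simp add: scaleR_conv_of_real mult_ac)
  qed
  also have "\<dots> = of_real (2 * pi) * integral {0..pi} (\<lambda>\<beta>. sY (int s) l m \<beta> 0 * cnj (sY (int s) l' m \<beta> 0) * of_real (sin \<beta>))"
    by (rule integral_mult_right)
  finally show ?thesis by (auto simp: field_simps)
qed

text \<open>The relative rotation is the one by \<open>- \<beta>\<close> about the second axis;
  conjugation with \<open>Rz pi\<close> makes the middle angle nonnegative. As
  \<open>pi + (- pi) = 0\<close>, the spin phase is trivial.\<close>

lemma relative_euler_angles_meridian: "\<beta> \<in> {0..pi} \<Longrightarrow> relative_euler_angles 0 0 \<beta> 0 pi \<beta> (- pi)"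
  unfolding relative_euler_angles_def vec_eq_iff forall_3
  by (simp add: euler_entries matrix_matrix_mult_def sum_3 transpose_def)

lemma sqrt_spin_factor: "sqrt (real (2 * l + 1) / (4 * pi)) = sqrt (real (2 * l + 1)) / (2 * sqrt pi)"
  by (simp add: real_sqrt_divide real_sqrt_mult)

context spin_field
begin

lemma kernel_continuous:
  assumes "s \<le> l"
  shows "continuous_on sphere_domain (\<lambda>y. kernel l y x)"
  unfolding kernel_def by (intro continuous_intros Yf_continuous assms) auto

lemma integral_kernel:
  assumes "s \<le> l" "s \<le> l'" "\<bar>m'\<bar> \<le> int l'"
  shows "(LINT y|sphere_measure. kernel l y x * cnj (Yf s l' m' y)) = (if l = l' then cnj (Yf s l' m' x) else 0)"
proof -
  have "(LINT y|sphere_measure. kernel l y x * cnj (Yf s l' m' y)) =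
      (LINT y|sphere_measure. (\<Sum>m\<in>{- int l..int l}. cnj (Yf s l m x) * (Yf s l m y * cnj (Yf s l' m' y))))"
    unfolding kernel_def sum_distrib_right by (simp add: mult_ac)
  also have "\<dots> = (\<Sum>m\<in>{- int l..int l}. (LINT y|sphere_measure. cnj (Yf s l m x) * (Yf s l m y * cnj (Yf s l' m' y))))"
    by (rule Bochner_Integration.integral_sum)
      (intro integrable_sphere_continuous continuous_intros Yf_continuous; use assms in auto)
  also have "\<dots> = (\<Sum>m\<in>{- int l..int l}. if m = m' then (if l = l' then cnj (Yf s l' m' x) else 0) else 0)"
    using sY_orthonormal[of s l _ l' m'] assms by (intro sum.cong refl) auto
  also have "\<dots> = (if l = l' then cnj (Yf s l' m' x) else 0)"
    using assms by (auto simp: sum.delta)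
  finally show ?thesis .
qed

definition summand :: "nat \<Rightarrow> real \<Rightarrow> real \<Rightarrow> real \<times> real \<Rightarrow> real \<times> real \<Rightarrow> complex" where
  "summand l r1 r2 x y = (if s \<le> l then C l r1 r2 * kernel l x y else 0)"

lemma summand_bound:
  assumes "r1 \<in> chi_range K" "r2 \<in> chi_range K"
  shows "cmod (summand l r1 r2 x y) \<le> majorant l r1 + majorant l r2"
proof (cases "s \<le> l")
  case True
  have "cmod (C l r1 r2) * cmod (kernel l x y) \<le> (Cr l r1 + Cr l r2) * (real (2 * l + 1) / (4 * pi))"
    by (intro mult_mono C_bound[OF assms True] kernel_bound[OF True] add_nonneg_nonneg Cr_nonneg norm_ge_zero)
  then have "cmod (summand l r1 r2 x y) \<le> (Cr l r1 + Cr l r2) * (real (2 * l + 1) / (4 * pi))"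
    using True by (simp add: summand_def norm_mult)
  then show ?thesis by (simp only: majorant_def True if_True distrib_right)
qed (simp add: summand_def majorant_def)

lemma summand_bound_diagonal: "cmod (summand l r r x y) \<le> majorant l r"
proof (cases "s \<le> l")
  case True
  have "Cr l r * cmod (kernel l x y) \<le> Cr l r * (real (2 * l + 1) / (4 * pi))"
    by (rule mult_left_mono[OF kernel_bound[OF True] Cr_nonneg])
  then show ?thesis
    using True Cr_nonneg[of l r] by (simp add: summand_def majorant_def norm_mult C_Cr)
qed (simp add: summand_def majorant_def)

lemma sum_summand: "(\<Sum>l<Suc N. summand l r1 r2 x y) = (\<Sum>l\<in>{s..N}. C l r1 r2 * kernel l x y)"
  unfolding summand_def by (rule sum_from_eq_sum_lessThan[symmetric])

lemma summand_continuous: "continuous_on sphere_domain (\<lambda>y. summand l r1 r2 y x)"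
  unfolding summand_def by (cases "s \<le> l") (auto intro!: continuous_intros kernel_continuous)

text \<open>An analogue of Mercer's theorem. The majorant makes the series converge uniformly, so
  its sum is continuous and its harmonic coefficients may be computed term by term with
  \<open>integral_kernel\<close>.\<close>

lemma covariance_series:
  assumes r: "r \<in> chi_range K" and x: "x \<in> sphere_domain" and z: "z \<in> sphere_domain"
  shows "(LINT \<omega>|M. F r \<omega> z * cnj (F r \<omega> x)) = (\<Sum>l. summand l r r z x)"
proof -
  define G where "G y = (\<Sum>l. summand l r r y x)" for y
  define H where "H y = (LINT \<omega>|M. F r \<omega> y * cnj (F r \<omega> x))" for y
  have H: "continuous_on sphere_domain H"
    unfolding H_def by (rule F_inner_continuous[OF r F_square_integrable[OF r]])
  have U: "uniform_limit sphere_domain (\<lambda>n y. \<Sum>l<n. summand l r r y x) G sequentially"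
    unfolding G_def by (rule Weierstrass_m_test[OF _ majorant_summable[OF r]]) (rule summand_bound_diagonal)
  have G: "continuous_on sphere_domain G"
    by (rule uniform_limit_theorem[OF _ U]) (auto intro!: always_eventually continuous_intros summand_continuous)
  have "H z - G z = 0"
  proof (rule sphere_unique[of _ s, OF _ _ z])
    show "continuous_on sphere_domain (\<lambda>y. H y - G y)" by (intro continuous_intros H G)
    fix l m assume lm: "s \<le> l" "\<bar>m\<bar> \<le> int l"
    note Yc = Yf_continuous[OF lm]
    have HY: "(LINT y|sphere_measure. H y * cnj (Yf s l m y)) = C l r r * cnj (Yf s l m x)"
    proof -
      have "(LINT y|sphere_measure. H y * cnj (Yf s l m y)) = (LINT \<omega>|M. a l m r \<omega> * cnj (F r \<omega> x))"
        unfolding H_def a_def by (rule expectation_sphere_coeff_mult_cnj[OF F_field[OF r] Yc F_square_integrable[OF r], symmetric])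
      also have "\<dots> = cnj (C l r r * Yf s l m x)"
        unfolding F_a_covariance[OF r lm x, symmetric]
        by (rule cnj_integral_mult_cnj[symmetric, OF F_square_integrable[OF r] a_square_integrable[OF r lm]])
      finally show ?thesis by (simp add: C_Cr)
    qed
    have "(\<lambda>n. LINT y|sphere_measure. (\<Sum>l<n. summand l r r y x) * cnj (Yf s l m y)) \<longlonglongrightarrow> (LINT y|sphere_measure. G y * cnj (Yf s l m y))"
    proof (rule integral_dominated_convergence[where w = "\<lambda>_. (\<Sum>l. majorant l r) * sqrt (real (2 * l + 1) / (4 * pi))"])
      show "(\<lambda>y. G y * cnj (Yf s l m y)) \<in> borel_measurable sphere_measure"
        by (intro measurable_sphere_continuous continuous_intros G Yc)
      show "(\<lambda>y. (\<Sum>l<n. summand l r r y x) * cnj (Yf s l m y)) \<in> borel_measurable sphere_measure" for n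
        by (intro measurable_sphere_continuous continuous_intros summand_continuous Yc)
      show "AE y in sphere_measure. (\<lambda>n. (\<Sum>l<n. summand l r r y x) * cnj (Yf s l m y)) \<longlonglongrightarrow> G y * cnj (Yf s l m y)"
        using tendsto_uniform_limitI[OF U] by (intro AE_I2 tendsto_intros) simp
      show "AE y in sphere_measure. norm ((\<Sum>l<n. summand l r r y x) * cnj (Yf s l m y)) \<le> (\<Sum>l. majorant l r) * sqrt (real (2 * l + 1) / (4 * pi))" for n
      proof (rule AE_I2)
        fix y
        have "cmod (\<Sum>l<n. summand l r r y x) \<le> (\<Sum>l<n. majorant l r)"
          by (rule order_trans[OF norm_sum sum_mono]) (rule summand_bound_diagonal)
        also have "\<dots> \<le> (\<Sum>l. majorant l r)"
          by (intro sum_le_suminf majorant_summable r majorant_nonneg) auto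
        finally show "norm ((\<Sum>l<n. summand l r r y x) * cnj (Yf s l m y)) \<le> (\<Sum>l. majorant l r) * sqrt (real (2 * l + 1) / (4 * pi))"
          unfolding norm_mult complex_mod_cnj using Yf_bound[OF lm, of y]
          by (intro mult_mono suminf_nonneg majorant_summable r majorant_nonneg) auto
      qed
    qed simp
    moreover have "\<forall>\<^sub>F n in sequentially. (LINT y|sphere_measure. (\<Sum>l<n. summand l r r y x) * cnj (Yf s l m y)) = C l r r * cnj (Yf s l m x)"
    \<comment> \<open>As soon as \<open>n > l\<close>, exactly the term of degree \<open>l\<close>
      contributes, so the sequence is constant from there on.\<close>
    proof (rule eventually_sequentiallyI[of "Suc l"])
      fix n assume n: "Suc l \<le> n"
      have "(LINT y|sphere_measure. (\<Sum>l<n. summand l r r y x) * cnj (Yf s l m y)) =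
          (\<Sum>j<n. LINT y|sphere_measure. summand j r r y x * cnj (Yf s l m y))"
        unfolding sum_distrib_right
        by (rule Bochner_Integration.integral_sum) (intro integrable_sphere_continuous continuous_intros summand_continuous Yc)
      also have "\<dots> = (\<Sum>j<n. if j = l then C l r r * cnj (Yf s l m x) else 0)"
      proof (intro sum.cong refl)
        fix j
        show "(LINT y|sphere_measure. summand j r r y x * cnj (Yf s l m y)) = (if j = l then C l r r * cnj (Yf s l m x) else 0)"
          using integral_kernel[of j l m x] lm by (cases "s \<le> j") (auto simp: summand_def mult.assoc)
      qed
      also have "\<dots> = C l r r * cnj (Yf s l m x)" using n by (simp add: sum.delta)
      finally show "(LINT y|sphere_measure. (\<Sum>l<n. summand l r r y x) * cnj (Yf s l m y)) = C l r r * cnj (Yf s l m x)" .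
    qed
    then have "(\<lambda>n. LINT y|sphere_measure. (\<Sum>l<n. summand l r r y x) * cnj (Yf s l m y)) \<longlonglongrightarrow> C l r r * cnj (Yf s l m x)"
      by (rule tendsto_eventually)
    ultimately have GY: "(LINT y|sphere_measure. G y * cnj (Yf s l m y)) = C l r r * cnj (Yf s l m x)"
      by (rule LIMSEQ_unique)
    have "(LINT y|sphere_measure. (H y - G y) * cnj (Yf s l m y)) =
        (LINT y|sphere_measure. H y * cnj (Yf s l m y)) - (LINT y|sphere_measure. G y * cnj (Yf s l m y))"
      unfolding left_diff_distrib
      by (rule Bochner_Integration.integral_diff) (intro integrable_sphere_continuous continuous_intros H G Yc)+
    then show "(LINT y|sphere_measure. (H y - G y) * cnj (Yf s l m y)) = 0"
      by (simp add: HY GY)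
  qed
  then show ?thesis by (simp add: H_def G_def)
qed

text \<open>At two equal points \<open>covariance_series\<close> has the variance on the left and
  the series of majorants on the right.\<close>

lemma T_tendsto:
  assumes r: "r \<in> chi_range K"
  shows "(\<lambda>N. T N r) \<longlonglongrightarrow> V r"
proof -
  have x: "(0, 0) \<in> sphere_domain" by (simp add: sphere_domain_def)
  have t: "summand l r r (0, 0) (0, 0) = of_real (majorant l r)" for l
    by (simp add: summand_def majorant_def kernel_diagonal C_Cr)
  have "complex_of_real (V r) = (\<Sum>l. of_real (majorant l r))"
    using covariance_series[OF r x x] unfolding integral_cmod_square F_variance[OF r] t .
  also have "\<dots> = of_real (\<Sum>l. majorant l r)"
    by (rule suminf_of_real[OF majorant_summable[OF r], symmetric])
  finally have "V r = (\<Sum>l. majorant l r)" by (simp only: of_real_eq_iff)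
  then have "(\<lambda>l. majorant l r) sums V r" using summable_sums[OF majorant_summable[OF r]] by simp
  then show ?thesis unfolding T_eq sums_def by (rule LIMSEQ_Suc)
qed

lemma F_expansion:
  assumes r: "r \<in> chi_range K" and x: "x \<in> sphere_domain"
  shows "(\<lambda>N. LINT \<omega>|M. (cmod (F r \<omega> x - S N r \<omega> x))\<^sup>2) \<longlonglongrightarrow> 0"
  unfolding F_minus_S[OF r x] using tendsto_diff[OF tendsto_const T_tendsto[OF r], of "V r"] by simp

lemma covariance_sums:
  assumes r: "r1 \<in> chi_range K" "r2 \<in> chi_range K" and x: "x \<in> sphere_domain" "y \<in> sphere_domain"
  shows "(\<lambda>l. summand l r1 r2 x y) sums (LINT \<omega>|M. F r1 \<omega> x * cnj (F r2 \<omega> y))"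
proof -
  have "(\<lambda>N. LINT \<omega>|M. S N r1 \<omega> x * cnj (S N r2 \<omega> y)) \<longlonglongrightarrow> (LINT \<omega>|M. F r1 \<omega> x * cnj (F r2 \<omega> y))"
    by (rule tendsto_inner_L2[OF S_square_integrable[OF r(1)] F_square_integrable[OF r(1)]
          S_square_integrable[OF r(2)] F_square_integrable[OF r(2)] F_expansion[OF r(1) x(1)] F_expansion[OF r(2) x(2)]])
  then have "(\<lambda>N. \<Sum>l<Suc N. summand l r1 r2 x y) \<longlonglongrightarrow> (LINT \<omega>|M. F r1 \<omega> x * cnj (F r2 \<omega> y))"
    unfolding S_covariance[OF r] sum_summand .
  then show ?thesis unfolding sums_def by (rule LIMSEQ_imp_Suc)
qed

text \<open>\<open>has_sum\<close> means unconditional convergence, more than the limit of partial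
  sums in \<open>covariance_sums\<close>. It follows from absolute convergence, which the sum of the
  two majorants guarantees even for different radii.\<close>

lemma covariance_has_sum:
  assumes r: "r1 \<in> chi_range K" "r2 \<in> chi_range K" and x: "x \<in> sphere_domain" "y \<in> sphere_domain"
  shows "((\<lambda>l. C l r1 r2 * kernel l x y) has_sum (LINT \<omega>|M. F r1 \<omega> x * cnj (F r2 \<omega> y))) {s..}"
proof -
  have "summable (\<lambda>l. majorant l r1 + majorant l r2)" by (intro summable_add majorant_summable r)
  then have "summable (\<lambda>l. norm (summand l r1 r2 x y))"
    by (rule summable_comparison_test'[of _ 0]) (use summand_bound[OF r] in simp)
  then have "((\<lambda>l. summand l r1 r2 x y) has_sum (LINT \<omega>|M. F r1 \<omega> x * cnj (F r2 \<omega> y))) UNIV"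
    by (rule norm_summable_imp_has_sum[OF _ covariance_sums[OF r x]])
  then show ?thesis
    by (rule has_sum_cong_neutral[THEN iffD1, rotated -1]) (auto simp: summand_def)
qed

lemma kernel_relative_euler:
  assumes "s \<le> l" "relative_euler_angles \<theta>1 \<phi>1 \<theta>2 \<phi>2 \<alpha> \<beta> \<gamma>"
  shows "kernel l (\<theta>1, \<phi>1) (\<theta>2, \<phi>2) = of_real (sqrt (real (2 * l + 1)) / (2 * sqrt pi)) *
    (sY (int s) l (- int s) \<beta> 0 * cis (- (of_nat s * (\<alpha> + \<gamma>))))"
  unfolding kernel_def fst_conv snd_conv sY_addition[OF assms] sqrt_spin_factor ..

text \<open>Along the meridian the spin phase is trivial and the series for the correlation
  converges uniformly in \<beta>, so it may be integrated term by term; polar orthonormality leaves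
  only the term of degree \<open>L\<close>.\<close>

lemma inversion:
  assumes r: "r1 \<in> chi_range K" "r2 \<in> chi_range K" and L: "s \<le> L"
  shows "((\<lambda>\<beta>. correlation M X r1 0 0 r2 \<beta> 0 * cnj (sY (int s) L (- int s) \<beta> 0) * of_real (sin \<beta>))
    has_integral C L r1 r2 * of_real (sqrt (real (2 * L + 1)) / (2 * sqrt pi) / (2 * pi))) {0..pi}"
proof -
  define Y where "Y l \<beta> = sY (int s) l (- int s) \<beta> 0" for l \<beta>
  define q where "q l = sqrt (real (2 * l + 1)) / (2 * sqrt pi)" for l :: nat
  define u where "u l \<beta> = summand l r1 r2 (0, 0) (\<beta>, 0) * cnj (Y L \<beta>) * of_real (sin \<beta>)" for l \<beta>
  define D where "D = sqrt (real (2 * L + 1) / (4 * pi))"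
  have ms: "\<bar>- int s\<bar> \<le> int L" using L by simp
  have Yc: "continuous_on {0..pi} (Y l)" if "s \<le> l" for l
  proof -
    have "continuous_on UNIV (Yf s l (- int s))"
      using that by (intro sY_continuous) auto
    then have "continuous_on {0..pi} (\<lambda>\<beta>. Yf s l (- int s) (\<beta>, 0))"
      by (rule continuous_on_compose2) (auto intro!: continuous_intros)
    then show ?thesis by (simp add: Y_def[abs_def])
  qed
  have ter: "summand l r1 r2 (0, 0) (\<beta>, 0) = C l r1 r2 * of_real (q l) * Y l \<beta>" if "s \<le> l" "\<beta> \<in> {0..pi}" for l \<beta>
    using kernel_relative_euler[OF that(1) relative_euler_angles_meridian[OF that(2)]] that
    by (simp add: summand_def Y_def q_def)
  have u_eq: "u l \<beta> = C l r1 r2 * of_real (q l) * (Y l \<beta> * cnj (Y L \<beta>) * of_real (sin \<beta>))" if "s \<le> l" "\<beta> \<in> {0..pi}" for l \<beta>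
    unfolding u_def ter[OF that] by (simp add: mult_ac)
  have u0: "u l \<beta> = 0" if "\<not> s \<le> l" for l \<beta> using that by (simp add: u_def summand_def)
  have uc: "continuous_on {0..pi} (u l)" for l
  proof (cases "s \<le> l")
    case True
    then show ?thesis
      using Yc[OF True] Yc[OF L] by (subst continuous_on_cong[OF refl u_eq[OF True]]) (auto intro!: continuous_intros)
  next
    case False
    then show ?thesis using u0[OF False] by (simp add: fun_eq_iff[of "u l"])
  qed
  have ui: "integral {0..pi} (u l) = (if l = L then C L r1 r2 * of_real (q L / (2 * pi)) else 0)" for l
  proof (cases "s \<le> l")
    case True
    have "integral {0..pi} (u l) = integral {0..pi} (\<lambda>\<beta>. C l r1 r2 * of_real (q l) * (Y l \<beta> * cnj (Y L \<beta>) * of_real (sin \<beta>)))"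
      by (intro integral_cong u_eq True)
    also have "\<dots> = C l r1 r2 * of_real (q l) * (if l = L then of_real (1 / (2 * pi)) else 0)"
      using sY_polar_orthonormal[of s l L "- int s"] True L by (simp add: Y_def)
    finally show ?thesis by auto
  next
    case False
    then have "u l = (\<lambda>_. 0)" using u0[OF False] by (intro ext)
    then show ?thesis using L False by auto
  qed
  have ub: "cmod (u l \<beta>) \<le> (majorant l r1 + majorant l r2) * D" for l \<beta>
  proof -
    have "cmod (Y L \<beta>) \<le> D" using Yf_bound[OF L ms, of "(\<beta>, 0)"] by (simp add: Y_def D_def)
    moreover have "cmod (Y L \<beta>) * \<bar>sin \<beta>\<bar> \<le> cmod (Y L \<beta>) * 1"
      by (intro mult_left_mono) auto
    ultimately have "cmod (Y L \<beta>) * \<bar>sin \<beta>\<bar> \<le> D" by simp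
    then have "cmod (summand l r1 r2 (0, 0) (\<beta>, 0)) * (cmod (Y L \<beta>) * \<bar>sin \<beta>\<bar>) \<le> (majorant l r1 + majorant l r2) * D"
      by (intro mult_mono summand_bound[OF r]) (auto simp: majorant_nonneg)
    then show ?thesis by (simp add: u_def norm_mult mult.assoc)
  qed
  have "uniform_limit {0..pi} (\<lambda>n \<beta>. \<Sum>l<n. u l \<beta>) (\<lambda>\<beta>. \<Sum>l. u l \<beta>) sequentially"
    by (rule Weierstrass_m_test[OF ub]) (intro summable_mult2 summable_add majorant_summable r)
  then obtain I J where I: "\<And>n. ((\<lambda>\<beta>. \<Sum>l<n. u l \<beta>) has_integral I n) {0..pi}"
    and J: "((\<lambda>\<beta>. \<Sum>l. u l \<beta>) has_integral J) {0..pi}" and IJ: "(I \<longlongrightarrow> J) sequentially"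
    by (rule uniform_limit_integral) (auto intro!: continuous_intros uc)
  have "I n = C L r1 r2 * of_real (q L / (2 * pi))" if "Suc L \<le> n" for n
  proof -
    have "((\<lambda>\<beta>. \<Sum>l<n. u l \<beta>) has_integral (\<Sum>l<n. integral {0..pi} (u l))) {0..pi}"
      by (intro has_integral_sum integrable_integral integrable_continuous_real uc) auto
    then have "I n = (\<Sum>l<n. integral {0..pi} (u l))" using I has_integral_unique by blast
    also have "\<dots> = C L r1 r2 * of_real (q L / (2 * pi))"
      unfolding ui using that by (simp add: sum.delta)
    finally show ?thesis .
  qed
  then have "I \<longlonglongrightarrow> C L r1 r2 * of_real (q L / (2 * pi))"
    by (intro tendsto_eventually eventually_sequentiallyI[of "Suc L"])
  then have "J = C L r1 r2 * of_real (q L / (2 * pi))" using IJ LIMSEQ_unique by blast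
  moreover have "(\<Sum>l. u l \<beta>) = correlation M X r1 0 0 r2 \<beta> 0 * cnj (Y L \<beta>) * of_real (sin \<beta>)" if "\<beta> \<in> {0..pi}" for \<beta>
  proof -
    have "(0, 0) \<in> sphere_domain" "(\<beta>, 0) \<in> sphere_domain" using that by (auto simp: sphere_domain_def)
    from covariance_sums[OF r this] have "(\<lambda>l. summand l r1 r2 (0, 0) (\<beta>, 0)) sums correlation M X r1 0 0 r2 \<beta> 0"
      by (simp add: correlation_def F_def)
    then have "(\<lambda>l. u l \<beta>) sums (correlation M X r1 0 0 r2 \<beta> 0 * cnj (Y L \<beta>) * of_real (sin \<beta>))"
      unfolding u_def by (intro sums_mult2)
    then show ?thesis by (rule sums_unique[symmetric])
  qed
  ultimately show ?thesis
    using J unfolding Y_def q_def by (subst has_integral_cong[symmetric]) auto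
qed

end

theorem theorem2:
  fixes M :: "'w measure"
    and K :: real
    and \<psi> :: "real^4 \<Rightarrow> 'w \<Rightarrow> real"
    and k :: field_kind
    and X :: "real \<Rightarrow> real^3 \<Rightarrow> 'w \<Rightarrow> bundle_point set"
  assumes "prob_space M"
    and "invariant_random_field M K \<psi>"
    and "spin_cosmological_field M K k \<psi> X"
  shows "\<exists>(a :: nat \<Rightarrow> int \<Rightarrow> real \<Rightarrow> 'w \<Rightarrow> complex) (C :: nat \<Rightarrow> real \<Rightarrow> real \<Rightarrow> complex).
    \<comment> \<open>mean-square continuous coefficient processes\<close>
    (\<forall>l m. spin k \<le> l \<and> \<bar>m\<bar> \<le> int l \<longrightarrow> ms_continuous_on M (chi_range K) (a l m)) \<and>
    \<comment> \<open>spectral expansion, in mean square\<close>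
    (\<forall>r\<in>chi_range K. \<forall>\<theta>\<in>{0..pi}. \<forall>\<phi>.
       (\<lambda>N. LINT \<omega>|M. (cmod (field_value X r \<theta> \<phi> \<omega> -
          (\<Sum>l\<in>{spin k..N}. \<Sum>m\<in>{- int l..int l}.
             a l m r \<omega> * sY (int (spin k)) l m \<theta> \<phi>)))\<^sup>2) \<longlonglongrightarrow> 0) \<and>
    \<comment> \<open>the processes are uncorrelated, with the stated correlations\<close>
    (\<forall>l m l' m'. \<forall>r1\<in>chi_range K. \<forall>r2\<in>chi_range K.
       spin k \<le> l \<and> \<bar>m\<bar> \<le> int l \<and> spin k \<le> l' \<and> \<bar>m'\<bar> \<le> int l' \<and> (l, m) \<noteq> (l', m') \<longrightarrow>
       (LINT \<omega>|M. a l m r1 \<omega> * cnj (a l' m' r2 \<omega>)) -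
       (LINT \<omega>|M. a l m r1 \<omega>) * cnj (LINT \<omega>|M. a l' m' r2 \<omega>) = 0) \<and>
    (\<forall>l m l' m'. \<forall>r1\<in>chi_range K. \<forall>r2\<in>chi_range K.
       spin k \<le> l \<and> \<bar>m\<bar> \<le> int l \<and> spin k \<le> l' \<and> \<bar>m'\<bar> \<le> int l' \<longrightarrow>
       (LINT \<omega>|M. a l m r1 \<omega> * cnj (a l' m' r2 \<omega>)) =
         (if l = l' \<and> m = m' then C l r1 r2 else 0)) \<and>
    \<comment> \<open>properties of the kernels\<close>
    (\<forall>l\<ge>spin k. nonnegative_definite (chi_range K) (C l)) \<and>
    (\<forall>r\<in>chi_range K. (\<lambda>l. of_nat (2 * l + 1) * C l r r) summable_on {spin k..}) \<and>
    (\<forall>l\<ge>spin k. l \<noteq> 0 \<longrightarrow> (\<forall>r\<in>chi_range K. C l 0 r = 0)) \<and>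
    \<comment> \<open>the correlation function\<close>
    (\<forall>r1\<in>chi_range K. \<forall>r2\<in>chi_range K. \<forall>\<theta>1\<in>{0..pi}. \<forall>\<theta>2\<in>{0..pi}. \<forall>\<phi>1 \<phi>2 \<alpha> \<beta> \<gamma>.
       relative_euler_angles \<theta>1 \<phi>1 \<theta>2 \<phi>2 \<alpha> \<beta> \<gamma> \<longrightarrow>
       ((\<lambda>l. of_real (1 / (2 * sqrt pi)) * (C l r1 r2 * of_real (sqrt (real (2 * l + 1))) *
              sY (int (spin k)) l (- int (spin k)) \<beta> 0 *
              exp (- \<i> * of_nat (spin k) * of_real (\<alpha> + \<gamma>))))
         has_sum correlation M X r1 \<theta>1 \<phi>1 r2 \<theta>2 \<phi>2) {spin k..}) \<and>
    \<comment> \<open>the inversion formula\<close>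
    (\<forall>l\<ge>spin k. \<forall>r1\<in>chi_range K. \<forall>r2\<in>chi_range K.
       (\<lambda>\<beta>. correlation M X r1 0 0 r2 \<beta> 0 *
          cnj (sY (int (spin k)) l (- int (spin k)) \<beta> 0) * of_real (sin \<beta>))
         integrable_on {0..pi} \<and>
       C l r1 r2 = of_real (4 * pi powr (3 / 2) / sqrt (real (2 * l + 1))) *
         integral {0..pi} (\<lambda>\<beta>. correlation M X r1 0 0 r2 \<beta> 0 *
           cnj (sY (int (spin k)) l (- int (spin k)) \<beta> 0) * of_real (sin \<beta>)))"
proof -
  interpret prob_space M by fact
  interpret spin_field M K \<psi> k X
    by unfold_locales fact+
  have lims: "(\<lambda>N. LINT \<omega>|M. (cmod (field_value X r \<theta> \<phi> \<omega> -
          (\<Sum>l\<in>{spin k..N}. \<Sum>m\<in>{- int l..int l}. a l m r \<omega> * sY (int (spin k)) l m \<theta> \<phi>)))\<^sup>2) \<longlonglongrightarrow> 0"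
    if "r \<in> chi_range K" "\<theta> \<in> {0..pi}" for r \<theta> \<phi>
  proof -
    obtain \<phi>' where \<phi>': "\<phi>' \<in> {0..2 * pi}"
      "\<And>X r \<theta> \<omega>. field_value (X :: real \<Rightarrow> real^3 \<Rightarrow> 'w \<Rightarrow> bundle_point set) r \<theta> \<phi> \<omega> = field_value X r \<theta> \<phi>' \<omega>"
      "\<And>s l m \<theta>. sY s l m \<theta> \<phi> = sY s l m \<theta> \<phi>'"
      using field_value_wrap[of \<phi>] by blast
    have "(\<theta>, \<phi>') \<in> sphere_domain" using that \<phi>'(1) by (simp add: sphere_domain_def)
    from F_expansion[OF that(1) this] show ?thesis
      unfolding \<phi>'(2,3) by (simp add: F_def S_def)
  qed
  have unc: "(LINT \<omega>|M. a l m r1 \<omega> * cnj (a l' m' r2 \<omega>)) - (LINT \<omega>|M. a l m r1 \<omega>) * cnj (LINT \<omega>|M. a l' m' r2 \<omega>) = 0"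
    if "r1 \<in> chi_range K" "r2 \<in> chi_range K"
      "spin k \<le> l \<and> \<bar>m\<bar> \<le> int l \<and> spin k \<le> l' \<and> \<bar>m'\<bar> \<le> int l' \<and> (l, m) \<noteq> (l', m')" for l m l' m' r1 r2
    using that a_covariance[of r1 r2 l m l' m'] a_mean[of r1 l m] by auto
  have summ: "(\<lambda>l. of_nat (2 * l + 1) * C l r r) summable_on {spin k..}" if "r \<in> chi_range K" for r
  proof -
    have "summable (\<lambda>l. 4 * pi * majorant l r)" by (intro summable_mult majorant_summable that)
    moreover have "4 * pi * majorant l r = norm (if spin k \<le> l then of_nat (2 * l + 1) * C l r r else 0)" for l
    proof -
      have "norm (of_nat (2 * l + 1) * C l r r) = real (2 * l + 1) * Cr l r"
        using Cr_nonneg[of l r] by (simp only: norm_mult norm_of_nat C_Cr norm_of_real abs_of_nonneg)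
      also have "\<dots> = 4 * pi * (Cr l r * (real (2 * l + 1) / (4 * pi)))"
        by simp
      finally show ?thesis unfolding majorant_def by (simp only: norm_zero mult_zero_right split: if_split) simp
    qed
    ultimately have "summable (\<lambda>l. norm (if spin k \<le> l then of_nat (2 * l + 1) * C l r r else 0))"
      by (simp only:)
    then have "(\<lambda>l. if spin k \<le> l then of_nat (2 * l + 1) * C l r r else 0) summable_on UNIV"
      by (rule norm_summable_imp_summable_on)
    then show ?thesis
      by (rule summable_on_cong_neutral[THEN iffD1, rotated -1]) auto
  qed
  have corr: "((\<lambda>l. of_real (1 / (2 * sqrt pi)) * (C l r1 r2 * of_real (sqrt (real (2 * l + 1))) *
              sY (int (spin k)) l (- int (spin k)) \<beta> 0 *
              exp (- \<i> * of_nat (spin k) * of_real (\<alpha> + \<gamma>))))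
         has_sum correlation M X r1 \<theta>1 \<phi>1 r2 \<theta>2 \<phi>2) {spin k..}"
    if r: "r1 \<in> chi_range K" "r2 \<in> chi_range K" and \<theta>: "\<theta>1 \<in> {0..pi}" "\<theta>2 \<in> {0..pi}"
      and rel: "relative_euler_angles \<theta>1 \<phi>1 \<theta>2 \<phi>2 \<alpha> \<beta> \<gamma>" for r1 r2 \<theta>1 \<theta>2 \<phi>1 \<phi>2 \<alpha> \<beta> \<gamma>
  proof -
    obtain \<phi>1' where \<phi>1': "\<phi>1' \<in> {0..2 * pi}"
      "\<And>X r \<theta> \<omega>. field_value (X :: real \<Rightarrow> real^3 \<Rightarrow> 'w \<Rightarrow> bundle_point set) r \<theta> \<phi>1 \<omega> = field_value X r \<theta> \<phi>1' \<omega>"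
      "\<And>s l m \<theta>. sY s l m \<theta> \<phi>1 = sY s l m \<theta> \<phi>1'"
      using field_value_wrap[of \<phi>1] by blast
    obtain \<phi>2' where \<phi>2': "\<phi>2' \<in> {0..2 * pi}"
      "\<And>X r \<theta> \<omega>. field_value (X :: real \<Rightarrow> real^3 \<Rightarrow> 'w \<Rightarrow> bundle_point set) r \<theta> \<phi>2 \<omega> = field_value X r \<theta> \<phi>2' \<omega>"
      "\<And>s l m \<theta>. sY s l m \<theta> \<phi>2 = sY s l m \<theta> \<phi>2'"
      using field_value_wrap[of \<phi>2] by blast
    have x: "(\<theta>1, \<phi>1') \<in> sphere_domain" "(\<theta>2, \<phi>2') \<in> sphere_domain"
      using \<theta> \<phi>1'(1) \<phi>2'(1) by (auto simp: sphere_domain_def)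
    have e: "exp (- \<i> * of_nat (spin k) * of_real (\<alpha> + \<gamma>)) = cis (- (of_nat (spin k) * (\<alpha> + \<gamma>)))"
      by (simp add: cis_conv_exp mult.assoc)
    have "((\<lambda>l. C l r1 r2 * kernel l (\<theta>1, \<phi>1') (\<theta>2, \<phi>2')) has_sum correlation M X r1 \<theta>1 \<phi>1 r2 \<theta>2 \<phi>2) {spin k..}"
      using covariance_has_sum[OF r x] unfolding correlation_def \<phi>1'(2) \<phi>2'(2) F_def fst_conv snd_conv .
    moreover have "C l r1 r2 * kernel l (\<theta>1, \<phi>1') (\<theta>2, \<phi>2') = of_real (1 / (2 * sqrt pi)) * (C l r1 r2 * of_real (sqrt (real (2 * l + 1))) *
              sY (int (spin k)) l (- int (spin k)) \<beta> 0 * exp (- \<i> * of_nat (spin k) * of_real (\<alpha> + \<gamma>)))"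
      if "l \<in> {spin k..}" for l
    proof -
      have "kernel l (\<theta>1, \<phi>1') (\<theta>2, \<phi>2') = kernel l (\<theta>1, \<phi>1) (\<theta>2, \<phi>2)"
        unfolding kernel_def fst_conv snd_conv \<phi>1'(3) \<phi>2'(3) ..
      then show ?thesis
        unfolding e using kernel_relative_euler[OF _ rel, of l] that by (simp add: mult_ac)
    qed
    ultimately show ?thesis
      by (rule has_sum_cong[THEN iffD1, rotated -1]) auto
  qed
  have inv: "(\<lambda>\<beta>. correlation M X r1 0 0 r2 \<beta> 0 *
          cnj (sY (int (spin k)) l (- int (spin k)) \<beta> 0) * of_real (sin \<beta>)) integrable_on {0..pi} \<and>
       C l r1 r2 = of_real (4 * pi powr (3 / 2) / sqrt (real (2 * l + 1))) *
         integral {0..pi} (\<lambda>\<beta>. correlation M X r1 0 0 r2 \<beta> 0 *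
           cnj (sY (int (spin k)) l (- int (spin k)) \<beta> 0) * of_real (sin \<beta>))"
    if r: "r1 \<in> chi_range K" "r2 \<in> chi_range K" and l: "spin k \<le> l" for r1 r2 l
  proof -
    \<comment> \<open>The factor produced by \<open>inversion\<close> is
      \<open>sqrt (2 l + 1) / (4 pi sqrt pi)\<close>; the prefactor in the statement is its
      inverse.\<close>
    have "pi powr (3 / 2) = pi powr (1 + 1 / 2)" by simp
    also have "\<dots> = pi * sqrt pi" unfolding powr_add by (simp add: powr_half_sqrt)
    finally have "4 * pi powr (3 / 2) / sqrt (real (2 * l + 1)) * (sqrt (real (2 * l + 1)) / (2 * sqrt pi) / (2 * pi)) = 1"
      by simp
    then have c: "complex_of_real (4 * pi powr (3 / 2) / sqrt (real (2 * l + 1))) * of_real (sqrt (real (2 * l + 1)) / (2 * sqrt pi) / (2 * pi)) = 1"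
      by (simp only: of_real_mult[symmetric] of_real_1)
    have "z = A * (z * B)" if "A * B = 1" for z A B :: complex
      using that by (metis mult.left_commute mult.right_neutral)
    then show ?thesis
      using inversion[OF r l] c unfolding has_integral_iff by simp
  qed
  show ?thesis
  proof (intro exI[of _ a] exI[of _ C] conjI, goal_cases)
    case 1
    show ?case using a_ms_continuous by simp
  next
    case 2
    show ?case using lims by simp
  next
    case 3
    show ?case by (intro allI ballI impI unc)
  next
    case 4
    show ?case by (intro allI ballI impI a_covariance) auto
  next
    case 5
    show ?case using a_nonnegative_definite by simp
  next
    case 6
    show ?case by (intro ballI summ)
  next
    case 7
    show ?case using C_origin by simp
  next
    case 8
    show ?case by (intro allI ballI impI corr)
  next
    case 9
    show ?case by (intro allI ballI impI inv)
  qed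
qed

end
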